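(* Let $d\geq 1$ be an integer, let $s>\frac32$, let $v_0\in H^s(\mathbb{R})$ and put $n_0=v_0-d\,\partial_x^2v_0$. Assume that for some point $x_0\in\mathbb{R}$ one has $n_0\geq 0$ on $(-\infty,x_0]$ and $n_0\leq 0$ on $[x_0,+\infty)$, and that $n_0$ changes sign. Then the corresponding solution $v$ of the Cauchy problem $$\partial_tv+d\,v\,\partial_xv=-\partial_x(1-d\,\partial_x^2)^{-1}\Big(d\,v^2+\frac{d^2}{2}(\partial_xv)^2\Big),\quad (t,x)\in\mathbb{R}^+\times\mathbb{R},\qquad v(0,x)=v_0(x),$$ blows up in finite time, i.e. its maximal existence time $T$ is finite.
   Context: Here $(1-d\,\partial_x^2)^{-1}f=p_d*f$ with $p_d(x)=\frac{1}{2\sqrt d}\,e^{-|x|/\sqrt d}$. For $v_0\in H^s(\mathbb{R})$ with $s>\frac32$, the Cauchy problem is locally well posed: there is a unique strong solution $v\in C([0,T);H^s(\mathbb{R}))\cap C^1([0,T);H^{s-1}(\mathbb{R}))$ on a maximal time interval $[0,T)$, $0<T\le\infty$; this is "the corresponding solution" and $T$ is its maximal existence time. Since $n_0\in H^{s-2}(\mathbb{R})$ need not be a function, the sign conditions on $n_0$ are understood in the sense of distributions (on the interiors of the indicated intervals) when $n_0$ is not a function, and almost everywhere when it is. "$n_0$ changes sign" means that neither $n_0\geq0$ on $\mathbb{R}$ nor $n_0\leq 0$ on $\mathbb{R}$ holds. *)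

theory Defs
  imports "HOL-Analysis.Analysis"
begin

section \<open>Test functions and Schwartz functions\<close>

definition nth_vderiv :: "nat \<Rightarrow> (real \<Rightarrow> 'a::real_normed_vector) \<Rightarrow> real \<Rightarrow> 'a" where
  "nth_vderiv k f = ((\<lambda>g x. vector_derivative g (at x)) ^^ k) f"

definition smooth :: "(real \<Rightarrow> 'a::real_normed_vector) \<Rightarrow> bool" where
  "smooth f \<longleftrightarrow> (\<forall>k x. nth_vderiv k f differentiable (at x))"

definition support :: "(real \<Rightarrow> real) \<Rightarrow> real set" where
  "support f = closure {x. f x \<noteq> 0}"

definition test_function :: "(real \<Rightarrow> real) \<Rightarrow> bool" where
  "test_function \<phi> \<longleftrightarrow> smooth \<phi> \<and> compact (support \<phi>)"

definition schwartz :: "(real \<Rightarrow> complex) \<Rightarrow> bool" where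
  "schwartz \<phi> \<longleftrightarrow>
     smooth \<phi> \<and> (\<forall>j k. bounded (range (\<lambda>x. (x ^ j) *\<^sub>R nth_vderiv k \<phi> x)))"

section \<open>Sobolev spaces of nonnegative order\<close>

definition square_integrable :: "(real \<Rightarrow> 'a::real_normed_vector) \<Rightarrow> bool" where
  "square_integrable f \<longleftrightarrow>
     f \<in> borel_measurable lborel \<and> integrable lborel (\<lambda>x. (norm (f x))\<^sup>2)"

definition fourier :: "(real \<Rightarrow> complex) \<Rightarrow> real \<Rightarrow> complex" where
  "fourier \<phi> \<xi> = (1 / sqrt (2 * pi)) *\<^sub>R (LINT x|lborel. cis (- (x * \<xi>)) * \<phi> x)"

text \<open>The Fourier transform of an \<open>L\<^sup>2\<close> function, taken in the sense of tempered distributions.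
  It is determined up to null sets.\<close>

definition has_fourier :: "(real \<Rightarrow> complex) \<Rightarrow> (real \<Rightarrow> complex) \<Rightarrow> bool" where
  "has_fourier f g \<longleftrightarrow> square_integrable f \<and> square_integrable g \<and>
     (\<forall>\<phi>. schwartz \<phi> \<longrightarrow>
        (LINT \<xi>|lborel. g \<xi> * \<phi> \<xi>) = (LINT x|lborel. f x * fourier \<phi> x))"

definition fourier_L2 :: "(real \<Rightarrow> complex) \<Rightarrow> real \<Rightarrow> complex" where
  "fourier_L2 f = (SOME g. has_fourier f g)"

text \<open>The real-valued functions in \<open>H\<^sup>s\<close>, for \<open>s \<ge> 0\<close> only (so that \<open>H\<^sup>s \<subseteq> L\<^sup>2\<close>). Elements are
  functions rather than classes of functions: equality in \<open>H\<^sup>s\<close> is equality almost everywhere.\<close>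

definition sobolev :: "real \<Rightarrow> (real \<Rightarrow> real) set" where
  "sobolev s = {f. \<exists>g. has_fourier (\<lambda>x. complex_of_real (f x)) g \<and>
     square_integrable (\<lambda>\<xi>. ((1 + \<xi>\<^sup>2) powr (s / 2)) *\<^sub>R g \<xi>)}"

definition sobolev_norm :: "real \<Rightarrow> (real \<Rightarrow> real) \<Rightarrow> real" where
  "sobolev_norm s f =
     sqrt (LINT \<xi>|lborel. (1 + \<xi>\<^sup>2) powr s * (norm (fourier_L2 (\<lambda>x. complex_of_real (f x)) \<xi>))\<^sup>2)"

definition continuous_into_sobolev :: "real set \<Rightarrow> real \<Rightarrow> (real \<Rightarrow> real \<Rightarrow> real) \<Rightarrow> bool" where
  "continuous_into_sobolev I s v \<longleftrightarrow> (\<forall>t\<in>I. v t \<in> sobolev s \<and>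
     ((\<lambda>\<tau>. sobolev_norm s (\<lambda>x. v \<tau> x - v t x)) \<longlongrightarrow> 0) (at t within I))"

definition has_sobolev_derivative ::
    "real set \<Rightarrow> real \<Rightarrow> (real \<Rightarrow> real \<Rightarrow> real) \<Rightarrow> (real \<Rightarrow> real \<Rightarrow> real) \<Rightarrow> bool" where
  "has_sobolev_derivative I s v w \<longleftrightarrow> (\<forall>t\<in>I.
     ((\<lambda>\<tau>. sobolev_norm s (\<lambda>x. (v \<tau> x - v t x) / (\<tau> - t) - w t x)) \<longlongrightarrow> 0) (at t within I))"

section \<open>Weak derivatives and distributions\<close>

definition locally_integrable :: "(real \<Rightarrow> real) \<Rightarrow> bool" where
  "locally_integrable f \<longleftrightarrow> (\<forall>a b. set_integrable lborel {a..b} f)"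

definition has_weak_derivative :: "(real \<Rightarrow> real) \<Rightarrow> (real \<Rightarrow> real) \<Rightarrow> bool" where
  "has_weak_derivative f g \<longleftrightarrow> locally_integrable f \<and> locally_integrable g \<and>
     (\<forall>\<phi>. test_function \<phi> \<longrightarrow>
        (LINT x|lborel. f x * nth_vderiv 1 \<phi> x) = - (LINT x|lborel. g x * \<phi> x))"

text \<open>A distribution is given by its action on test functions; its values at other functions
  are irrelevant.\<close>

type_synonym distribution = "(real \<Rightarrow> real) \<Rightarrow> real"

definition is_function :: "distribution \<Rightarrow> (real \<Rightarrow> real) \<Rightarrow> bool" where
  "is_function n f \<longleftrightarrow> locally_integrable f \<and>
     (\<forall>\<phi>. test_function \<phi> \<longrightarrow> n \<phi> = (LINT x|lborel. f x * \<phi> x))"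

definition nonneg_on :: "distribution \<Rightarrow> real set \<Rightarrow> bool" where
  "nonneg_on n I \<longleftrightarrow>
     (if \<exists>f. is_function n f
      then \<exists>f. is_function n f \<and> (AE x in lborel. x \<in> I \<longrightarrow> 0 \<le> f x)
      else \<forall>\<phi>. test_function \<phi> \<and> (\<forall>x. 0 \<le> \<phi> x) \<and> support \<phi> \<subseteq> interior I \<longrightarrow> 0 \<le> n \<phi>)"

definition nonpos_on :: "distribution \<Rightarrow> real set \<Rightarrow> bool" where
  "nonpos_on n I \<longleftrightarrow> nonneg_on (\<lambda>\<phi>. - n \<phi>) I"

definition changes_sign :: "distribution \<Rightarrow> bool" where
  "changes_sign n \<longleftrightarrow> \<not> nonneg_on n UNIV \<and> \<not> nonpos_on n UNIV"

text \<open>The distribution \<open>u - d \<partial>\<^sub>x\<^sup>2 u\<close>, with both derivatives moved to the test function.\<close>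

definition momentum :: "nat \<Rightarrow> (real \<Rightarrow> real) \<Rightarrow> distribution" where
  "momentum d u \<phi> = (LINT x|lborel. u x * (\<phi> x - real d * nth_vderiv 2 \<phi> x))"

section \<open>The Cauchy problem\<close>

definition kernel :: "nat \<Rightarrow> real \<Rightarrow> real" where
  "kernel d x = exp (- \<bar>x\<bar> / sqrt (real d)) / (2 * sqrt (real d))"

definition inverse_helmholtz :: "nat \<Rightarrow> (real \<Rightarrow> real) \<Rightarrow> real \<Rightarrow> real" where
  "inverse_helmholtz d f x = (LINT y|lborel. kernel d (x - y) * f y)"

definition time_interval :: "ereal \<Rightarrow> real set" where
  "time_interval T = {t. 0 \<le> t \<and> ereal t < T}"

text \<open>The solution is \<open>v t x\<close>; in the definition \<open>w\<close>, \<open>vx\<close> and \<open>q\<close> stand for \<open>\<partial>\<^sub>t v\<close>, \<open>\<partial>\<^sub>x v\<close> and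
  \<open>\<partial>\<^sub>x (1 - d \<partial>\<^sub>x\<^sup>2)\<^sup>-\<^sup>1 (d v\<^sup>2 + d\<^sup>2/2 (\<partial>\<^sub>x v)\<^sup>2)\<close>, each unique up to null sets. The derivative in
  time is one-sided at \<open>t = 0\<close>.\<close>

definition strong_solution ::
    "nat \<Rightarrow> real \<Rightarrow> (real \<Rightarrow> real) \<Rightarrow> ereal \<Rightarrow> (real \<Rightarrow> real \<Rightarrow> real) \<Rightarrow> bool" where
  "strong_solution d s v0 T v \<longleftrightarrow>
     0 < T \<and>
     (AE x in lborel. v 0 x = v0 x) \<and>
     continuous_into_sobolev (time_interval T) s v \<and>
     (\<exists>w. continuous_into_sobolev (time_interval T) (s - 1) w \<and>
          has_sobolev_derivative (time_interval T) (s - 1) v w \<and>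
          (\<forall>t\<in>time_interval T. \<exists>vx q.
             has_weak_derivative (v t) vx \<and>
             has_weak_derivative
               (inverse_helmholtz d
                  (\<lambda>x. real d * (v t x)\<^sup>2 + (real d)\<^sup>2 / 2 * (vx x)\<^sup>2)) q \<and>
             (AE x in lborel. w t x + real d * v t x * vx x = - q x)))"

definition maximal_solution ::
    "nat \<Rightarrow> real \<Rightarrow> (real \<Rightarrow> real) \<Rightarrow> ereal \<Rightarrow> (real \<Rightarrow> real \<Rightarrow> real) \<Rightarrow> bool" where
  "maximal_solution d s v0 T v \<longleftrightarrow>
     strong_solution d s v0 T v \<and>
     \<not> (\<exists>T' u. T < T' \<and> strong_solution d s v0 T' u \<and>
          (\<forall>t\<in>time_interval T. AE x in lborel. u t x = v t x))"

end

theory Submission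
  imports Defs "HOL-Probability.Probability"
begin

text \<open>
  Put \<open>c = sqrt d\<close>, \<open>f = d v\<^sup>2 + (d\<^sup>2/2) v\<^sub>x\<^sup>2\<close> and \<open>P = \<partial>\<^sub>x (1 - d \<partial>\<^sub>x\<^sup>2)\<^sup>-\<^sup>1 f\<close>, so that the equation
  reads \<open>v\<^sub>t + d v v\<^sub>x = - P\<close>. It suffices to refute a strong solution that lives on all of \<open>[0, \<infinity>)\<close>.

  Follow a characteristic \<open>q' = d v(t, q)\<close> and put \<open>a = - (v + c v\<^sub>x)\<close> and \<open>b = v - c v\<^sub>x\<close> at \<open>(t, q(t))\<close>.
  The kernel of \<open>(1 - d \<partial>\<^sub>x\<^sup>2)\<^sup>-\<^sup>1\<close> is a multiple of a sum of two one-sided exponentials; write \<open>R\<close> and \<open>L\<close> for the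
  convolutions of \<open>f\<close> with them. Differentiating the equation in \<open>x\<close> gives
  \<open>a' = R/c\<^sup>2 - c v\<^sup>2 + (c\<^sup>3/2) v\<^sub>x\<^sup>2\<close>, and the same formula for \<open>b'\<close> with \<open>L\<close> in place of \<open>R\<close>. Both \<open>R\<close> and \<open>L\<close> are at
  least \<open>(c\<^sup>3/2) v\<^sup>2\<close> (\<open>right_potential_lower_bound\<close>), hence \<open>a'\<close> and \<open>b'\<close> are at least \<open>(c/2) (c\<^sup>2 v\<^sub>x\<^sup>2 - v\<^sup>2) = (c/2) a b\<close>. If \<open>a\<close>
  and \<open>b\<close> are positive initially, they remain so, and \<open>m = min a b\<close> grows at least like a solution of
  \<open>m' = (c/2) m\<^sup>2\<close>, which does not survive the time \<open>2/(c m(0))\<close> (\<open>blowup_time_bound\<close>).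

  The sign of the momentum \<open>n\<close> of \<open>v\<^sub>0\<close> makes \<open>a\<close> and \<open>b\<close> positive at the point \<open>x\<^sub>0\<close> (\<open>initial_slope\<close>). Indeed
  \<open>(v\<^sub>0 - c v\<^sub>0') e\<^bsup>x/c\<^esup>\<close> has the derivative \<open>n e\<^bsup>x/c\<^esup>/c\<close>, so it increases from \<open>0\<close> on \<open>(-\<infinity>, x\<^sub>0]\<close>, and it
  cannot vanish at \<open>x\<^sub>0\<close>, because then \<open>n\<close> would vanish to the left of \<open>x\<^sub>0\<close> and would be nonpositive
  everywhere. The function \<open>(v\<^sub>0 + c v\<^sub>0') e\<^bsup>-x/c\<^esup>\<close> is treated in the same way on \<open>[x\<^sub>0, \<infinity>)\<close>.

  Two points need care. First, \<open>s > 3/2\<close> makes \<open>v\<close> continuously differentiable in \<open>x\<close> (\<open>sobolev_C1_representative\<close>), but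
  \<open>v\<^sub>x\<^sub>x\<close> need not exist, so that the equation cannot be differentiated. The difference quotients
  \<open>(v(t, q + h) - v(t, q))/h\<close>, however, do satisfy a differential equation, and dominated convergence for
  \<open>h \<rightarrow> 0\<close> turns it into an integral equation for \<open>v\<^sub>x\<close> along \<open>q\<close>, which is all that the comparison
  argument uses. Secondly, uniqueness statements (for Fourier transforms, weak derivatives and
  distributions) all have to be obtained from test functions. They are reduced to the uniqueness theorem
  of Levy for characteristic functions: an integrable function whose Fourier transform vanishes is zero
  almost everywhere (\<open>fourier_zero_imp_AE_zero\<close>), and the integrable functions are products with a Gaussian or with a bump function.
\<close>


section \<open>Smooth functions and bump functions\<close>

lemma nth_vderiv_Suc: "nth_vderiv (Suc k) f = nth_vderiv k (\<lambda>x. vector_derivative f (at x))"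
  unfolding nth_vderiv_def by (simp only: funpow_Suc_right o_apply)

lemma nth_vderiv_0: "nth_vderiv 0 f = f"
  unfolding nth_vderiv_def by simp

lemma vector_derivative_eqI:
  assumes "\<And>x. (f has_vector_derivative f' x) (at x)"
  shows "(\<lambda>x. vector_derivative f (at x)) = f'"
  using assms vector_derivative_at by blast

lemma nth_vderiv_1:
  assumes "\<And>x. (f has_vector_derivative f' x) (at x)"
  shows "nth_vderiv 1 f = f'"
  using vector_derivative_eqI[OF assms] by (simp add: nth_vderiv_Suc nth_vderiv_0)

text \<open>Iterated derivatives are handled by coinduction: a class of functions that is closed under taking the
  derivative contains all the iterated derivatives of its members, so that no explicit formula for them is
  ever needed.\<close>

lemma nth_vderiv_invariant:
  assumes step: "\<And>f. P f \<Longrightarrow> \<exists>f'. P f' \<and> (\<forall>x. (f has_vector_derivative f' x) (at x))"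
    and "P f"
  shows "P (nth_vderiv k f)"
  using \<open>P f\<close>
proof (induction k arbitrary: f)
  case 0
  then show ?case by (simp add: nth_vderiv_0)
next
  case (Suc k)
  obtain f' where "P f'" "\<And>x. (f has_vector_derivative f' x) (at x)"
    using step[OF Suc.prems] by blast
  then show ?case
    using Suc.IH[of f'] vector_derivative_eqI[of f f'] by (simp add: nth_vderiv_Suc)
qed

lemma smooth_coinduct:
  assumes step: "\<And>f. P f \<Longrightarrow> \<exists>f'. P f' \<and> (\<forall>x. (f has_vector_derivative f' x) (at x))"
    and "P f"
  shows "smooth f"
  unfolding smooth_def
proof (intro allI)
  fix k x
  have "P (nth_vderiv k f)" using nth_vderiv_invariant[of P, OF step \<open>P f\<close>] by blast
  then show "nth_vderiv k f differentiable (at x)"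
    using step differentiableI_vector by metis
qed

lemma smooth_derivative:
  assumes "smooth f"
  obtains f' where "smooth f'" "\<And>x. (f has_vector_derivative f' x) (at x)"
    "nth_vderiv 1 f = f'" "\<And>k. nth_vderiv (Suc k) f = nth_vderiv k f'"
proof -
  let ?f' = "\<lambda>x. vector_derivative f (at x)"
  have "nth_vderiv 0 f differentiable (at x)" for x
    using assms unfolding smooth_def by blast
  then have d: "(f has_vector_derivative ?f' x) (at x)" for x
    by (simp add: nth_vderiv_0 vector_derivative_works[symmetric])
  have "smooth ?f'"
    using assms unfolding smooth_def by (metis nth_vderiv_Suc)
  then show thesis using that[of ?f'] d nth_vderiv_Suc[of _ f] nth_vderiv_1[OF d] by blast
qed

text \<open>Products of two smooth functions are not closed under differentiation, but their finite sums are, by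
  the Leibniz rule; this is the class to which the coinduction is applied.\<close>

inductive sums_of_products :: "(real \<Rightarrow> 'a::real_normed_algebra) \<Rightarrow> bool" where
  prod: "smooth f \<Longrightarrow> smooth g \<Longrightarrow> sums_of_products (\<lambda>x. f x * g x)"
| add: "sums_of_products f \<Longrightarrow> sums_of_products g \<Longrightarrow> sums_of_products (\<lambda>x. f x + g x)"

lemma smooth_sums_of_products:
  assumes "sums_of_products f" shows "smooth f"
proof (rule smooth_coinduct[of sums_of_products])
  fix f :: "real \<Rightarrow> 'a"
  assume "sums_of_products f"
  then show "\<exists>f'. sums_of_products f' \<and> (\<forall>x. (f has_vector_derivative f' x) (at x))"
  proof induction
    case (prod f g)
    obtain f' g' where "smooth f'" "smooth g'"
      and d: "\<And>x. (f has_vector_derivative f' x) (at x)" "\<And>x. (g has_vector_derivative g' x) (at x)"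
      using smooth_derivative prod by metis
    then have "sums_of_products (\<lambda>x. f x * g' x + f' x * g x)"
      using prod by (intro sums_of_products.intros)
    moreover have "((\<lambda>x. f x * g x) has_vector_derivative f x * g' x + f' x * g x) (at x)" for x
      using has_vector_derivative_mult[OF d(1) d(2), of x] .
    ultimately show ?case by (intro exI conjI allI) auto
  next
    case (add f g)
    then obtain f' g' where *: "sums_of_products f'" "sums_of_products g'"
      "\<And>x. (f has_vector_derivative f' x) (at x)" "\<And>x. (g has_vector_derivative g' x) (at x)"
      by blast
    show ?case
      by (rule exI[of _ "\<lambda>x. f' x + g' x"])
         (use * in \<open>auto intro!: sums_of_products.add derivative_intros\<close>)
  qed
qed fact

lemma smooth_mult:
  fixes f g :: "real \<Rightarrow> 'a::real_normed_algebra"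
  assumes "smooth f" "smooth g"
  shows "smooth (\<lambda>x. f x * g x)"
  by (rule smooth_sums_of_products, rule sums_of_products.prod) fact+

lemma smooth_trig: "smooth (\<lambda>x::real. a * cos (\<eta> * x) + b * sin (\<eta> * x))"
proof (rule smooth_coinduct[of "\<lambda>f. \<exists>a b. f = (\<lambda>x. a * cos (\<eta> * x) + b * sin (\<eta> * x))"])
  fix f assume "\<exists>a b. f = (\<lambda>x. a * cos (\<eta> * x) + b * sin (\<eta> * x))"
  then obtain a b where f: "f = (\<lambda>x. a * cos (\<eta> * x) + b * sin (\<eta> * x))" by blast
  have "(f has_vector_derivative (b * \<eta>) * cos (\<eta> * x) + (- a * \<eta>) * sin (\<eta> * x)) (at x)" for x
    unfolding f has_real_derivative_iff_has_vector_derivative[symmetric]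
    by (auto intro!: derivative_eq_intros simp: algebra_simps)
  then show "\<exists>f'. (\<exists>a b. f' = (\<lambda>x. a * cos (\<eta> * x) + b * sin (\<eta> * x))) \<and>
      (\<forall>x. (f has_vector_derivative f' x) (at x))"
    by (intro exI[of _ "\<lambda>x. (b * \<eta>) * cos (\<eta> * x) + (- a * \<eta>) * sin (\<eta> * x)"]) blast
qed blast

lemma smooth_exp: "smooth (\<lambda>x::real. exp (k * x))"
proof -
  have "smooth (\<lambda>x. 1 * exp (k * x))"
  proof (rule smooth_coinduct[of "\<lambda>f. \<exists>a::real. f = (\<lambda>x. a * exp (k * x))"])
    fix f assume "\<exists>a. f = (\<lambda>x. a * exp (k * x))"
    then obtain a where f: "f = (\<lambda>x. a * exp (k * x))" by blast
    have "(f has_vector_derivative (a * k) * exp (k * x)) (at x)" for x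
      unfolding f has_real_derivative_iff_has_vector_derivative[symmetric]
      by (auto intro!: derivative_eq_intros)
    then show "\<exists>f'. (\<exists>a. f' = (\<lambda>x. a * exp (k * x))) \<and> (\<forall>x. (f has_vector_derivative f' x) (at x))"
      by (intro exI[of _ "\<lambda>x. (a * k) * exp (k * x)"]) blast
  qed blast
  then show ?thesis by simp
qed

lemma smooth_affine:
  fixes f :: "real \<Rightarrow> real"
  assumes "smooth f" shows "smooth (\<lambda>x. f (m * x + k))"
proof -
  have "smooth (\<lambda>x. 1 * f (m * x + k))"
  proof (rule smooth_coinduct[of "\<lambda>g. \<exists>a f. smooth f \<and> g = (\<lambda>x. a * f (m * x + k))"])
    fix g :: "real \<Rightarrow> real"
    assume "\<exists>a f. smooth f \<and> g = (\<lambda>x. a * f (m * x + k))"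
    then obtain a f where f: "smooth f" and g: "g = (\<lambda>x. a * f (m * x + k))" by blast
    obtain f' where f': "smooth f'" "\<And>x. (f has_vector_derivative f' x) (at x)"
      using smooth_derivative[OF f] by metis
    have d: "(f has_real_derivative f' x) (at x)" for x
      using f'(2) by (simp add: has_real_derivative_iff_has_vector_derivative)
    have "(g has_vector_derivative (a * m) * f' (m * x + k)) (at x)" for x
      unfolding g has_real_derivative_iff_has_vector_derivative[symmetric]
      by (auto intro!: derivative_eq_intros DERIV_chain2[OF d])
    then show "\<exists>g'. (\<exists>a f. smooth f \<and> g' = (\<lambda>x. a * f (m * x + k))) \<and>
        (\<forall>x. (g has_vector_derivative g' x) (at x))"
      using f'(1) by (intro exI[of _ "\<lambda>x. (a * m) * f' (m * x + k)"]) blast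
  qed (use assms in blast)
  then show ?thesis by simp
qed

lemma smooth_diff:
  fixes f g :: "real \<Rightarrow> real"
  assumes "smooth f" "smooth g" shows "smooth (\<lambda>x. f x - g x)"
proof (rule smooth_coinduct[of "\<lambda>h. \<exists>f g. smooth f \<and> smooth g \<and> h = (\<lambda>x. f x - g x)"])
  fix h :: "real \<Rightarrow> real"
  assume "\<exists>f g. smooth f \<and> smooth g \<and> h = (\<lambda>x. f x - g x)"
  then obtain f g where "smooth f" "smooth g" and h: "h = (\<lambda>x. f x - g x)" by blast
  then obtain f' g' where *: "smooth f'" "smooth g'"
      "\<And>x. (f has_vector_derivative f' x) (at x)" "\<And>x. (g has_vector_derivative g' x) (at x)"
    using smooth_derivative by metis
  show "\<exists>h'. (\<exists>f g. smooth f \<and> smooth g \<and> h' = (\<lambda>x. f x - g x)) \<and>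
      (\<forall>x. (h has_vector_derivative h' x) (at x))"
    by (rule exI[of _ "\<lambda>x. f' x - g' x"]) (use * in \<open>auto simp: h intro!: derivative_intros\<close>)
qed (use assms in blast)

lemma smooth_primitive:
  assumes "smooth f" "\<And>x. (F has_vector_derivative f x) (at x)"
  shows "smooth F"
proof (rule smooth_coinduct[of "\<lambda>g. g = F \<or> smooth g"])
  fix g assume "g = F \<or> smooth g"
  then show "\<exists>g'. (g' = F \<or> smooth g') \<and> (\<forall>x. (g has_vector_derivative g' x) (at x))"
    using assms smooth_derivative by metis
qed blast

text \<open>The functions \<open>p(1/x) e\<^bsup>-1/x\<^esup>\<close> on the positive half-line, extended by \<open>0\<close>. The polynomial is a
  parameter because the derivative of \<open>e\<^bsup>-1/x\<^esup>\<close> brings in a polynomial in \<open>1/x\<close>, and the whole family is then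
  closed under differentiation.\<close>

definition flat :: "real poly \<Rightarrow> real \<Rightarrow> real" where
  "flat p x = (if 0 < x then poly p (1 / x) * exp (- (1 / x)) else 0)"


text \<open>Only the origin is delicate: the difference quotient there is \<open>(1/h) p(1/h) e\<^bsup>-1/h\<^esup>\<close>, which is
  again a polynomial against an exponential at infinity in the variable \<open>1/h\<close>.\<close>

lemma flat_has_derivative:
  "(flat p has_real_derivative flat ([:0, 0, 1:] * (p - pderiv p)) x) (at x)"
proof -
  have tend: "((\<lambda>t::real. poly p t * exp (- t)) \<longlongrightarrow> 0) at_top" for p :: "real poly"
  proof -
    have "((\<lambda>t::real. t ^ i * exp (- t)) \<longlongrightarrow> 0) at_top" for i
      using tendsto_power_div_exp_0[of i] by (simp add: exp_minus field_simps)
    then have "((\<lambda>t. \<Sum>i\<le>degree p. coeff p i * (t ^ i * exp (- t))) \<longlongrightarrow> (\<Sum>i\<le>degree p. coeff p i * 0)) at_top"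
      by (intro tendsto_intros)
    then show ?thesis by (simp add: poly_altdef sum_distrib_right mult.assoc)
  qed
  consider "x > 0" | "x < 0" | "x = 0" by linarith
  then show ?thesis
  proof cases
    case 1
    have "((\<lambda>x. poly p (1 / x) * exp (- (1 / x))) has_real_derivative
        flat ([:0, 0, 1:] * (p - pderiv p)) x) (at x)"
      using 1 by (auto intro!: derivative_eq_intros DERIV_chain2[OF poly_DERIV]
          simp: flat_def field_simps power2_eq_square)
    then show ?thesis
      by (rule DERIV_cong_ev[OF refl _ refl, THEN iffD1, rotated])
         (use 1 in \<open>auto simp: flat_def intro!: eventually_mono[OF eventually_nhds_in_open[of "{0<..}"]]\<close>)
  next
    case 2
    have "((\<lambda>x. 0) has_real_derivative flat ([:0, 0, 1:] * (p - pderiv p)) x) (at x)"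
      using 2 by (simp add: flat_def)
    then show ?thesis
      by (rule DERIV_cong_ev[OF refl _ refl, THEN iffD1, rotated])
         (use 2 in \<open>auto simp: flat_def intro!: eventually_mono[OF eventually_nhds_in_open[of "{..<0}"]]\<close>)
  next
    case 3
    have "((\<lambda>h. flat p h / h) \<longlongrightarrow> 0) (at_right 0)"
    proof -
      have "((\<lambda>h::real. poly (pCons 0 p) (inverse h) * exp (- inverse h)) \<longlongrightarrow> 0) (at_right 0)"
        by (rule filterlim_compose[OF tend filterlim_inverse_at_top_right])
      then show ?thesis
        by (rule Lim_transform_eventually)
           (auto simp: flat_def field_simps intro!: eventually_mono[OF eventually_at_right_less[of 0]])
    qed
    moreover have "((\<lambda>h. flat p h / h) \<longlongrightarrow> 0) (at_left 0)"
      by (rule tendsto_eventually) (auto simp: flat_def eventually_at_filter)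
    ultimately have "((\<lambda>h. flat p h / h) \<longlongrightarrow> 0) (at 0)"
      by (simp add: filterlim_split_at)
    then show ?thesis
      using 3 by (simp add: DERIV_def flat_def)
  qed
qed

lemma smooth_flat: "smooth (flat p)"
proof (rule smooth_coinduct[of "\<lambda>f. f \<in> range flat"])
  fix f assume "f \<in> range flat"
  then show "\<exists>f'. f' \<in> range flat \<and> (\<forall>x. (f has_vector_derivative f' x) (at x))"
    using flat_has_derivative by (auto simp: has_real_derivative_iff_has_vector_derivative)
qed simp

definition bump :: "real \<Rightarrow> real \<Rightarrow> real \<Rightarrow> real" where
  "bump a b x = flat 1 (x - a) * flat 1 (b - x)"

lemma smooth_bump: "smooth (bump a b)"
proof -
  have "smooth (\<lambda>x. flat 1 (1 * x + (- a)) * flat 1 ((- 1) * x + b))"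
    by (intro smooth_mult smooth_affine smooth_flat)
  then show ?thesis by (simp add: bump_def[abs_def])
qed

lemma bump_pos: "a < x \<Longrightarrow> x < b \<Longrightarrow> 0 < bump a b x"
  and bump_zero: "x \<le> a \<or> b \<le> x \<Longrightarrow> bump a b x = 0"
  and bump_nonneg: "0 \<le> bump a b x"
  by (auto simp: bump_def flat_def)

lemma support_subset_iff: "closed S \<Longrightarrow> support f \<subseteq> S \<longleftrightarrow> (\<forall>x. x \<notin> S \<longrightarrow> f x = 0)"
  unfolding support_def by (metis (mono_tags, lifting) closure_minimal closure_subset mem_Collect_eq subset_eq)

lemma test_functionI:
  assumes "smooth f" "\<And>x. x \<notin> {a..b} \<Longrightarrow> f x = 0"
  shows "test_function f" "support f \<subseteq> {a..b}"
proof -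
  show "support f \<subseteq> {a..b}" using assms by (simp add: support_subset_iff)
  then have "compact (support f)"
    using compact_Int_closed[of "{a..b}" "support f"] by (simp add: Int_absorb1 support_def)
  then show "test_function f" using assms by (simp add: test_function_def)
qed

text \<open>The two ways in which the support of a test function is used: outside a compact interval, and outside a
  given set, the function vanishes.\<close>

lemma test_function_vanishes:
  assumes "test_function f" "support f \<subseteq> S"
  obtains a b where "a \<le> b" "\<And>x. x \<notin> {a..b} \<Longrightarrow> f x = 0" "\<And>x. x \<notin> S \<Longrightarrow> f x = 0"
proof -
  have "bounded (support f)" using assms by (simp add: test_function_def compact_imp_bounded)
  then obtain a where a: "support f \<subseteq> cbox (-a) a"
    using bounded_subset_cbox_symmetric by blast
  show thesis
  proof (rule that[of "- \<bar>a\<bar>" "\<bar>a\<bar>"])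
    show "f x = 0" if "x \<notin> {- \<bar>a\<bar>..\<bar>a\<bar>}" for x
      using a that closure_subset[of "{x. f x \<noteq> 0}"] unfolding support_def by fastforce
    show "f x = 0" if "x \<notin> S" for x
      using assms(2) that closure_subset[of "{x. f x \<noteq> 0}"] unfolding support_def by blast
  qed simp
qed

section \<open>Testing against smooth functions\<close>

lemma char_density:
  fixes p :: "real \<Rightarrow> real"
  assumes [measurable]: "p \<in> borel_measurable borel" and "\<And>x. 0 \<le> p x"
  shows "char (density lborel (\<lambda>x. ennreal (p x))) t = (LINT x|lborel. cis (t * x) * p x)"
proof -
  have "char (density lborel (\<lambda>x. ennreal (p x))) t = (LINT x|lborel. p x *\<^sub>R iexp (t * x))"
    unfolding char_def by (rule integral_density) (use assms in auto)
  then show ?thesis by (simp add: cis_conv_exp scaleR_conv_of_real mult.commute)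
qed

lemma real_distribution_density:
  fixes p :: "real \<Rightarrow> real"
  assumes "integrable lborel p" "\<And>x. 0 \<le> p x" "integral\<^sup>L lborel p = 1"
  shows "real_distribution (density lborel (\<lambda>x. ennreal (p x)))"
proof -
  have "emeasure (density lborel (\<lambda>x. ennreal (p x))) UNIV = (\<integral>\<^sup>+x. ennreal (p x) \<partial>lborel)"
    using assms(1) by (subst emeasure_density) auto
  also have "\<dots> = 1"
    using assms by (subst nn_integral_eq_integral) auto
  finally have "prob_space (density lborel (\<lambda>x. ennreal (p x)))"
    by (intro prob_spaceI) (simp add: space_density)
  then show ?thesis
    by (simp add: real_distribution_def real_distribution_axioms_def)
qed

lemma integrable_cis_mult:
  fixes k :: "real \<Rightarrow> complex"
  assumes "integrable lborel k"
  shows "integrable lborel (\<lambda>x. cis (t * x) * k x)"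
proof (rule Bochner_Integration.integrable_bound[OF assms])
  have "(\<lambda>x. cis (t * x)) \<in> borel_measurable borel"
    by (intro borel_measurable_continuous_onI continuous_intros)
  then show "(\<lambda>x. cis (t * x) * k x) \<in> borel_measurable lborel"
    using borel_measurable_integrable[OF assms] by simp
qed (simp add: norm_mult)

text \<open>The positive and the negative part of \<open>k\<close> have the same Fourier transform. At frequency \<open>0\<close> this says
  that they have the same mass; unless the mass is zero, dividing by it makes them densities of probability
  measures with the same characteristic function, so they agree. As their product is zero, both vanish.\<close>

lemma fourier_zero_real_imp_AE_zero:
  fixes k :: "real \<Rightarrow> real"
  assumes k: "integrable lborel k"
    and zero: "\<And>\<eta>. (LINT x|lborel. cis (\<eta> * x) * complex_of_real (k x)) = 0"
  shows "AE x in lborel. k x = 0"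
proof -
  define p n where "p x = max (k x) 0" and "n x = max (- k x) 0" for x
  have pn: "integrable lborel p" "integrable lborel n" "\<And>x. 0 \<le> p x" "\<And>x. 0 \<le> n x"
    unfolding p_def n_def using k by (auto intro: integrable_max)
  have kpn: "k x = p x - n x" for x by (simp add: p_def n_def max_def)
  have eq: "(LINT x|lborel. cis (\<eta> * x) * complex_of_real (p x)) = (LINT x|lborel. cis (\<eta> * x) * complex_of_real (n x))"
    for \<eta>
  proof -
    have "(LINT x|lborel. cis (\<eta> * x) * complex_of_real (p x)) - (LINT x|lborel. cis (\<eta> * x) * complex_of_real (n x))
      = (LINT x|lborel. cis (\<eta> * x) * complex_of_real (p x) - cis (\<eta> * x) * complex_of_real (n x))"
      by (intro Bochner_Integration.integral_diff[symmetric] integrable_cis_mult)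
         (use pn in \<open>auto intro: integrable_of_real\<close>)
    then show ?thesis using zero[of \<eta>] by (simp add: kpn algebra_simps)
  qed
  define M where "M = integral\<^sup>L lborel p"
  have Mn: "integral\<^sup>L lborel n = M"
    using eq[of 0] pn by (simp add: M_def)
  show ?thesis
  proof (cases "M = 0")
    case True
    then have "AE x in lborel. p x = 0" "AE x in lborel. n x = 0"
      using integral_nonneg_eq_0_iff_AE[of lborel p] integral_nonneg_eq_0_iff_AE[of lborel n] pn Mn M_def
      by auto
    then show ?thesis by eventually_elim (simp add: kpn)
  next
    case False
    then have "M > 0" using pn Mn by (simp add: M_def order_less_le)
    let ?D = "\<lambda>f. density lborel (\<lambda>x. ennreal (f x / M))"
    have "char (?D p) t = char (?D n) t" for t
    proof -
      have "char (?D f) t = (LINT x|lborel. cis (t * x) * complex_of_real (f x)) / M"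
        if "integrable lborel f" "\<And>x. 0 \<le> f x" for f :: "real \<Rightarrow> real"
        using that \<open>M > 0\<close> borel_measurable_integrable[OF that(1)] by (subst char_density) auto
      then show ?thesis using pn eq by simp
    qed
    moreover have "real_distribution (?D p)" "real_distribution (?D n)"
      using pn Mn \<open>M > 0\<close> by (auto intro!: real_distribution_density simp: M_def)
    ultimately have "?D p = ?D n" by (intro Levy_uniqueness) auto
    then have "AE x in lborel. ennreal (p x / M) = ennreal (n x / M)"
      using borel_measurable_integrable[OF pn(1)] borel_measurable_integrable[OF pn(2)]
      by (subst (asm) sigma_finite_measure.density_unique_iff[OF sigma_finite_lborel]) auto
    then show ?thesis
      by eventually_elim (use pn \<open>M > 0\<close> in \<open>simp add: kpn\<close>)
  qed
qed

text \<open>Conjugation reflects the frequency, so the hypothesis passes to \<open>cnj k\<close> and hence to the real and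
  the imaginary part.\<close>

lemma fourier_zero_imp_AE_zero:
  fixes k :: "real \<Rightarrow> complex"
  assumes k: "integrable lborel k"
    and zero: "\<And>\<eta>. (LINT x|lborel. cis (\<eta> * x) * k x) = 0"
  shows "AE x in lborel. k x = 0"
proof -
  have zero': "(LINT x|lborel. cis (\<eta> * x) * cnj (k x)) = 0" for \<eta>
  proof -
    have "(LINT x|lborel. cis (\<eta> * x) * cnj (k x)) = (LINT x|lborel. cnj (cis (- \<eta> * x) * k x))"
      by (simp add: cis_cnj)
    also have "\<dots> = cnj (LINT x|lborel. cis (- \<eta> * x) * k x)"
      by (rule integral_bounded_linear'[OF bounded_linear_cnj bounded_linear_cnj]) simp
    finally show ?thesis using zero[of "- \<eta>"] by simp
  qed
  have kc: "integrable lborel (\<lambda>x. cnj (k x))" using k by simp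
  have "(LINT x|lborel. cis (\<eta> * x) * complex_of_real (Re (k x))) = 0" for \<eta>
  proof -
    have "(LINT x|lborel. cis (\<eta> * x) * complex_of_real (Re (k x))) =
        (LINT x|lborel. (cis (\<eta> * x) * k x + cis (\<eta> * x) * cnj (k x)) / 2)"
      by (intro Bochner_Integration.integral_cong refl)
         (simp add: complex_eq_iff field_simps)
    also have "\<dots> = 0"
      using integrable_cis_mult[OF k] integrable_cis_mult[OF kc] zero zero'
      by simp
    finally show ?thesis .
  qed
  moreover have "(LINT x|lborel. cis (\<eta> * x) * complex_of_real (Im (k x))) = 0" for \<eta>
  proof -
    have "(LINT x|lborel. cis (\<eta> * x) * complex_of_real (Im (k x))) =
        (LINT x|lborel. (- \<i> / 2) * (cis (\<eta> * x) * k x - cis (\<eta> * x) * cnj (k x)))"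
      by (intro Bochner_Integration.integral_cong refl)
         (simp add: complex_eq_iff field_simps)
    also have "\<dots> = 0"
      using integrable_cis_mult[OF k] integrable_cis_mult[OF kc] zero zero'
      by simp
    finally show ?thesis .
  qed
  ultimately have "AE x in lborel. Re (k x) = 0" "AE x in lborel. Im (k x) = 0"
    using k by (auto intro!: fourier_zero_real_imp_AE_zero)
  then show ?thesis by eventually_elim (simp add: complex_eq_iff)
qed

lemma integrable_locally_times:
  assumes h: "locally_integrable h" and \<phi>: "continuous_on UNIV \<phi>" "\<And>x. x \<notin> {a..b} \<Longrightarrow> \<phi> x = 0"
  shows "integrable lborel (\<lambda>x. h x * \<phi> x)"
proof -
  have h': "integrable lborel (\<lambda>x. indicator {a..b} x *\<^sub>R h x)"
    using h by (simp add: locally_integrable_def set_integrable_def)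
  have "compact (\<phi> ` {a..b})"
    by (intro compact_continuous_image continuous_on_subset[OF \<phi>(1)]) auto
  then obtain K where K: "\<And>x. x \<in> {a..b} \<Longrightarrow> \<bar>\<phi> x\<bar> \<le> K"
    by (metis compact_imp_bounded bounded_real imageI)
  have eq: "h x * \<phi> x = (indicator {a..b} x *\<^sub>R h x) * \<phi> x" for x
    using \<phi>(2) by (auto simp: indicator_def)
  have "\<phi> \<in> borel_measurable borel" using \<phi>(1) by (rule borel_measurable_continuous_onI)
  then have meas: "(\<lambda>x. h x * \<phi> x) \<in> borel_measurable lborel"
    unfolding eq using borel_measurable_integrable[OF h'] by measurable
  show ?thesis
  proof (rule Bochner_Integration.integrable_bound[of _ "\<lambda>x. K * (indicator {a..b} x *\<^sub>R h x)"])
    show "integrable lborel (\<lambda>x. K * (indicator {a..b} x *\<^sub>R h x))" using h' by simp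
    have "norm (h x * \<phi> x) \<le> norm (K * (indicator {a..b} x *\<^sub>R h x))" for x
    proof (cases "x \<in> {a..b}")
      case True
      then have "\<bar>\<phi> x\<bar> \<le> \<bar>K\<bar>" using K by fastforce
      then show ?thesis using True by (simp add: abs_mult mult.commute mult_right_mono)
    qed (simp add: \<phi>)
    then show "AE x in lborel. norm (h x * \<phi> x) \<le> norm (K * (indicator {a..b} x *\<^sub>R h x))" by simp
  qed (rule meas)
qed

lemma smooth_imp_continuous:
  assumes "smooth f" shows "continuous_on UNIV f"
proof -
  have "nth_vderiv 0 f differentiable (at x)" for x using assms unfolding smooth_def by blast
  then show ?thesis
    by (simp add: nth_vderiv_0 continuous_on_eq_continuous_at differentiable_imp_continuous_within)
qed

lemma integrable_locally_times_test:
  assumes "locally_integrable h" "test_function \<phi>"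
  shows "integrable lborel (\<lambda>x. h x * \<phi> x)"
proof -
  obtain a b where "\<And>x. x \<notin> {a..b} \<Longrightarrow> \<phi> x = 0"
    using test_function_vanishes[OF assms(2), of UNIV] by (metis UNIV_I subset_UNIV)
  then show ?thesis
    using assms integrable_locally_times smooth_imp_continuous by (metis test_function_def)
qed

lemma continuous_imp_locally_integrable:
  "continuous_on UNIV h \<Longrightarrow> locally_integrable h"
  unfolding locally_integrable_def
  using borel_integrable_atLeastAtMost' continuous_on_subset by blast

lemma locally_integrable_diff:
  "locally_integrable f \<Longrightarrow> locally_integrable g \<Longrightarrow> locally_integrable (\<lambda>x. f x - g x)"
  unfolding locally_integrable_def by (simp add: set_integral_diff)

text \<open>On a small interval the function is multiplied by a bump function; testing with the bump times \<open>cos\<close>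
  and times \<open>sin\<close> shows that the Fourier transform of the product vanishes. Countably many intervals with
  rational endpoints cover the open set.\<close>

lemma test_functions_separate:
  assumes h: "locally_integrable h" and I: "open I"
    and zero: "\<And>\<phi>. test_function \<phi> \<Longrightarrow> support \<phi> \<subseteq> I \<Longrightarrow> (LINT x|lborel. h x * \<phi> x) = 0"
  shows "AE x in lborel. x \<in> I \<longrightarrow> h x = 0"
proof -
  have interval: "AE x in lborel. a < x \<and> x < b \<longrightarrow> h x = 0" if "{a..b} \<subseteq> I" for a b
  proof -
    have tf: "test_function (\<lambda>x. bump a b x * (c * cos (\<eta> * x) + d * sin (\<eta> * x)))"
      "support (\<lambda>x. bump a b x * (c * cos (\<eta> * x) + d * sin (\<eta> * x))) \<subseteq> I" for c d \<eta>
    proof -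
      have s: "smooth (\<lambda>x. bump a b x * (c * cos (\<eta> * x) + d * sin (\<eta> * x)))"
        by (rule smooth_mult[OF smooth_bump smooth_trig])
      have z: "bump a b x * (c * cos (\<eta> * x) + d * sin (\<eta> * x)) = 0" if "x \<notin> {a..b}" for x
        using bump_zero[of x a b] that by auto
      show "test_function (\<lambda>x. bump a b x * (c * cos (\<eta> * x) + d * sin (\<eta> * x)))"
        using s z by (rule test_functionI)
      show "support (\<lambda>x. bump a b x * (c * cos (\<eta> * x) + d * sin (\<eta> * x))) \<subseteq> I"
        using test_functionI(2)[OF s z] that by blast
    qed
    have int: "integrable lborel (\<lambda>x. h x * bump a b x)"
      using integrable_locally_times_test[OF h tf(1)[of 1 0 0]] by simp
    have "(LINT x|lborel. cis (\<eta> * x) * complex_of_real (h x * bump a b x)) = 0" for \<eta>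
    proof (rule complex_eqI)
      have i: "integrable lborel (\<lambda>x. cis (\<eta> * x) * complex_of_real (h x * bump a b x))"
        using int by (intro integrable_cis_mult integrable_of_real)
      have "Re (LINT x|lborel. cis (\<eta> * x) * complex_of_real (h x * bump a b x)) =
          (LINT x|lborel. h x * (bump a b x * (1 * cos (\<eta> * x) + 0 * sin (\<eta> * x))))"
        using i by (subst integral_Re[symmetric]) (auto simp: mult_ac)
      then show "Re (LINT x|lborel. cis (\<eta> * x) * complex_of_real (h x * bump a b x)) = Re 0"
        using zero[OF tf, of 1 \<eta> 0] by simp
      have "Im (LINT x|lborel. cis (\<eta> * x) * complex_of_real (h x * bump a b x)) =
          (LINT x|lborel. h x * (bump a b x * (0 * cos (\<eta> * x) + 1 * sin (\<eta> * x))))"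
        using i by (subst integral_Im[symmetric]) (auto simp: mult_ac)
      then show "Im (LINT x|lborel. cis (\<eta> * x) * complex_of_real (h x * bump a b x)) = Im 0"
        using zero[OF tf, of 0 \<eta> 1] by simp
    qed
    with int have "AE x in lborel. h x * bump a b x = 0"
      by (rule fourier_zero_real_imp_AE_zero)
    then show ?thesis by eventually_elim (use bump_pos in force)
  qed
  have "AE x in lborel. \<forall>r\<in>{(a, b). a \<in> \<rat> \<and> b \<in> \<rat> \<and> {a..b} \<subseteq> I}. fst r < x \<and> x < snd r \<longrightarrow> h x = 0"
  proof (subst AE_ball_countable)
    have "{(a, b). a \<in> \<rat> \<and> b \<in> \<rat> \<and> {a..b} \<subseteq> I} \<subseteq> \<rat> \<times> (\<rat> :: real set)" by auto
    then show "countable {(a::real, b). a \<in> \<rat> \<and> b \<in> \<rat> \<and> {a..b} \<subseteq> I}"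
      by (rule countable_subset) (intro countable_SIGMA countable_rat)
  qed (use interval in auto)
  then show ?thesis
  proof eventually_elim
    case (elim x)
    show ?case
    proof
      assume "x \<in> I"
      then obtain e where e: "e > 0" "ball x e \<subseteq> I" using I openE by blast
      obtain a where a: "a \<in> \<rat>" "x - e < a" "a < x" using Rats_dense_in_real[of "x - e" x] e by auto
      obtain b where b: "b \<in> \<rat>" "x < b" "b < x + e" using Rats_dense_in_real[of x "x + e"] e by auto
      have "{a..b} \<subseteq> ball x e" using a b by (auto simp: dist_real_def)
      then show "h x = 0" using elim a b e(2) by fastforce
    qed
  qed
qed

text \<open>Integration by parts without boundary terms.\<close>

lemma LINT_derivative_compact_support:
  fixes G :: "real \<Rightarrow> real"
  assumes G: "\<And>x. (G has_real_derivative G' x) (at x)" "continuous_on UNIV G'"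
    and z: "\<And>x. x \<notin> {a..b} \<Longrightarrow> G x = 0"
  shows "(LINT x|lborel. G' x) = 0"
proof -
  have G'z: "G' x = 0" if "x \<notin> {a..b}" for x
  proof -
    have "(G has_real_derivative 0) (at x)"
    proof (rule DERIV_cong_ev[OF refl _ refl, THEN iffD1])
      show "((\<lambda>x. 0) has_real_derivative 0) (at x)" by simp
      show "\<forall>\<^sub>F y in nhds x. 0 = G y"
        using that z by (intro eventually_mono[OF eventually_nhds_in_open[of "- {a..b}"]]) auto
    qed
    then show ?thesis using G(1) DERIV_unique by blast
  qed
  define A B where "A = min a b - 1" and "B = max a b + 1"
  have "(LINT x|lborel. indicator {A..B} x *\<^sub>R G' x) = G B - G A"
    by (rule integral_FTC_atLeastAtMost)
       (use G in \<open>auto simp: A_def B_def has_real_derivative_iff_has_vector_derivative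
          intro: has_vector_derivative_at_within continuous_on_subset\<close>)
  moreover have "(\<lambda>x. indicator {A..B} x *\<^sub>R G' x) = G'"
  proof
    fix x show "indicator {A..B} x *\<^sub>R G' x = G' x"
      using G'z[of x] by (cases "x \<in> {a..b}") (auto simp: indicator_def A_def B_def)
  qed
  moreover have "G A = 0" "G B = 0" by (auto intro!: z simp: A_def B_def)
  ultimately show ?thesis by simp
qed

text \<open>Weak derivatives are unique almost everywhere, and for a continuously differentiable function the
  classical derivative is one of them.\<close>

lemma weak_derivative_of_C1:
  assumes F: "\<And>x. (F has_real_derivative F' x) (at x)" "continuous_on UNIV F'"
    and fF: "AE x in lborel. f x = F x" and fg: "has_weak_derivative f g"
  shows "AE x in lborel. g x = F' x"
proof -
  have F'l: "locally_integrable F'" using F(2) by (rule continuous_imp_locally_integrable)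
  have Fc: "continuous_on UNIV F"
    using F(1) by (meson DERIV_isCont continuous_at_imp_continuous_on)
  have "(LINT x|lborel. (g x - F' x) * \<phi> x) = 0" if \<phi>: "test_function \<phi>" for \<phi>
  proof -
    obtain \<phi>' where \<phi>': "smooth \<phi>'" "\<And>x. (\<phi> has_vector_derivative \<phi>' x) (at x)" "nth_vderiv 1 \<phi> = \<phi>'"
      using \<phi> smooth_derivative unfolding test_function_def by metis
    obtain a b where ab: "\<And>x. x \<notin> {a..b} \<Longrightarrow> \<phi> x = 0"
      using test_function_vanishes[OF \<phi>, of UNIV] by (metis UNIV_I subset_UNIV)
    have \<phi>c: "continuous_on UNIV \<phi>" "continuous_on UNIV \<phi>'"
      using \<phi> \<phi>'(1) by (auto simp: test_function_def intro: smooth_imp_continuous)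
    have d: "((\<lambda>x. F x * \<phi> x) has_real_derivative F x * \<phi>' x + F' x * \<phi> x) (at x)" for x
      using F(1)[of x] \<phi>'(2)[of x]
      by (auto intro!: derivative_eq_intros simp: has_real_derivative_iff_has_vector_derivative[symmetric])
    have zero: "(LINT x|lborel. F x * \<phi>' x + F' x * \<phi> x) = 0"
      by (rule LINT_derivative_compact_support[OF d, of a b])
         (use ab in \<open>auto intro!: continuous_intros \<phi>c F(2) Fc\<close>)
    have gi: "integrable lborel (\<lambda>x. g x * \<phi> x)" "integrable lborel (\<lambda>x. F' x * \<phi> x)"
      using fg F'l \<phi> by (auto simp: has_weak_derivative_def intro: integrable_locally_times_test)
    have \<phi>'z: "\<phi>' x = 0" if "x \<notin> {a..b}" for x
    proof -
      have "(\<phi> has_vector_derivative 0) (at x)"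
      proof (rule has_vector_derivative_transform_within_open[of "\<lambda>x. 0" _ _ "- {a..b}"])
      qed (use ab that in auto)
      then show ?thesis using \<phi>'(2) vector_derivative_unique_at by blast
    qed
    have fi: "integrable lborel (\<lambda>x. F x * \<phi>' x)"
      using continuous_imp_locally_integrable[OF Fc] \<phi>c(2) \<phi>'z by (rule integrable_locally_times)
    have "(LINT x|lborel. F x * \<phi>' x) = (LINT x|lborel. f x * \<phi>' x)"
    proof -
      have "AE x in lborel. F x * \<phi>' x = f x * \<phi>' x" using fF by eventually_elim simp
      moreover have "locally_integrable f" using fg by (simp add: has_weak_derivative_def)
      then have "integrable lborel (\<lambda>x. f x * \<phi>' x)"
        using \<phi>c(2) \<phi>'z by (rule integrable_locally_times)
      ultimately show ?thesis using fi by (intro integral_cong_AE) auto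
    qed
    also have "\<dots> = - (LINT x|lborel. g x * \<phi> x)"
      using fg \<phi> unfolding has_weak_derivative_def \<phi>'(3)[symmetric] by blast
    finally show ?thesis using zero gi fi by (simp add: left_diff_distrib)
  qed
  then have "AE x in lborel. x \<in> UNIV \<longrightarrow> g x - F' x = 0"
    using fg F'l by (intro test_functions_separate)
      (auto simp: has_weak_derivative_def intro: locally_integrable_diff)
  then show ?thesis by simp
qed

section \<open>The Fourier transform on square integrable functions\<close>

lemma power_le_fact_mult_exp:
  fixes x :: real assumes "0 \<le> x" shows "x ^ n \<le> fact n * exp x"
proof -
  have s: "(\<lambda>n. x ^ n /\<^sub>R fact n) sums exp x" by (rule exp_converges)
  have "(\<Sum>k\<in>{n}. x ^ k /\<^sub>R fact k) \<le> (\<Sum>k. x ^ k /\<^sub>R fact k)"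
    using assms by (intro sum_le_suminf sums_summable[OF s]) auto
  then show ?thesis using sums_unique[OF s] by (simp add: field_simps)
qed

text \<open>A power times a Gaussian is bounded because \<open>\<bar>x\<bar>\<^sup>j \<le> j! e\<^bsup>\<bar>x\<bar>\<^esup>\<close> reduces it to the exponential of a quadratic
  polynomial with negative leading coefficient; polynomials follow by induction on the coefficients.\<close>

lemma bounded_poly_gaussian:
  "bounded (range (\<lambda>x::real. x ^ j *\<^sub>R (poly p (complex_of_real x) *
     exp (- (complex_of_real x)\<^sup>2 / 2 + \<beta> * complex_of_real x))))"
proof (induction p arbitrary: j)
  case 0
  then show ?case by (simp add: image_constant_conv)
next
  case (pCons a p)
  let ?e = "\<lambda>x::real. exp (- (complex_of_real x)\<^sup>2 / 2 + \<beta> * complex_of_real x)"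
  have "bounded (range (\<lambda>x. a * (x ^ j *\<^sub>R ?e x)))"
  proof (rule boundedI)
    fix y assume "y \<in> range (\<lambda>x. a * (x ^ j *\<^sub>R ?e x))"
    then obtain x where y: "y = a * (x ^ j *\<^sub>R ?e x)" by blast
    \<comment> \<open>The exponent is at most \<open>m \<bar>x\<bar> - x\<^sup>2/2\<close>, whose maximum is \<open>m\<^sup>2/2\<close>.\<close>
    define m where "m = \<bar>Re \<beta>\<bar> + 1"
    have "\<bar>x\<bar> ^ j * exp (- x\<^sup>2 / 2 + Re \<beta> * x) \<le> fact j * exp \<bar>x\<bar> * exp (- x\<^sup>2 / 2 + Re \<beta> * x)"
      by (intro mult_right_mono power_le_fact_mult_exp) auto
    also have "\<dots> = fact j * exp (\<bar>x\<bar> - x\<^sup>2 / 2 + Re \<beta> * x)"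
      by (simp add: exp_add[symmetric] algebra_simps)
    also have "\<bar>x\<bar> - x\<^sup>2 / 2 + Re \<beta> * x \<le> m\<^sup>2 / 2"
    proof -
      have "Re \<beta> * x \<le> \<bar>Re \<beta>\<bar> * \<bar>x\<bar>" by (metis abs_ge_self abs_mult)
      moreover have "0 \<le> (m - \<bar>x\<bar>)\<^sup>2" by simp
      ultimately show ?thesis by (simp add: m_def power2_eq_square algebra_simps)
    qed
    finally have "\<bar>x\<bar> ^ j * exp (- x\<^sup>2 / 2 + Re \<beta> * x) \<le> fact j * exp (m\<^sup>2 / 2)" by simp
    moreover have "norm y = norm a * (\<bar>x\<bar> ^ j * exp (- x\<^sup>2 / 2 + Re \<beta> * x))"
      unfolding y by (simp add: norm_mult power_abs power2_eq_square)
    ultimately show "norm y \<le> norm a * (fact j * exp (m\<^sup>2 / 2))"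
      by (simp add: mult_left_mono)
  qed
  moreover have "bounded (range (\<lambda>x. x ^ Suc j *\<^sub>R (poly p (complex_of_real x) * ?e x)))"
    by (rule pCons.IH)
  ultimately have "bounded (range (\<lambda>x. a * (x ^ j *\<^sub>R ?e x) + x ^ Suc j *\<^sub>R (poly p (complex_of_real x) * ?e x)))"
    by (rule bounded_plus_comp)
  then show ?case
    by (simp add: scaleR_conv_of_real algebra_simps)
qed

text \<open>The exponent has a linear term with complex coefficient so that both translated and modulated
  Gaussians are covered.\<close>

lemma schwartz_gaussian:
  "schwartz (\<lambda>x. C * exp (- (complex_of_real x)\<^sup>2 / 2 + \<beta> * complex_of_real x))"
proof -
  let ?e = "\<lambda>x::real. exp (- (complex_of_real x)\<^sup>2 / 2 + \<beta> * complex_of_real x)"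
  define P where "P f \<longleftrightarrow> (\<exists>p. f = (\<lambda>x. poly p (complex_of_real x) * ?e x))" for f
  have step: "\<exists>f'. P f' \<and> (\<forall>x. (f has_vector_derivative f' x) (at x))" if Pf: "P f" for f
  proof -
    obtain p where f: "f = (\<lambda>x. poly p (complex_of_real x) * ?e x)" using Pf unfolding P_def by blast
    have "((\<lambda>z. poly p z * exp (- z\<^sup>2 / 2 + \<beta> * z)) has_field_derivative
        poly (pderiv p + p * [:\<beta>, - 1:]) z * exp (- z\<^sup>2 / 2 + \<beta> * z)) (at z)" for z
      by (auto intro!: derivative_eq_intros poly_DERIV simp: algebra_simps)
    then have "(f has_vector_derivative poly (pderiv p + p * [:\<beta>, - 1:]) (complex_of_real x) * ?e x) (at x)" for x
      unfolding f using has_vector_derivative_real_field by blast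
    then show ?thesis unfolding P_def
      by (intro exI[of _ "\<lambda>x. poly (pderiv p + p * [:\<beta>, - 1:]) (complex_of_real x) * ?e x"]) blast
  qed
  have P: "P (\<lambda>x. C * ?e x)"
    unfolding P_def by (intro exI[of _ "[:C:]"]) simp
  have "P (nth_vderiv k (\<lambda>x. C * ?e x))" for k
    by (rule nth_vderiv_invariant[of P, OF step P])
  then have "bounded (range (\<lambda>x. (x ^ j) *\<^sub>R nth_vderiv k (\<lambda>x. C * ?e x) x))" for j k
  proof -
    obtain p where p: "nth_vderiv k (\<lambda>x. C * ?e x) = (\<lambda>x. poly p (complex_of_real x) * ?e x)"
      using \<open>P (nth_vderiv k (\<lambda>x. C * ?e x))\<close> unfolding P_def by blast
    show ?thesis unfolding p by (rule bounded_poly_gaussian)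
  qed
  moreover have "smooth (\<lambda>x. C * ?e x)"
    by (rule smooth_coinduct[of P, OF step P])
  ultimately show ?thesis unfolding schwartz_def by blast
qed

text \<open>The characteristic function of the standard normal distribution.\<close>

lemma gaussian_transform:
  "(LINT u|lborel. cis (t * u) * complex_of_real (exp (- u\<^sup>2 / 2))) = sqrt (2 * pi) * exp (- t\<^sup>2 / 2)"
proof -
  have "exp (- t\<^sup>2 / 2) = (LINT x|lborel. cis (t * x) * std_normal_density x)"
    using char_density[of std_normal_density t] char_std_normal_distribution
    by (simp add: fun_eq_iff)
  also have "\<dots> = (LINT x|lborel. (cis (t * x) * complex_of_real (exp (- x\<^sup>2 / 2))) / sqrt (2 * pi))"
    by (simp add: std_normal_density_def)
  also have "\<dots> = (LINT x|lborel. (cis (t * x) * complex_of_real (exp (- x\<^sup>2 / 2)))) / sqrt (2 * pi)"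
    by (rule integral_divide_zero)
  finally show ?thesis by (simp add: field_simps)
qed

lemma fourier_gaussian:
  "fourier (\<lambda>\<xi>. complex_of_real (exp (- (\<xi> - \<eta>)\<^sup>2 / 2))) x = cis (- (\<eta> * x)) * complex_of_real (exp (- x\<^sup>2 / 2))"
proof -
  have "(LINT \<xi>|lborel. cis (- (\<xi> * x)) * complex_of_real (exp (- (\<xi> - \<eta>)\<^sup>2 / 2)))
      = (LINT u|lborel. cis (- ((\<eta> + u) * x)) * complex_of_real (exp (- u\<^sup>2 / 2)))"
    by (subst lborel_integral_real_affine[where c = 1 and t = \<eta>]) auto
  also have "\<dots> = (LINT u|lborel. cis (- (\<eta> * x)) * (cis ((- x) * u) * complex_of_real (exp (- u\<^sup>2 / 2))))"
    by (intro Bochner_Integration.integral_cong refl)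
       (simp add: mult.assoc[symmetric] cis_mult algebra_simps)
  also have "\<dots> = cis (- (\<eta> * x)) * (sqrt (2 * pi) * exp (- x\<^sup>2 / 2))"
    by (simp only: integral_mult_right_zero gaussian_transform) simp
  finally show ?thesis
    unfolding fourier_def by (simp add: scaleR_conv_of_real mult.commute)
qed

lemma square_integrable_mult_integrable:
  fixes f g :: "real \<Rightarrow> complex"
  assumes "square_integrable f" "square_integrable g"
  shows "integrable lborel (\<lambda>x. f x * g x)"
proof (rule Bochner_Integration.integrable_bound)
  show "integrable lborel (\<lambda>x. (norm (f x))\<^sup>2 + (norm (g x))\<^sup>2)"
    using assms by (simp add: square_integrable_def)
  show "(\<lambda>x. f x * g x) \<in> borel_measurable lborel"
    using assms by (auto simp: square_integrable_def intro!: borel_measurable_times)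
  have "norm (f x) * norm (g x) \<le> (norm (f x))\<^sup>2 + (norm (g x))\<^sup>2" for x
  proof -
    have "2 * (norm (f x) * norm (g x)) \<le> (norm (f x))\<^sup>2 + (norm (g x))\<^sup>2"
      using sum_squares_bound[of "norm (f x)" "norm (g x)"] by (simp add: mult.assoc)
    moreover have "0 \<le> norm (f x) * norm (g x)" by simp
    ultimately show ?thesis by linarith
  qed
  then show "AE x in lborel. norm (f x * g x) \<le> norm ((norm (f x))\<^sup>2 + (norm (g x))\<^sup>2)"
    by (simp add: norm_mult)
qed

lemma square_integrable_diff:
  fixes f g :: "real \<Rightarrow> complex"
  assumes "square_integrable f" "square_integrable g"
  shows "square_integrable (\<lambda>x. f x - g x)"
  unfolding square_integrable_def
proof
  show "(\<lambda>x. f x - g x) \<in> borel_measurable lborel"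
    using assms by (auto simp: square_integrable_def intro!: borel_measurable_diff)
  then have "(\<lambda>x. (norm (f x - g x))\<^sup>2) \<in> borel_measurable lborel" by measurable
  then show "integrable lborel (\<lambda>x. (norm (f x - g x))\<^sup>2)"
  proof (rule Bochner_Integration.integrable_bound[of _ "\<lambda>x. 2 * (norm (f x))\<^sup>2 + 2 * (norm (g x))\<^sup>2", rotated])
    have "(norm (f x - g x))\<^sup>2 \<le> 2 * (norm (f x))\<^sup>2 + 2 * (norm (g x))\<^sup>2" for x
    proof -
      have "(norm (f x - g x))\<^sup>2 \<le> (norm (f x) + norm (g x))\<^sup>2"
        by (intro power_mono norm_triangle_ineq4) simp
      then show ?thesis
        using sum_squares_bound[of "norm (f x)" "norm (g x)"] by (simp add: power2_sum)
    qed
    then show "AE x in lborel. norm ((norm (f x - g x))\<^sup>2) \<le> norm (2 * (norm (f x))\<^sup>2 + 2 * (norm (g x))\<^sup>2)"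
      by simp
  qed (use assms in \<open>auto simp: square_integrable_def\<close>)
qed

lemma square_integrable_cmult:
  fixes f :: "real \<Rightarrow> complex"
  assumes "square_integrable f" shows "square_integrable (\<lambda>x. a * f x)"
  using assms by (auto simp: square_integrable_def norm_mult power_mult_distrib intro!: borel_measurable_times)

lemma integrable_inverse_one_plus_square: "integrable lborel (\<lambda>x::real. 1 / (1 + x\<^sup>2))"
  using integrable_inverse_1_plus_square
  by (simp add: set_integrable_def divide_inverse einterval_def)

text \<open>The two bounds together say that \<open>f\<close> is at most a multiple of \<open>(1 + x\<^sup>2)\<^bsup>-1/2\<^esup>\<close>.\<close>

lemma decay_imp_square_integrable:
  fixes f :: "real \<Rightarrow> complex"
  assumes "f \<in> borel_measurable borel" "\<And>x. norm (f x) \<le> K" "\<And>x. \<bar>x\<bar> * norm (f x) \<le> K"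
  shows "square_integrable f"
  unfolding square_integrable_def
proof
  show "f \<in> borel_measurable lborel" using assms(1) by simp
  show "integrable lborel (\<lambda>x. (norm (f x))\<^sup>2)"
  proof (rule Bochner_Integration.integrable_bound[of _ "\<lambda>x. 2 * K\<^sup>2 * (1 / (1 + x\<^sup>2))"])
    show "integrable lborel (\<lambda>x. 2 * K\<^sup>2 * (1 / (1 + x\<^sup>2)))"
      using integrable_inverse_one_plus_square by (rule integrable_mult_right)
    have "(norm (f x))\<^sup>2 \<le> 2 * K\<^sup>2 * (1 / (1 + x\<^sup>2))" for x
    proof -
      have "(norm (f x))\<^sup>2 \<le> K\<^sup>2" "(\<bar>x\<bar> * norm (f x))\<^sup>2 \<le> K\<^sup>2"
        using assms by (auto intro!: power_mono)
      then have "(1 + x\<^sup>2) * (norm (f x))\<^sup>2 \<le> 2 * K\<^sup>2"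
        by (simp add: power_mult_distrib distrib_right)
      moreover have "0 < 1 + x\<^sup>2" by (simp add: add_pos_nonneg)
      ultimately show ?thesis by (simp add: field_simps)
    qed
    then show "AE x in lborel. norm ((norm (f x))\<^sup>2) \<le> norm (2 * K\<^sup>2 * (1 / (1 + x\<^sup>2)))"
      by (simp add: abs_of_nonneg)
  qed (use assms(1) in simp)
qed

lemma schwartz_continuous: "schwartz \<phi> \<Longrightarrow> continuous_on UNIV \<phi>"
  by (simp add: schwartz_def smooth_imp_continuous)

lemma schwartz_bound:
  assumes "schwartz \<phi>" obtains K where "\<And>x. \<bar>x\<bar> ^ j * norm (\<phi> x) \<le> K"
proof -
  have "bounded (range (\<lambda>x. (x ^ j) *\<^sub>R nth_vderiv 0 \<phi> x))"
    using assms unfolding schwartz_def by blast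
  then obtain K where K: "\<And>y. y \<in> range (\<lambda>x. (x ^ j) *\<^sub>R \<phi> x) \<Longrightarrow> norm y \<le> K"
    unfolding bounded_iff nth_vderiv_0 by blast
  show thesis
  proof (rule that)
    show "\<bar>x\<bar> ^ j * norm (\<phi> x) \<le> K" for x
      using K[of "(x ^ j) *\<^sub>R \<phi> x"] by (simp add: power_abs)
  qed
qed

lemma schwartz_square_integrable: assumes "schwartz \<phi>" shows "square_integrable \<phi>"
proof -
  obtain K0 K1 where K: "\<And>x. \<bar>x\<bar> ^ 0 * norm (\<phi> x) \<le> K0" "\<And>x. \<bar>x\<bar> ^ 1 * norm (\<phi> x) \<le> K1"
    using schwartz_bound[OF assms] by metis
  show ?thesis
  proof (rule decay_imp_square_integrable)
    show "\<phi> \<in> borel_measurable borel"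
      using schwartz_continuous[OF assms] by (rule borel_measurable_continuous_onI)
    show "norm (\<phi> x) \<le> max K0 K1" "\<bar>x\<bar> * norm (\<phi> x) \<le> max K0 K1" for x
      using K[of x] by auto
  qed
qed

lemma schwartz_integrable: assumes "schwartz \<phi>" shows "integrable lborel \<phi>"
proof -
  obtain K0 K2 where K: "\<And>x. \<bar>x\<bar> ^ 0 * norm (\<phi> x) \<le> K0" "\<And>x. \<bar>x\<bar> ^ 2 * norm (\<phi> x) \<le> K2"
    using schwartz_bound[OF assms] by metis
  show ?thesis
  proof (rule Bochner_Integration.integrable_bound[of _ "\<lambda>x. (K0 + K2) * (1 / (1 + x\<^sup>2))"])
    show "integrable lborel (\<lambda>x. (K0 + K2) * (1 / (1 + x\<^sup>2)))"
      using integrable_inverse_one_plus_square by (rule integrable_mult_right)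
    show "\<phi> \<in> borel_measurable lborel"
      using schwartz_continuous[OF assms] borel_measurable_continuous_onI by fastforce
    have "norm (\<phi> x) \<le> (K0 + K2) * (1 / (1 + x\<^sup>2))" for x
    proof -
      have "(1 + x\<^sup>2) * norm (\<phi> x) \<le> K0 + K2"
        using K[of x] by (simp add: distrib_right)
      moreover have "0 < 1 + x\<^sup>2" by (simp add: add_pos_nonneg)
      ultimately show ?thesis by (simp add: field_simps)
    qed
    then show "AE x in lborel. norm (\<phi> x) \<le> norm ((K0 + K2) * (1 / (1 + x\<^sup>2)))"
      by (intro AE_I2) (metis norm_ge_zero order_trans real_norm_def abs_ge_self)
  qed
qed

lemma schwartz_derivative:
  assumes "schwartz \<phi>"
  obtains \<phi>' where "schwartz \<phi>'" "\<And>x. (\<phi> has_vector_derivative \<phi>' x) (at x)"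
proof -
  obtain \<phi>' where "smooth \<phi>'" "\<And>x. (\<phi> has_vector_derivative \<phi>' x) (at x)"
      "\<And>k. nth_vderiv (Suc k) \<phi> = nth_vderiv k \<phi>'"
    using smooth_derivative assms unfolding schwartz_def by metis
  then show thesis using that assms unfolding schwartz_def by metis
qed

lemma schwartz_tendsto_0:
  assumes "schwartz \<phi>" shows "(\<phi> \<longlongrightarrow> 0) at_top" "(\<phi> \<longlongrightarrow> 0) at_bot"
proof -
  obtain K where K: "\<And>x. \<bar>x\<bar> ^ 1 * norm (\<phi> x) \<le> K" using schwartz_bound[OF assms] by metis
  have le: "norm (\<phi> x) \<le> K / \<bar>x\<bar>" if "x \<noteq> 0" for x
    using K[of x] that by (simp add: field_simps)
  have "((\<lambda>x::real. K / \<bar>x\<bar>) \<longlongrightarrow> 0) at_top" "((\<lambda>x::real. K / \<bar>x\<bar>) \<longlongrightarrow> 0) at_bot"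
    by (auto intro!: tendsto_divide_0[OF tendsto_const] filterlim_at_top_imp_at_infinity
        filterlim_abs_real filterlim_at_infinity_imp_filterlim_at_top
        filterlim_compose[OF filterlim_abs_real filterlim_uminus_at_top_at_bot, simplified])
  moreover have "\<forall>\<^sub>F x in at_top. norm (\<phi> x) \<le> K / \<bar>x\<bar>"
    using eventually_gt_at_top[of 0] by eventually_elim (rule le, simp)
  moreover have "\<forall>\<^sub>F x in at_bot. norm (\<phi> x) \<le> K / \<bar>x\<bar>"
    using eventually_gt_at_bot[of 0] by eventually_elim (rule le, simp)
  ultimately show "(\<phi> \<longlongrightarrow> 0) at_top" "(\<phi> \<longlongrightarrow> 0) at_bot"
    by (auto intro: Lim_null_comparison)
qed

lemma integral_derivative_eq_0:
  fixes f :: "real \<Rightarrow> complex"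
  assumes d: "\<And>x. (f has_vector_derivative f' x) (at x)"
    and i: "integrable lborel f'" and c: "continuous_on UNIV f'"
    and lim: "(f \<longlongrightarrow> 0) at_top" "(f \<longlongrightarrow> 0) at_bot"
  shows "integral\<^sup>L lborel f' = 0"
proof -
  have "LBINT x=-\<infinity>..\<infinity>. f' x = 0 - 0"
  proof (rule interval_integral_FTC_integrable)
    show "set_integrable lborel (einterval (-\<infinity>) \<infinity>) f'"
      using i by (simp add: set_integrable_def einterval_def)
    show "isCont f' x" for x using c by (simp add: continuous_on_eq_continuous_at)
    show "((f \<circ> real_of_ereal) \<longlongrightarrow> 0) (at_right (-\<infinity>))" "((f \<circ> real_of_ereal) \<longlongrightarrow> 0) (at_left \<infinity>)"
      using lim by (simp_all add: ereal_tendsto_simps)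
  qed (use d in auto)
  then show ?thesis
    by (simp add: interval_lebesgue_integral_def set_lebesgue_integral_def einterval_def)
qed

text \<open>Integration by parts turns \<open>\<xi>\<close> times the transform of \<open>\<phi>\<close> into the transform of \<open>\<phi>'\<close>, so the transform
  decays like \<open>1/\<bar>\<xi>\<bar>\<close>. Square integrability is what makes the pairing with an \<open>L\<^sup>2\<close> function converge, and
  hence the Fourier relation linear.\<close>

lemma schwartz_fourier_square_integrable:
  assumes "schwartz \<phi>" shows "square_integrable (fourier \<phi>)"
proof -
  obtain \<phi>' where \<phi>': "schwartz \<phi>'" "\<And>x. (\<phi> has_vector_derivative \<phi>' x) (at x)"
    using schwartz_derivative[OF assms] by metis
  have i: "integrable lborel \<phi>" "integrable lborel \<phi>'"
    using assms \<phi>'(1) by (auto intro: schwartz_integrable)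
  have ic: "integrable lborel (\<lambda>x. cis (- (x * \<xi>)) * f x)" if "integrable lborel f" for f :: "real \<Rightarrow> complex" and \<xi>
    using integrable_cis_mult[OF that, of "- \<xi>"] by (simp add: mult.commute)
  define J where "J f \<xi> = (LINT x|lborel. cis (- (x * \<xi>)) * f x)" for f :: "real \<Rightarrow> complex" and \<xi>
  have Jb: "norm (J f \<xi>) \<le> (LINT x|lborel. norm (f x))" if "integrable lborel f" for f \<xi>
    unfolding J_def using integral_norm_bound[of lborel "\<lambda>x. cis (- (x * \<xi>)) * f x"]
    by (simp add: norm_mult)
  have parts: "J \<phi>' \<xi> = \<i> * \<xi> * J \<phi> \<xi>" for \<xi>
  proof -
    have dc: "((\<lambda>x. cis (- (x * \<xi>))) has_vector_derivative (- \<i> * \<xi>) * cis (- (x * \<xi>))) (at x)" for x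
    proof -
      have "((\<lambda>z. exp (\<i> * - (z * \<xi>))) has_field_derivative (- \<i> * \<xi>) * exp (\<i> * - (of_real x * \<xi>))) (at (of_real x))"
        by (auto intro!: derivative_eq_intros)
      from has_vector_derivative_real_field[OF this] show ?thesis
        by (simp add: cis_conv_exp)
    qed
    let ?f' = "\<lambda>x. cis (- (x * \<xi>)) * \<phi>' x + (- \<i> * \<xi>) * cis (- (x * \<xi>)) * \<phi> x"
    have lim: "((\<lambda>x. cis (- (x * \<xi>)) * \<phi> x) \<longlongrightarrow> 0) F" if "(\<phi> \<longlongrightarrow> 0) F" for F
      using that by (subst tendsto_norm_zero_iff[symmetric]) (simp add: norm_mult tendsto_norm_zero_iff)
    have "integral\<^sup>L lborel ?f' = 0"
    proof (rule integral_derivative_eq_0)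
      show "((\<lambda>x. cis (- (x * \<xi>)) * \<phi> x) has_vector_derivative ?f' x) (at x)" for x
        by (rule has_vector_derivative_mult[OF dc \<phi>'(2)])
      show "integrable lborel ?f'"
        using ic[OF i(2)] ic[OF i(1)] by (simp add: mult.assoc)
      show "continuous_on UNIV ?f'"
        by (intro continuous_intros schwartz_continuous assms \<phi>')
    qed (use schwartz_tendsto_0[OF assms] lim in auto)
    then show ?thesis
      using ic[OF i(2)] ic[OF i(1)] by (simp add: mult.assoc J_def)
  qed
  define N where "N = (LINT x|lborel. norm (\<phi> x)) + (LINT x|lborel. norm (\<phi>' x))"
  have four: "fourier \<phi> \<xi> = (1 / sqrt (2 * pi)) *\<^sub>R J \<phi> \<xi>" for \<xi>
    by (simp add: fourier_def J_def)
  show ?thesis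
  proof (rule decay_imp_square_integrable)
    have [measurable]: "cis \<in> borel_measurable borel" "\<phi> \<in> borel_measurable borel"
      using schwartz_continuous[OF assms]
      by (auto intro!: borel_measurable_continuous_onI continuous_intros)
    have "J \<phi> \<in> borel_measurable borel"
      unfolding J_def[abs_def] by measurable
    then show "fourier \<phi> \<in> borel_measurable borel"
      unfolding four[abs_def] by measurable
    have nn: "0 \<le> (LINT x|lborel. norm (\<phi> x))" "0 \<le> (LINT x|lborel. norm (\<phi>' x))" by auto
    have "norm (J \<phi> \<xi>) \<le> N" for \<xi>
      using Jb[OF i(1), of \<xi>] nn unfolding N_def by linarith
    then show "norm (fourier \<phi> \<xi>) \<le> (1 / sqrt (2 * pi)) * N" for \<xi>
      unfolding four by (auto intro!: divide_right_mono)
    have "\<bar>\<xi>\<bar> * norm (J \<phi> \<xi>) \<le> (LINT x|lborel. norm (\<phi>' x))" for \<xi>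
      using Jb[OF i(2), of \<xi>] unfolding parts norm_mult by simp
    then have "\<bar>\<xi>\<bar> * norm (J \<phi> \<xi>) \<le> N" for \<xi>
      using nn unfolding N_def by (meson add_increasing order_trans order_refl)
    then show "\<bar>\<xi>\<bar> * norm (fourier \<phi> \<xi>) \<le> (1 / sqrt (2 * pi)) * N" for \<xi>
      unfolding four by (auto intro!: divide_right_mono)
  qed
qed

lemma has_fourier_diff:
  assumes "has_fourier f g" "has_fourier f' g'"
  shows "has_fourier (\<lambda>x. f x - f' x) (\<lambda>x. g x - g' x)"
  unfolding has_fourier_def
proof (intro conjI allI impI)
  fix \<phi> assume \<phi>: "schwartz \<phi>"
  note s = schwartz_square_integrable[OF \<phi>] schwartz_fourier_square_integrable[OF \<phi>]
  have "integrable lborel (\<lambda>x. f x * fourier \<phi> x)" "integrable lborel (\<lambda>x. f' x * fourier \<phi> x)"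
    "integrable lborel (\<lambda>x. g x * \<phi> x)" "integrable lborel (\<lambda>x. g' x * \<phi> x)"
    using assms s by (auto simp: has_fourier_def intro: square_integrable_mult_integrable)
  then show "(LINT \<xi>|lborel. (g \<xi> - g' \<xi>) * \<phi> \<xi>) = (LINT x|lborel. (f x - f' x) * fourier \<phi> x)"
    using assms \<phi> by (simp add: left_diff_distrib has_fourier_def)
qed (use assms in \<open>auto simp: has_fourier_def intro: square_integrable_diff\<close>)

lemma has_fourier_cmult:
  assumes "has_fourier f g" shows "has_fourier (\<lambda>x. a * f x) (\<lambda>x. a * g x)"
  using assms unfolding has_fourier_def
  by (auto intro: square_integrable_cmult simp: mult.assoc)

text \<open>The modulated Gaussians \<open>e\<^bsup>i\<eta>x\<^esup> e\<^bsup>-x\<^sup>2/2\<^esup>\<close> as test functions say that the difference of the two transforms,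
  multiplied by a Gaussian, has vanishing Fourier transform. So the transform that is chosen in the
  definition of the Sobolev norm may be replaced by any other one.\<close>

lemma has_fourier_unique:
  assumes "has_fourier f g" "has_fourier f g'"
  shows "AE x in lborel. g x = g' x"
proof -
  let ?h = "\<lambda>x. g x - g' x"
  have h: "square_integrable ?h"
    using assms by (auto simp: has_fourier_def intro: square_integrable_diff)
  have sc: "schwartz (\<lambda>x. cis (\<eta> * x) * complex_of_real (exp (- x\<^sup>2 / 2)))" for \<eta>
  proof -
    have "cis (\<eta> * x) * complex_of_real (exp (- x\<^sup>2 / 2)) = 1 * exp (- (complex_of_real x)\<^sup>2 / 2 + \<i> * \<eta> * complex_of_real x)" for x
      by (simp add: cis_conv_exp flip: exp_of_real exp_add) (simp add: algebra_simps)
    then show ?thesis using schwartz_gaussian[of 1 "\<i> * \<eta>"] by simp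
  qed
  let ?k = "\<lambda>x. ?h x * complex_of_real (exp (- x\<^sup>2 / 2))"
  have "AE x in lborel. ?k x = 0"
  proof (rule fourier_zero_imp_AE_zero)
    show "integrable lborel ?k"
      using square_integrable_mult_integrable[OF h schwartz_square_integrable[OF sc[of 0]]] by simp
    fix \<eta>
    let ?\<phi> = "\<lambda>x. cis (\<eta> * x) * complex_of_real (exp (- x\<^sup>2 / 2))"
    have "integrable lborel (\<lambda>x. g x * ?\<phi> x)" "integrable lborel (\<lambda>x. g' x * ?\<phi> x)"
      using assms schwartz_square_integrable[OF sc[of \<eta>]]
      by (auto simp: has_fourier_def intro!: square_integrable_mult_integrable)
    moreover have "(LINT x|lborel. g x * ?\<phi> x) = (LINT x|lborel. g' x * ?\<phi> x)"
    proof -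
      have "(LINT x|lborel. g x * ?\<phi> x) = (LINT x|lborel. f x * fourier ?\<phi> x)"
        using assms(1) sc[of \<eta>] unfolding has_fourier_def by blast
      moreover have "(LINT x|lborel. g' x * ?\<phi> x) = (LINT x|lborel. f x * fourier ?\<phi> x)"
        using assms(2) sc[of \<eta>] unfolding has_fourier_def by blast
      ultimately show ?thesis by simp
    qed
    ultimately have "(LINT x|lborel. g x * ?\<phi> x - g' x * ?\<phi> x) = 0" by simp
    then show "(LINT x|lborel. cis (\<eta> * x) * ?k x) = 0"
      by (simp add: algebra_simps)
  qed
  then show ?thesis by eventually_elim simp
qed

definition inverse_fourier :: "(real \<Rightarrow> complex) \<Rightarrow> real \<Rightarrow> complex" where
  "inverse_fourier g x = (1 / sqrt (2 * pi)) *\<^sub>R (LINT \<xi>|lborel. cis (x * \<xi>) * g \<xi>)"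

lemma borel_measurable_cis [measurable]: "cis \<in> borel_measurable borel"
  by (auto intro!: borel_measurable_continuous_onI continuous_intros)

lemma norm_inverse_fourier_le:
  assumes "integrable lborel g"
  shows "norm (inverse_fourier g x) \<le> (LINT \<xi>|lborel. norm (g \<xi>))"
proof -
  have "norm (LINT \<xi>|lborel. cis (x * \<xi>) * g \<xi>) \<le> (LINT \<xi>|lborel. norm (g \<xi>))"
    using integral_norm_bound[of lborel "\<lambda>\<xi>. cis (x * \<xi>) * g \<xi>"] by (simp add: norm_mult)
  moreover have "1 \<le> sqrt (2 * pi)" using pi_gt3 by simp
  then have "1 / sqrt (2 * pi) \<le> 1" by simp
  ultimately have "(1 / sqrt (2 * pi)) * norm (LINT \<xi>|lborel. cis (x * \<xi>) * g \<xi>) \<le> 1 * (LINT \<xi>|lborel. norm (g \<xi>))"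
    by (intro mult_mono) auto
  then show ?thesis by (simp add: inverse_fourier_def)
qed

lemma continuous_inverse_fourier:
  assumes g: "integrable lborel g"
  shows "continuous_on UNIV (inverse_fourier g)"
  unfolding continuous_on_eq_continuous_at[OF open_UNIV]
proof (intro ballI continuous_at_sequentiallyI)
  fix x :: real and u assume u: "u \<longlonglongrightarrow> x"
  have [measurable]: "g \<in> borel_measurable borel" using g by auto
  have "(\<lambda>n. LINT \<xi>|lborel. cis (u n * \<xi>) * g \<xi>) \<longlonglongrightarrow> (LINT \<xi>|lborel. cis (x * \<xi>) * g \<xi>)"
  proof (rule integral_dominated_convergence[where w = "\<lambda>\<xi>. norm (g \<xi>)"])
    show "AE \<xi> in lborel. (\<lambda>n. cis (u n * \<xi>) * g \<xi>) \<longlonglongrightarrow> cis (x * \<xi>) * g \<xi>"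
      by (intro AE_I2 tendsto_intros u)
  qed (use g in \<open>auto simp: norm_mult\<close>)
  then show "(\<lambda>n. inverse_fourier g (u n)) \<longlonglongrightarrow> inverse_fourier g x"
    unfolding inverse_fourier_def by (intro tendsto_intros)
qed

text \<open>Differentiation under the integral sign. The difference quotients of \<open>cis\<close> are dominated since
  \<open>\<bar>e\<^bsup>it\<^esup> - 1\<bar> \<le> \<bar>t\<bar>\<close>.\<close>

lemma inverse_fourier_has_derivative:
  assumes g: "integrable lborel g" and g1: "integrable lborel (\<lambda>\<xi>. complex_of_real \<xi> * g \<xi>)"
  shows "(inverse_fourier g has_vector_derivative inverse_fourier (\<lambda>\<xi>. \<i> * (complex_of_real \<xi> * g \<xi>)) x) (at x)"
proof -
  have [measurable]: "g \<in> borel_measurable borel" using g by auto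
  have cis1: "norm (cis t - 1) \<le> \<bar>t\<bar>" for t
    using iexp_approx1[of t 0] by (simp add: cis_conv_exp)
  let ?D = "inverse_fourier (\<lambda>\<xi>. \<i> * (complex_of_real \<xi> * g \<xi>)) x"
  define R where "R h \<xi> = cis (x * \<xi>) * ((cis (h * \<xi>) - 1) / complex_of_real h - \<i> * \<xi>) * g \<xi>" for h \<xi>
  have Rm: "R h \<in> borel_measurable borel" for h unfolding R_def by measurable
  have quot: "(inverse_fourier g (x + h) - inverse_fourier g x - h *\<^sub>R ?D) /\<^sub>R h
      = (1 / sqrt (2 * pi)) *\<^sub>R (LINT \<xi>|lborel. R h \<xi>)" if "h \<noteq> 0" for h
  proof -
    note i = integrable_cis_mult[OF g, of "x + h"] integrable_cis_mult[OF g, of x]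
      integrable_cis_mult[OF integrable_mult_right[OF g1], of x \<i>]
    define A B D where "A = (LINT \<xi>|lborel. cis ((x + h) * \<xi>) * g \<xi>)" and "B = (LINT \<xi>|lborel. cis (x * \<xi>) * g \<xi>)"
      and "D = (LINT \<xi>|lborel. cis (x * \<xi>) * (\<i> * (complex_of_real \<xi> * g \<xi>)))"
    have "(LINT \<xi>|lborel. R h \<xi>) = (LINT \<xi>|lborel. (cis ((x + h) * \<xi>) * g \<xi> - cis (x * \<xi>) * g \<xi>) / complex_of_real h
        - cis (x * \<xi>) * (\<i> * (complex_of_real \<xi> * g \<xi>)))"
      using that by (intro Bochner_Integration.integral_cong refl)
        (simp add: R_def distrib_right cis_mult[symmetric] field_simps)
    also have "\<dots> = (LINT \<xi>|lborel. (cis ((x + h) * \<xi>) * g \<xi> - cis (x * \<xi>) * g \<xi>) / complex_of_real h) - D"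
      unfolding D_def
      by (rule Bochner_Integration.integral_diff[OF integrable_divide[OF Bochner_Integration.integrable_diff[OF i(1,2)]] i(3)])
    also have "(LINT \<xi>|lborel. (cis ((x + h) * \<xi>) * g \<xi> - cis (x * \<xi>) * g \<xi>) / complex_of_real h) = (A - B) / complex_of_real h"
      unfolding A_def B_def Bochner_Integration.integral_diff[OF i(1,2), symmetric]
      by (rule integral_divide_zero)
    finally have R: "(LINT \<xi>|lborel. R h \<xi>) = (A - B) / complex_of_real h - D" .
    have "inverse_fourier g (x + h) = (1 / sqrt (2 * pi)) *\<^sub>R A" "inverse_fourier g x = (1 / sqrt (2 * pi)) *\<^sub>R B"
      "?D = (1 / sqrt (2 * pi)) *\<^sub>R D"
      by (simp_all add: inverse_fourier_def A_def B_def D_def)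
    then show ?thesis
      unfolding R using that by (simp add: scaleR_conv_of_real field_simps)
  qed
  have "((\<lambda>h. LINT \<xi>|lborel. R h \<xi>) \<longlongrightarrow> 0) (at 0)"
    unfolding tendsto_at_iff_sequentially comp_def
  proof (intro allI impI)
    fix h :: "nat \<Rightarrow> real" assume h: "\<forall>i. h i \<in> UNIV - {0}" "h \<longlonglongrightarrow> 0"
    have "(\<lambda>n. LINT \<xi>|lborel. R (h n) \<xi>) \<longlonglongrightarrow> integral\<^sup>L lborel (\<lambda>\<xi>::real. 0 :: complex)"
    proof (rule integral_dominated_convergence[where w = "\<lambda>\<xi>. 2 * norm (complex_of_real \<xi> * g \<xi>)" and s = "\<lambda>n. R (h n)"])
      show "integrable lborel (\<lambda>\<xi>. 2 * norm (complex_of_real \<xi> * g \<xi>))"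
        by (rule integrable_mult_right, rule integrable_norm, rule g1)
      show "AE \<xi> in lborel. norm (R (h n) \<xi>) \<le> 2 * norm (complex_of_real \<xi> * g \<xi>)" for n
      proof (rule AE_I2)
        fix \<xi>
        have "norm ((cis (h n * \<xi>) - 1) / complex_of_real (h n)) \<le> \<bar>\<xi>\<bar>"
          using cis1[of "h n * \<xi>"] h(1) by (simp add: norm_divide abs_mult field_simps)
        then have "norm ((cis (h n * \<xi>) - 1) / complex_of_real (h n) - \<i> * \<xi>) \<le> 2 * \<bar>\<xi>\<bar>"
          using norm_triangle_ineq4[of "(cis (h n * \<xi>) - 1) / complex_of_real (h n)" "\<i> * \<xi>"] by (simp add: norm_mult)
        then show "norm (R (h n) \<xi>) \<le> 2 * norm (complex_of_real \<xi> * g \<xi>)"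
          unfolding R_def norm_mult by (simp add: mult_right_mono flip: mult.assoc)
      qed
      show "AE \<xi> in lborel. (\<lambda>n. R (h n) \<xi>) \<longlonglongrightarrow> 0"
      proof (rule AE_I2)
        fix \<xi> :: real
        have "((\<lambda>z. exp (\<i> * \<xi> * z)) has_field_derivative \<i> * \<xi>) (at 0)"
          by (auto intro!: derivative_eq_intros)
        then have "((\<lambda>z. (exp (\<i> * \<xi> * z) - 1) / z) \<longlongrightarrow> \<i> * \<xi>) (at 0)"
          by (simp add: DERIV_def)
        moreover have "filterlim (\<lambda>n. complex_of_real (h n)) (at 0) sequentially"
        proof (rule filterlim_atI)
          show "(\<lambda>n. complex_of_real (h n)) \<longlonglongrightarrow> 0" using tendsto_of_real[OF h(2)] by simp
        qed (use h(1) in simp)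
        ultimately have "(\<lambda>n. (exp (\<i> * \<xi> * complex_of_real (h n)) - 1) / complex_of_real (h n)) \<longlonglongrightarrow> \<i> * \<xi>"
          by (rule filterlim_compose)
        then have "(\<lambda>n. (cis (h n * \<xi>) - 1) / complex_of_real (h n)) \<longlonglongrightarrow> \<i> * \<xi>"
          by (simp add: cis_conv_exp mult_ac)
        then have "(\<lambda>n. R (h n) \<xi>) \<longlonglongrightarrow> cis (x * \<xi>) * (\<i> * \<xi> - \<i> * \<xi>) * g \<xi>"
          unfolding R_def
          by (rule tendsto_mult[OF tendsto_mult[OF tendsto_const tendsto_diff[OF _ tendsto_const]] tendsto_const])
        then show "(\<lambda>n. R (h n) \<xi>) \<longlonglongrightarrow> 0" by simp
      qed
    qed (simp_all add: Rm)
    then show "(\<lambda>n. LINT \<xi>|lborel. R (h n) \<xi>) \<longlonglongrightarrow> 0" by simp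
  qed
  then have "((\<lambda>h. norm ((1 / sqrt (2 * pi)) *\<^sub>R (LINT \<xi>|lborel. R h \<xi>))) \<longlongrightarrow> 0) (at 0)"
    by (auto intro!: tendsto_eq_intros)
  then have "((\<lambda>h. norm (inverse_fourier g (x + h) - inverse_fourier g x - h *\<^sub>R ?D) / norm h) \<longlongrightarrow> 0) (at 0)"
  proof (rule Lim_transform_eventually)
    show "\<forall>\<^sub>F h in at 0. norm ((1 / sqrt (2 * pi)) *\<^sub>R (LINT \<xi>|lborel. R h \<xi>))
        = norm (inverse_fourier g (x + h) - inverse_fourier g x - h *\<^sub>R ?D) / norm h"
    proof (rule eventually_at_filter[THEN iffD2], rule always_eventually, intro allI impI)
      fix h :: real assume "h \<noteq> 0"
      from quot[OF this, THEN arg_cong, of norm]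
      show "norm ((1 / sqrt (2 * pi)) *\<^sub>R (LINT \<xi>|lborel. R h \<xi>))
        = norm (inverse_fourier g (x + h) - inverse_fourier g x - h *\<^sub>R ?D) / norm h"
        by (simp add: divide_inverse mult.commute)
    qed
  qed
  then show ?thesis
    unfolding has_vector_derivative_def has_derivative_at
    by (simp add: bounded_linear_scaleR_left)
qed

lemma integrable_gaussian: "integrable lborel (\<lambda>x::real. exp (- x\<^sup>2 / 2))"
proof -
  have "integrable lborel (\<lambda>x. sqrt (2 * pi) * std_normal_density x)"
    by (intro integrable_mult_right) (simp add: integrable_std_normal_moment[of 0, simplified])
  then show ?thesis by (simp add: std_normal_density_def)
qed

text \<open>The translated Gaussians \<open>e\<^bsup>-(\<xi>-\<eta>)\<^sup>2/2\<^esup>\<close> have the transform \<open>e\<^bsup>-i\<eta>x\<^esup> e\<^bsup>-x\<^sup>2/2\<^esup>\<close>. Testing with them, and using Fubini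
  for the inverse transform of \<open>g\<close>, shows that \<open>f\<close> and that inverse transform, multiplied by a Gaussian, have
  the same Fourier transform.\<close>

lemma fourier_inversion:
  assumes fg: "has_fourier f g" and g: "integrable lborel g"
  shows "AE x in lborel. f x = inverse_fourier g x"
proof -
  have f2: "square_integrable f" using fg by (simp add: has_fourier_def)
  have [measurable]: "g \<in> borel_measurable borel" using g by auto
  have [measurable]: "f \<in> borel_measurable borel" using f2 by (simp add: square_integrable_def)
  have [measurable]: "inverse_fourier g \<in> borel_measurable borel"
    by (intro borel_measurable_continuous_onI continuous_inverse_fourier g)
  let ?e = "\<lambda>x. complex_of_real (exp (- x\<^sup>2 / 2))"
  have sc: "schwartz (\<lambda>\<xi>. complex_of_real (exp (- (\<xi> - \<eta>)\<^sup>2 / 2)))" for \<eta>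
  proof -
    have "complex_of_real (exp (- (\<xi> - \<eta>)\<^sup>2 / 2)) =
        exp (- \<eta>\<^sup>2 / 2) * exp (- (complex_of_real \<xi>)\<^sup>2 / 2 + \<eta> * complex_of_real \<xi>)" for \<xi>
      by (simp flip: exp_of_real exp_add, rule arg_cong[where f = exp], simp add: power2_eq_square field_simps)
    then show ?thesis using schwartz_gaussian by simp
  qed
  have e2: "square_integrable ?e" using schwartz_square_integrable[OF sc[of 0]] by simp
  have ei: "integrable lborel ?e" using integrable_gaussian by (rule integrable_of_real)
  have fe: "integrable lborel (\<lambda>x. f x * ?e x)"
    using f2 e2 by (rule square_integrable_mult_integrable)
  have Fe: "integrable lborel (\<lambda>x. inverse_fourier g x * ?e x)"
  proof (rule Bochner_Integration.integrable_bound[of _ "\<lambda>x. (LINT \<xi>|lborel. norm (g \<xi>)) *\<^sub>R ?e x"])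
    show "integrable lborel (\<lambda>x. (LINT \<xi>|lborel. norm (g \<xi>)) *\<^sub>R ?e x)" using ei by simp
    show "AE x in lborel. norm (inverse_fourier g x * ?e x) \<le> norm ((LINT \<xi>|lborel. norm (g \<xi>)) *\<^sub>R ?e x)"
      using norm_inverse_fourier_le[OF g] by (auto simp: norm_mult intro!: mult_right_mono order_trans[OF _ abs_ge_self])
  qed simp
  have main: "(LINT x|lborel. cis (- (\<eta> * x)) * (f x * ?e x)) = (LINT x|lborel. cis (- (\<eta> * x)) * (inverse_fourier g x * ?e x))" for \<eta>
  proof -
    let ?h = "\<lambda>x \<xi>. cis ((\<xi> - \<eta>) * x) * ?e x * g \<xi>"
    have cs: "cis ((\<xi> - \<eta>) * x) = cis (x * \<xi>) * cis (- (\<eta> * x))" for \<xi> x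
      by (simp add: cis_mult algebra_simps)
    have hi: "integrable (lborel \<Otimes>\<^sub>M lborel) (case_prod ?h)"
    proof (rule lborel_pair.Fubini_integrable)
      show "case_prod ?h \<in> borel_measurable (lborel \<Otimes>\<^sub>M lborel)" by measurable
      show "integrable lborel (\<lambda>x. LINT \<xi>|lborel. norm (case_prod ?h (x, \<xi>)))"
        using integrable_gaussian by (simp add: norm_mult)
      show "AE x in lborel. integrable lborel (\<lambda>\<xi>. case_prod ?h (x, \<xi>))"
      proof (rule AE_I2)
        fix x
        have "integrable lborel (\<lambda>\<xi>. cis (x * \<xi>) * (cis (- (\<eta> * x)) * ?e x * g \<xi>))"
          by (intro integrable_cis_mult integrable_mult_right g)
        then show "integrable lborel (\<lambda>\<xi>. case_prod ?h (x, \<xi>))"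
          unfolding cs prod.case by (simp add: mult_ac)
      qed
    qed
    have "(LINT x|lborel. cis (- (\<eta> * x)) * (inverse_fourier g x * ?e x))
        = (LINT x|lborel. (1 / sqrt (2 * pi)) * (LINT \<xi>|lborel. ?h x \<xi>))"
    proof (intro Bochner_Integration.integral_cong refl)
      fix x
      have "cis (- (\<eta> * x)) * ?e x * (LINT \<xi>|lborel. cis (x * \<xi>) * g \<xi>) = (LINT \<xi>|lborel. ?h x \<xi>)"
        unfolding integral_mult_right_zero[symmetric]
        by (intro Bochner_Integration.integral_cong refl) (unfold cs, simp only: mult_ac)
      then show "cis (- (\<eta> * x)) * (inverse_fourier g x * ?e x) = (1 / sqrt (2 * pi)) * (LINT \<xi>|lborel. ?h x \<xi>)"
        by (simp add: inverse_fourier_def scaleR_conv_of_real mult_ac)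
    qed
    also have "\<dots> = (1 / sqrt (2 * pi)) * (LINT \<xi>|lborel. LINT x|lborel. ?h x \<xi>)"
      using lborel_pair.Fubini_integral[OF hi] by simp
    also have "(LINT \<xi>|lborel. LINT x|lborel. ?h x \<xi>) = (LINT \<xi>|lborel. sqrt (2 * pi) * (g \<xi> * complex_of_real (exp (- (\<xi> - \<eta>)\<^sup>2 / 2))))"
      by (simp only: integral_mult_left_zero gaussian_transform) (simp add: mult_ac)
    also have "(1 / sqrt (2 * pi)) * \<dots> = (LINT \<xi>|lborel. g \<xi> * complex_of_real (exp (- (\<xi> - \<eta>)\<^sup>2 / 2)))"
      by (simp only: integral_mult_right_zero) (simp flip: of_real_mult mult.assoc)
    also have "\<dots> = (LINT x|lborel. f x * fourier (\<lambda>\<xi>. complex_of_real (exp (- (\<xi> - \<eta>)\<^sup>2 / 2))) x)"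
      using fg sc unfolding has_fourier_def by blast
    also have "\<dots> = (LINT x|lborel. cis (- (\<eta> * x)) * (f x * ?e x))"
      unfolding fourier_gaussian by (simp add: mult_ac)
    finally show ?thesis by simp
  qed
  let ?k = "\<lambda>x. f x * ?e x - inverse_fourier g x * ?e x"
  have "AE x in lborel. ?k x = 0"
  proof (rule fourier_zero_imp_AE_zero)
    show "integrable lborel ?k" using fe Fe by simp
    show "(LINT x|lborel. cis (\<eta> * x) * ?k x) = 0" for \<eta>
      using main[of "- \<eta>"] integrable_cis_mult[OF fe, of \<eta>] integrable_cis_mult[OF Fe, of \<eta>]
      by (simp add: right_diff_distrib)
  qed
  then show ?thesis by eventually_elim simp
qed

lemma integrable_bessel_weight:
  fixes \<rho> :: real assumes "1 / 2 < \<rho>"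
  shows "integrable lborel (\<lambda>x. (1 + x\<^sup>2) powr (- \<rho>))"
proof -
  let ?f = "\<lambda>x::real. x powr (- 2 * \<rho>)"
  let ?F = "\<lambda>x::real. x powr (1 - 2 * \<rho>) / (1 - 2 * \<rho>)"
  have nn: "(\<integral>\<^sup>+x. ennreal (?f x) * indicator {1..} x \<partial>lborel) = 0 - ?F 1"
  proof (rule nn_integral_FTC_atLeast[where F = ?F and T = 0])
    show "(?F has_real_derivative ?f x) (at x)" if "1 \<le> x" for x
      using that assms by (auto intro!: derivative_eq_intros)
    show "(?F \<longlongrightarrow> 0) at_top"
      using assms by (intro tendsto_divide_zero tendsto_neg_powr filterlim_ident) auto
  qed auto
  have q: "integrable lborel (\<lambda>x. ?f x * indicator {1..} x)"
  proof (rule integrableI_nonneg)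
    have "(\<integral>\<^sup>+ x. ennreal (?f x * indicator {1..} x) \<partial>lborel) = (\<integral>\<^sup>+x. ennreal (?f x) * indicator {1..} x \<partial>lborel)"
      by (intro nn_integral_cong) (auto simp: indicator_def)
    then show "(\<integral>\<^sup>+ x. ennreal (?f x * indicator {1..} x) \<partial>lborel) < \<infinity>"
      unfolding nn by simp
  qed auto
  have q': "integrable lborel (\<lambda>x. ?f (- x) * indicator {1..} (- x))"
    using lborel_integrable_real_affine[OF q, of "- 1" 0] by simp
  have c: "integrable lborel (\<lambda>x::real. indicator {-1..1} x :: real)" by simp
  show ?thesis
  proof (rule Bochner_Integration.integrable_bound)
    show "integrable lborel (\<lambda>x. ?f x * indicator {1..} x + ?f (- x) * indicator {1..} (- x) + indicator {-1..1} x)"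
      using q q' c by simp
    have le: "(1 + x\<^sup>2) powr (- \<rho>) \<le> \<bar>x\<bar> powr (- 2 * \<rho>)" if "x \<noteq> 0" for x :: real
    proof -
      have "(1 + x\<^sup>2) powr (- \<rho>) \<le> (\<bar>x\<bar>\<^sup>2) powr (- \<rho>)"
        using that assms by (intro powr_mono2') auto
      also have "\<dots> = \<bar>x\<bar> powr (- 2 * \<rho>)"
      proof -
        have "\<bar>x\<bar>\<^sup>2 = \<bar>x\<bar> powr 2" using that by (simp add: powr_numeral)
        then show ?thesis by (simp only: powr_powr) simp
      qed
      finally show ?thesis .
    qed
    have le1: "(1 + x\<^sup>2) powr (- \<rho>) \<le> 1" for x :: real
      using powr_mono2'[of "- \<rho>" 1 "1 + x\<^sup>2"] assms by simp
    have "(1 + x\<^sup>2) powr (- \<rho>) \<le> ?f x * indicator {1..} x + ?f (- x) * indicator {1..} (- x) + indicator {-1..1} x" for x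
      using le[of x] le1[of x] by (auto simp: indicator_def)
    then show "AE x in lborel. norm ((1 + x\<^sup>2) powr (- \<rho>)) \<le>
        norm (?f x * indicator {1..} x + ?f (- x) * indicator {1..} (- x) + indicator {-1..1} x)"
      by (intro AE_I2) (metis abs_ge_self order_trans powr_ge_zero real_norm_def abs_of_nonneg)
  qed simp
qed

text \<open>The quadratic polynomial in \<open>s\<close> that is the integral of \<open>(s a - b)\<^sup>2\<close> is nonnegative.\<close>

lemma integral_Cauchy_Schwarz:
  fixes a b :: "'a \<Rightarrow> real"
  assumes [measurable]: "a \<in> borel_measurable M" "b \<in> borel_measurable M"
    and a: "integrable M (\<lambda>x. (a x)\<^sup>2)" and b: "integrable M (\<lambda>x. (b x)\<^sup>2)"
  shows "integrable M (\<lambda>x. a x * b x)"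
    and "(LINT x|M. a x * b x)\<^sup>2 \<le> (LINT x|M. (a x)\<^sup>2) * (LINT x|M. (b x)\<^sup>2)"
proof -
  show ab: "integrable M (\<lambda>x. a x * b x)"
  proof (rule Bochner_Integration.integrable_bound)
    show "integrable M (\<lambda>x. (a x)\<^sup>2 + (b x)\<^sup>2)" using a b by simp
    have "\<bar>a x * b x\<bar> \<le> (a x)\<^sup>2 + (b x)\<^sup>2" for x
    proof -
      have "2 * \<bar>a x * b x\<bar> \<le> (a x)\<^sup>2 + (b x)\<^sup>2"
        using sum_squares_bound[of "\<bar>a x\<bar>" "\<bar>b x\<bar>"] by (simp add: abs_mult mult.assoc)
      then show ?thesis using abs_ge_zero[of "a x * b x"] by linarith
    qed
    then show "AE x in M. norm (a x * b x) \<le> norm ((a x)\<^sup>2 + (b x)\<^sup>2)" by simp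
  qed simp
  define A B X where "A = (LINT x|M. (a x)\<^sup>2)" and "B = (LINT x|M. (b x)\<^sup>2)" and "X = (LINT x|M. a x * b x)"
  have quad: "0 \<le> s\<^sup>2 * A - 2 * s * X + B" for s
  proof -
    have "0 \<le> (LINT x|M. (s * a x - b x)\<^sup>2)" by simp
    also have "\<dots> = (LINT x|M. s\<^sup>2 * (a x)\<^sup>2 - 2 * s * (a x * b x) + (b x)\<^sup>2)"
      by (intro Bochner_Integration.integral_cong refl) (simp add: power2_eq_square algebra_simps)
    also have "\<dots> = s\<^sup>2 * A - 2 * s * X + B"
      using a b ab by (simp add: A_def B_def X_def)
    finally show ?thesis .
  qed
  have "A \<ge> 0" unfolding A_def by simp
  show "X\<^sup>2 \<le> A * B"
  proof (cases "A = 0")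
    case True
    then have X: "2 * s * X \<le> B" for s using quad[of s] by simp
    have "X = 0"
    proof (rule ccontr)
      assume "X \<noteq> 0"
      \<comment> \<open>This \<open>s\<close> makes \<open>2 s X\<close> equal to \<open>B + 1\<close>.\<close>
      then show False using X[of "(B + 1) / (2 * X)"] by simp
    qed
    then show ?thesis using True by simp
  next
    case False
    then have "A > 0" using \<open>A \<ge> 0\<close> by simp
    then show ?thesis using quad[of "X / A"] by (simp add: power2_eq_square field_simps)
  qed
qed

section \<open>Sobolev embedding\<close>

abbreviation ft :: "(real \<Rightarrow> real) \<Rightarrow> real \<Rightarrow> complex" where
  "ft f \<equiv> fourier_L2 (\<lambda>x. complex_of_real (f x))"

lemma one_plus_square_neq_0 [simp]: "1 + x\<^sup>2 \<noteq> (0 :: real)"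
  using zero_le_power2[of x] by linarith

lemma sobolev_ft:
  assumes "f \<in> sobolev r"
  shows "has_fourier (\<lambda>x. complex_of_real (f x)) (ft f)"
    and "integrable lborel (\<lambda>\<xi>. (1 + \<xi>\<^sup>2) powr r * (norm (ft f \<xi>))\<^sup>2)"
proof -
  obtain g where g: "has_fourier (\<lambda>x. complex_of_real (f x)) g"
      "square_integrable (\<lambda>\<xi>. ((1 + \<xi>\<^sup>2) powr (r / 2)) *\<^sub>R g \<xi>)"
    using assms by (auto simp: sobolev_def)
  show ft: "has_fourier (\<lambda>x. complex_of_real (f x)) (ft f)"
    unfolding fourier_L2_def using g(1) by (rule someI[of "has_fourier (\<lambda>x. complex_of_real (f x))"])
  have eq: "AE \<xi> in lborel. g \<xi> = ft f \<xi>" using g(1) ft by (rule has_fourier_unique)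
  have [measurable]: "ft f \<in> borel_measurable borel" "g \<in> borel_measurable borel"
    using ft g(1) by (auto simp: has_fourier_def square_integrable_def)
  have "((1 + \<xi>\<^sup>2) powr (r / 2))\<^sup>2 = (1 + \<xi>\<^sup>2) powr r" for \<xi> :: real
    by (simp add: power2_eq_square flip: powr_add)
  then have "integrable lborel (\<lambda>\<xi>. (1 + \<xi>\<^sup>2) powr r * (norm (g \<xi>))\<^sup>2)"
    using g(2) by (simp add: square_integrable_def power_mult_distrib)
  moreover have "AE \<xi> in lborel. (1 + \<xi>\<^sup>2) powr r * (norm (g \<xi>))\<^sup>2 = (1 + \<xi>\<^sup>2) powr r * (norm (ft f \<xi>))\<^sup>2"
    using eq by eventually_elim simp
  ultimately show "integrable lborel (\<lambda>\<xi>. (1 + \<xi>\<^sup>2) powr r * (norm (ft f \<xi>))\<^sup>2)"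
    by (subst integrable_cong_AE[symmetric]) auto
qed

lemma sobolev_diff:
  assumes "f \<in> sobolev r" "g \<in> sobolev r"
  shows "(\<lambda>x. f x - g x) \<in> sobolev r"
proof -
  obtain f' where f': "has_fourier (\<lambda>x. complex_of_real (f x)) f'"
      "square_integrable (\<lambda>\<xi>. ((1 + \<xi>\<^sup>2) powr (r / 2)) *\<^sub>R f' \<xi>)"
    using assms(1) by (auto simp: sobolev_def)
  obtain g' where g': "has_fourier (\<lambda>x. complex_of_real (g x)) g'"
      "square_integrable (\<lambda>\<xi>. ((1 + \<xi>\<^sup>2) powr (r / 2)) *\<^sub>R g' \<xi>)"
    using assms(2) by (auto simp: sobolev_def)
  show ?thesis
    using has_fourier_diff[OF f'(1) g'(1)] square_integrable_diff[OF f'(2) g'(2)]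
    unfolding sobolev_def by (auto simp: scaleR_diff_right)
qed

lemma sobolev_divide:
  assumes "f \<in> sobolev r" shows "(\<lambda>x. f x / a) \<in> sobolev r"
proof -
  obtain f' where f': "has_fourier (\<lambda>x. complex_of_real (f x)) f'"
      "square_integrable (\<lambda>\<xi>. ((1 + \<xi>\<^sup>2) powr (r / 2)) *\<^sub>R f' \<xi>)"
    using assms by (auto simp: sobolev_def)
  have "has_fourier (\<lambda>x. complex_of_real (f x / a)) (\<lambda>\<xi>. complex_of_real (1 / a) * f' \<xi>)"
    using has_fourier_cmult[OF f'(1), of "complex_of_real (1 / a)"] by simp
  moreover have "square_integrable (\<lambda>\<xi>. ((1 + \<xi>\<^sup>2) powr (r / 2)) *\<^sub>R (complex_of_real (1 / a) * f' \<xi>))"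
    using square_integrable_cmult[OF f'(2), of "complex_of_real (1 / a)"]
    by (simp only: mult_scaleR_right)
  ultimately show ?thesis unfolding sobolev_def by blast
qed

lemma sobolev_mono:
  assumes "f \<in> sobolev r" "r' \<le> r" shows "f \<in> sobolev r'"
proof -
  obtain f' where f': "has_fourier (\<lambda>x. complex_of_real (f x)) f'"
      "square_integrable (\<lambda>\<xi>. ((1 + \<xi>\<^sup>2) powr (r / 2)) *\<^sub>R f' \<xi>)"
    using assms by (auto simp: sobolev_def)
  have [measurable]: "f' \<in> borel_measurable borel"
    using f'(1) by (auto simp: has_fourier_def square_integrable_def)
  have "square_integrable (\<lambda>\<xi>. ((1 + \<xi>\<^sup>2) powr (r' / 2)) *\<^sub>R f' \<xi>)"
    unfolding square_integrable_def
  proof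
    have i: "integrable lborel (\<lambda>\<xi>. (norm (((1 + \<xi>\<^sup>2) powr (r / 2)) *\<^sub>R f' \<xi>))\<^sup>2)"
      using f'(2) by (simp only: square_integrable_def)
    have le: "(norm (((1 + \<xi>\<^sup>2) powr (r' / 2)) *\<^sub>R f' \<xi>))\<^sup>2 \<le> (norm (((1 + \<xi>\<^sup>2) powr (r / 2)) *\<^sub>R f' \<xi>))\<^sup>2" for \<xi>
      unfolding norm_scaleR using assms(2) by (intro power_mono mult_right_mono) (auto intro!: powr_mono)
    show "integrable lborel (\<lambda>\<xi>. (norm (((1 + \<xi>\<^sup>2) powr (r' / 2)) *\<^sub>R f' \<xi>))\<^sup>2)"
    proof (rule Bochner_Integration.integrable_bound[OF i])
      show "AE \<xi> in lborel. norm ((norm (((1 + \<xi>\<^sup>2) powr (r' / 2)) *\<^sub>R f' \<xi>))\<^sup>2) \<le> norm ((norm (((1 + \<xi>\<^sup>2) powr (r / 2)) *\<^sub>R f' \<xi>))\<^sup>2)"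
        using le by simp
    qed measurable
  qed measurable
  then show ?thesis using f'(1) unfolding sobolev_def by blast
qed

text \<open>Cauchy-Schwarz against the weight \<open>(1 + \<xi>\<^sup>2)\<^bsup>-\<rho>/2\<^esup>\<close>, which is square integrable for \<open>\<rho> > 1/2\<close>. The multiplier
  \<open>m\<close> is \<open>1\<close> for bounding the function and \<open>\<xi>\<close> for bounding its derivative.\<close>

lemma sobolev_weighted_L1:
  fixes m :: "real \<Rightarrow> complex"
  assumes f: "f \<in> sobolev r" and \<rho>: "1 / 2 < \<rho>"
    and [measurable]: "m \<in> borel_measurable borel"
    and m: "\<And>\<xi>. (norm (m \<xi>))\<^sup>2 \<le> (1 + \<xi>\<^sup>2) powr (r - \<rho>)"
  shows "integrable lborel (\<lambda>\<xi>. m \<xi> * ft f \<xi>)"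
    and "(LINT \<xi>|lborel. norm (m \<xi> * ft f \<xi>))
      \<le> sqrt (LINT \<xi>|lborel. (1 + \<xi>\<^sup>2) powr (- \<rho>)) * sobolev_norm r f"
proof -
  note ft = sobolev_ft[OF f]
  have [measurable]: "ft f \<in> borel_measurable borel"
    using ft(1) by (auto simp: has_fourier_def square_integrable_def)
  define a where "a \<xi> = norm (m \<xi> * ft f \<xi>) * (1 + \<xi>\<^sup>2) powr (\<rho> / 2)" for \<xi>
  define b where "b \<xi> = (1 + \<xi>\<^sup>2) powr (- \<rho> / 2)" for \<xi> :: real
  have [measurable]: "a \<in> borel_measurable borel" "b \<in> borel_measurable borel"
    unfolding a_def b_def by measurable
  have b2: "(b \<xi>)\<^sup>2 = (1 + \<xi>\<^sup>2) powr (- \<rho>)" for \<xi>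
    by (simp add: b_def power2_eq_square flip: powr_add)
  have a2: "(a \<xi>)\<^sup>2 \<le> (1 + \<xi>\<^sup>2) powr r * (norm (ft f \<xi>))\<^sup>2" for \<xi>
  proof -
    have "(a \<xi>)\<^sup>2 = (norm (m \<xi>))\<^sup>2 * (1 + \<xi>\<^sup>2) powr \<rho> * (norm (ft f \<xi>))\<^sup>2"
      by (simp add: a_def norm_mult power_mult_distrib power2_eq_square mult_ac flip: powr_add)
    also have "\<dots> \<le> (1 + \<xi>\<^sup>2) powr (r - \<rho>) * (1 + \<xi>\<^sup>2) powr \<rho> * (norm (ft f \<xi>))\<^sup>2"
      using m[of \<xi>] by (intro mult_right_mono) auto
    also have "\<dots> = (1 + \<xi>\<^sup>2) powr r * (norm (ft f \<xi>))\<^sup>2"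
      by (simp flip: powr_add)
    finally show ?thesis .
  qed
  have ab: "a \<xi> * b \<xi> = norm (m \<xi> * ft f \<xi>)" for \<xi>
  proof -
    have "0 < 1 + \<xi>\<^sup>2" by (simp add: add_pos_nonneg)
    then have "(1 + \<xi>\<^sup>2) powr (\<rho> / 2) * (1 + \<xi>\<^sup>2) powr (- \<rho> / 2) = 1"
      by (simp flip: powr_add)
    then show ?thesis by (simp add: a_def b_def mult.assoc)
  qed
  have ia: "integrable lborel (\<lambda>\<xi>. (a \<xi>)\<^sup>2)"
    by (rule Bochner_Integration.integrable_bound[OF ft(2)]) (use a2 in auto)
  have ib: "integrable lborel (\<lambda>\<xi>. (b \<xi>)\<^sup>2)"
    unfolding b2 by (rule integrable_bessel_weight[OF \<rho>])
  have "integrable lborel (\<lambda>\<xi>. a \<xi> * b \<xi>)"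
    by (rule integral_Cauchy_Schwarz(1)[OF _ _ ia ib]) auto
  then show "integrable lborel (\<lambda>\<xi>. m \<xi> * ft f \<xi>)"
    unfolding ab by (rule integrable_norm_cancel) simp
  have "(LINT \<xi>|lborel. a \<xi> * b \<xi>)\<^sup>2 \<le> (LINT \<xi>|lborel. (a \<xi>)\<^sup>2) * (LINT \<xi>|lborel. (b \<xi>)\<^sup>2)"
    by (rule integral_Cauchy_Schwarz(2)[OF _ _ ia ib]) auto
  also have "\<dots> \<le> (LINT \<xi>|lborel. (1 + \<xi>\<^sup>2) powr r * (norm (ft f \<xi>))\<^sup>2) * (LINT \<xi>|lborel. (b \<xi>)\<^sup>2)"
    by (intro mult_right_mono integral_mono ia ft a2) simp
  finally have "sqrt ((LINT \<xi>|lborel. a \<xi> * b \<xi>)\<^sup>2) \<le> sqrt \<dots>" by (rule real_sqrt_le_mono)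
  then show "(LINT \<xi>|lborel. norm (m \<xi> * ft f \<xi>)) \<le> sqrt (LINT \<xi>|lborel. (1 + \<xi>\<^sup>2) powr (- \<rho>)) * sobolev_norm r f"
    unfolding ab b2 by (simp add: sobolev_norm_def real_sqrt_mult mult.commute)
qed

lemma sobolev_continuous_representative:
  assumes r: "1 / 2 < r"
  obtains C where "0 \<le> C" "\<And>f. f \<in> sobolev r \<Longrightarrow> \<exists>F. continuous_on UNIV F \<and>
    (AE x in lborel. f x = F x) \<and> (\<forall>x. \<bar>F x\<bar> \<le> C * sobolev_norm r f)"
proof
  let ?C = "sqrt (LINT \<xi>|lborel. (1 + \<xi>\<^sup>2) powr (- r))"
  show "0 \<le> ?C" by simp
  fix f assume f: "f \<in> sobolev r"
  note L1 = sobolev_weighted_L1[OF f r, of "\<lambda>_. 1"]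
  have i: "integrable lborel (ft f)" using L1(1) by simp
  have le: "(LINT \<xi>|lborel. norm (ft f \<xi>)) \<le> ?C * sobolev_norm r f" using L1(2) by simp
  show "\<exists>F. continuous_on UNIV F \<and> (AE x in lborel. f x = F x) \<and> (\<forall>x. \<bar>F x\<bar> \<le> ?C * sobolev_norm r f)"
  proof (intro exI conjI allI)
    show "continuous_on UNIV (\<lambda>x. Re (inverse_fourier (ft f) x))"
      using continuous_inverse_fourier[OF i] by (intro continuous_intros)
    show "AE x in lborel. f x = Re (inverse_fourier (ft f) x)"
      using fourier_inversion[OF sobolev_ft(1)[OF f] i] by eventually_elim (metis Re_complex_of_real)
    show "\<bar>Re (inverse_fourier (ft f) x)\<bar> \<le> ?C * sobolev_norm r f" for x
      using abs_Re_le_cmod[of "inverse_fourier (ft f) x"] norm_inverse_fourier_le[OF i, of x] le by linarith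
  qed
qed

text \<open>The constant depends on \<open>r\<close> only, so that convergence in the Sobolev norm implies uniform convergence of
  the representatives and of their derivatives.\<close>

lemma sobolev_C1_representative:
  assumes r: "3 / 2 < r"
  obtains C where "0 \<le> C" "\<And>f. f \<in> sobolev r \<Longrightarrow> \<exists>F F'. (\<forall>x. (F has_real_derivative F' x) (at x)) \<and>
    continuous_on UNIV F' \<and> (AE x in lborel. f x = F x) \<and>
    (\<forall>x. \<bar>F x\<bar> \<le> C * sobolev_norm r f \<and> \<bar>F' x\<bar> \<le> C * sobolev_norm r f)"
proof
  let ?C = "sqrt (LINT \<xi>|lborel. (1 + \<xi>\<^sup>2) powr (- (r - 1)))"
  have r1: "1 / 2 < r - 1" using r by simp
  show "0 \<le> ?C" by simp
  fix f assume f: "f \<in> sobolev r"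
  note L0 = sobolev_weighted_L1[OF f r1, of "\<lambda>_. 1"]
    and L1 = sobolev_weighted_L1[OF f r1, of "\<lambda>\<xi>. complex_of_real \<xi>"]
  have i: "integrable lborel (ft f)" using L0(1) by simp
  have le: "(LINT \<xi>|lborel. norm (ft f \<xi>)) \<le> ?C * sobolev_norm r f" using L0(2) by simp
  have i1: "integrable lborel (\<lambda>\<xi>. complex_of_real \<xi> * ft f \<xi>)" using L1(1) by simp
  have le1: "(LINT \<xi>|lborel. norm (\<i> * (complex_of_real \<xi> * ft f \<xi>))) \<le> ?C * sobolev_norm r f"
    using L1(2) by (simp add: norm_mult)
  let ?G = "inverse_fourier (\<lambda>\<xi>. \<i> * (complex_of_real \<xi> * ft f \<xi>))"
  have iG: "integrable lborel (\<lambda>\<xi>. \<i> * (complex_of_real \<xi> * ft f \<xi>))" using i1 by simp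
  show "\<exists>F F'. (\<forall>x. (F has_real_derivative F' x) (at x)) \<and>
    continuous_on UNIV F' \<and> (AE x in lborel. f x = F x) \<and>
    (\<forall>x. \<bar>F x\<bar> \<le> ?C * sobolev_norm r f \<and> \<bar>F' x\<bar> \<le> ?C * sobolev_norm r f)"
  proof (intro exI conjI allI)
    show "((\<lambda>x. Re (inverse_fourier (ft f) x)) has_real_derivative Re (?G x)) (at x)" for x
      using inverse_fourier_has_derivative[OF i i1, of x]
      unfolding has_real_derivative_iff_has_vector_derivative
      by (rule bounded_linear.has_vector_derivative[OF bounded_linear_Re])
    show "continuous_on UNIV (\<lambda>x. Re (?G x))"
      using continuous_inverse_fourier[OF iG] by (intro continuous_intros)
    show "AE x in lborel. f x = Re (inverse_fourier (ft f) x)"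
      using fourier_inversion[OF sobolev_ft(1)[OF f] i] by eventually_elim (metis Re_complex_of_real)
    show "\<bar>Re (inverse_fourier (ft f) x)\<bar> \<le> ?C * sobolev_norm r f" for x
      using abs_Re_le_cmod[of "inverse_fourier (ft f) x"] norm_inverse_fourier_le[OF i, of x] le by linarith
    show "\<bar>Re (?G x)\<bar> \<le> ?C * sobolev_norm r f" for x
      using abs_Re_le_cmod[of "?G x"] norm_inverse_fourier_le[OF iG, of x] le1 by linarith
  qed
qed

text \<open>This makes the continuous representatives unique, so that they depend linearly on the function.\<close>

lemma AE_eq_continuous_imp_eq:
  fixes F G :: "real \<Rightarrow> real"
  assumes "continuous_on UNIV F" "continuous_on UNIV G" "AE x in lborel. F x = G x"
  shows "F = G"
proof
  fix x
  have "closed {x. F x = G x}" using assms by (intro closed_Collect_eq)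
  moreover have "AE x in lebesgue. x \<in> {x. F x = G x}"
    using assms(3) by (auto intro: AE_completion)
  ultimately show "F x = G x"
    using mem_closed_if_AE_lebesgue by blast
qed

section \<open>One-sided exponential convolutions\<close>

text \<open>The convolution of \<open>f\<close> with one half of the kernel \<open>e\<^bsup>-\<bar>x\<bar>/c\<^esup>\<close>, which only sees \<open>f\<close> to the right of the point.\<close>

definition right_potential :: "real \<Rightarrow> (real \<Rightarrow> real) \<Rightarrow> real \<Rightarrow> real" where
  "right_potential c f x = (LINT y|lborel. indicator {x..} y * (exp ((x - y) / c) * f y))"

definition left_potential :: "real \<Rightarrow> (real \<Rightarrow> real) \<Rightarrow> real \<Rightarrow> real" where
  "left_potential c f x = (LINT y|lborel. indicator {..x} y * (exp ((y - x) / c) * f y))"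

lemma exp_decay:
  fixes c :: real assumes "0 < c" shows "((\<lambda>y. exp (- (y / c))) \<longlongrightarrow> 0) at_top"
proof -
  have "filterlim (\<lambda>y. (1 / c) * y) at_top at_top"
    by (rule filterlim_tendsto_pos_mult_at_top[OF tendsto_const])
       (use assms in \<open>auto intro: filterlim_ident\<close>)
  then have "filterlim (\<lambda>y. - (y / c)) at_bot at_top"
    by (simp add: filterlim_uminus_at_top)
  then show ?thesis by (rule filterlim_compose[OF exp_at_bot])
qed

lemma right_exponential:
  fixes c x :: real assumes "0 < c"
  shows "integrable lborel (\<lambda>y. indicator {x..} y * exp ((x - y) / c))"
    and "(LINT y|lborel. indicator {x..} y * exp ((x - y) / c)) = c"
proof -
  have nn: "(\<integral>\<^sup>+y. ennreal (exp ((x - y) / c)) * indicator {x..} y \<partial>lborel) = 0 - (- c * exp ((x - x) / c))"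
  proof (rule nn_integral_FTC_atLeast[where F = "\<lambda>y. - c * exp ((x - y) / c)" and T = 0])
    show "((\<lambda>y. - c * exp ((x - y) / c)) has_real_derivative exp ((x - y) / c)) (at y)" for y
      using assms by (auto intro!: derivative_eq_intros)
    have "((\<lambda>y. - c * (exp (x / c) * exp (- (y / c)))) \<longlongrightarrow> - c * (exp (x / c) * 0)) at_top"
      by (intro tendsto_mult tendsto_const exp_decay assms)
    then show "((\<lambda>y. - c * exp ((x - y) / c)) \<longlongrightarrow> 0) at_top"
      by (simp add: diff_divide_distrib exp_diff exp_minus field_simps)
  qed auto
  have eq: "(\<integral>\<^sup>+y. ennreal (indicator {x..} y * exp ((x - y) / c)) \<partial>lborel) = ennreal c"
  proof -
    have "(\<integral>\<^sup>+y. ennreal (indicator {x..} y * exp ((x - y) / c)) \<partial>lborel)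
        = (\<integral>\<^sup>+y. ennreal (exp ((x - y) / c)) * indicator {x..} y \<partial>lborel)"
      by (intro nn_integral_cong) (simp add: indicator_def)
    then show ?thesis unfolding nn by simp
  qed
  show "integrable lborel (\<lambda>y. indicator {x..} y * exp ((x - y) / c))"
    by (rule integrableI_nonneg) (auto simp: eq)
  show "(LINT y|lborel. indicator {x..} y * exp ((x - y) / c)) = c"
    using eq assms by (subst integral_eq_nn_integral) auto
qed

context
  fixes c M :: real and f :: "real \<Rightarrow> real"
  assumes c: "0 < c" and fc: "continuous_on UNIV f" and fM: "\<And>x. \<bar>f x\<bar> \<le> M"
begin

lemma right_potential_integrable:
  "integrable lborel (\<lambda>y. indicator {x..} y * (exp ((x - y) / c) * f y))"
proof (rule Bochner_Integration.integrable_bound)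
  show "integrable lborel (\<lambda>y. M * (indicator {x..} y * exp ((x - y) / c)))"
    by (rule integrable_mult_right, rule right_exponential(1)[OF c])
  show "(\<lambda>y. indicator {x..} y * (exp ((x - y) / c) * f y)) \<in> borel_measurable lborel"
    using borel_measurable_continuous_onI[OF fc] by measurable
  show "AE y in lborel. norm (indicator {x..} y * (exp ((x - y) / c) * f y)) \<le> norm (M * (indicator {x..} y * exp ((x - y) / c)))"
    using fM by (intro AE_I2) (auto simp: indicator_def abs_mult mult.commute intro!: mult_left_mono order_trans[OF _ abs_ge_self])
qed

lemma right_potential_bound: "\<bar>right_potential c f x\<bar> \<le> c * M"
proof -
  have "\<bar>right_potential c f x\<bar> \<le> (LINT y|lborel. norm (indicator {x..} y * (exp ((x - y) / c) * f y)))"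
    unfolding right_potential_def using integral_norm_bound by fastforce
  also have "\<dots> \<le> (LINT y|lborel. M * (indicator {x..} y * exp ((x - y) / c)))"
  proof (rule integral_mono)
    show "integrable lborel (\<lambda>y. norm (indicator {x..} y * (exp ((x - y) / c) * f y)))"
      by (rule integrable_norm, rule right_potential_integrable)
    show "integrable lborel (\<lambda>y. M * (indicator {x..} y * exp ((x - y) / c)))"
      by (rule integrable_mult_right, rule right_exponential(1)[OF c])
  qed (use fM in \<open>auto simp: indicator_def abs_mult mult.commute intro!: mult_left_mono\<close>)
  also have "\<dots> = c * M"
    using right_exponential(2)[OF c] by simp
  finally show ?thesis .
qed

text \<open>After the factor \<open>e\<^bsup>x/c\<^esup>\<close> is taken out, the lower limit of integration is the only dependence on \<open>x\<close>.\<close>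

lemma right_potential_has_derivative:
  "(right_potential c f has_real_derivative right_potential c f x / c - f x) (at x)"
proof -
  define k where "k y = exp (- y / c) * f y" for y
  have kc: "continuous_on A k" for A
    unfolding k_def using fc c by (auto intro!: continuous_intros intro: continuous_on_subset)
  define H where "H x = (LINT y|lborel. indicator {x..} y * k y)" for x
  have RH: "right_potential c f x = exp (x / c) * H x" for x
    unfolding right_potential_def H_def integral_mult_right_zero[symmetric]
    by (intro Bochner_Integration.integral_cong refl)
       (simp add: k_def exp_add[symmetric] diff_divide_distrib flip: mult.assoc)
  have ki: "integrable lborel (\<lambda>y. indicator {x..} y * k y)" for x
  proof -
    have "integrable lborel (\<lambda>y. exp (- x / c) * (indicator {x..} y * (exp ((x - y) / c) * f y)))"
      by (rule integrable_mult_right, rule right_potential_integrable)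
    then show ?thesis
      by (simp add: k_def diff_divide_distrib exp_diff exp_minus field_simps)
  qed
  define a where "a = x - 1"
  have split: "H y = H a - integral {a..y} k" if "a \<le> y" for y
  proof -
    have i: "set_integrable lborel {a..y} k"
      using kc by (rule borel_integrable_atLeastAtMost')
    then have i': "integrable lborel (\<lambda>z. indicator {a..y} z * k z)"
      by (simp add: set_integrable_def)
    have km: "k \<in> borel_measurable borel" using kc by (rule borel_measurable_continuous_onI)
    have "H a = (LINT z|lborel. indicator {a..y} z * k z + indicator {y..} z * k z)"
      unfolding H_def
    proof (rule integral_cong_AE)
      show "AE z in lborel. indicator {a..} z * k z = indicator {a..y} z * k z + indicator {y..} z * k z"
        using AE_lborel_singleton[of y] by eventually_elim (use that in \<open>auto simp: indicator_def\<close>)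
    qed (use km in measurable)
    also have "\<dots> = integral {a..y} k + H y"
      using i' ki set_borel_integral_eq_integral(2)[OF i]
      by (simp add: H_def set_lebesgue_integral_def)
    finally show ?thesis by simp
  qed
  have "((\<lambda>y. integral {a..y} k) has_real_derivative k x) (at x within {a..x + 1})"
    by (rule integral_has_real_derivative[OF kc]) (simp add: a_def)
  then have "((\<lambda>y. integral {a..y} k) has_real_derivative k x) (at x)"
    by (simp add: a_def at_within_Icc_at)
  then have "((\<lambda>y. H a - integral {a..y} k) has_real_derivative - k x) (at x)"
    by (auto intro!: derivative_eq_intros)
  then have "(H has_real_derivative - k x) (at x)"
  proof (rule DERIV_cong_ev[OF refl _ refl, THEN iffD1, rotated])
    have "\<forall>\<^sub>F y in nhds x. y \<in> {a<..}"
      by (rule eventually_nhds_in_open) (auto simp: a_def)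
    then show "\<forall>\<^sub>F y in nhds x. H a - integral {a..y} k = H y"
      by eventually_elim (rule split[symmetric], simp)
  qed
  then have "((\<lambda>x. exp (x / c) * H x) has_real_derivative exp (x / c) * (- k x) + (1 / c) * exp (x / c) * H x) (at x)"
    using c by (auto intro!: derivative_eq_intros)
  moreover have "exp (x / c) * (- k x) + (1 / c) * exp (x / c) * H x = right_potential c f x / c - f x"
    by (simp add: RH k_def exp_minus field_simps)
  ultimately show ?thesis unfolding RH[abs_def, symmetric] by simp
qed

end

lemma left_potential_reflect: "left_potential c f x = right_potential c (\<lambda>y. f (- y)) (- x)"
  unfolding left_potential_def right_potential_def
  by (subst lborel_integral_real_affine[where c = "- 1" and t = 0])
     (auto simp: indicator_def intro!: Bochner_Integration.integral_cong)

context
  fixes c M :: real and f :: "real \<Rightarrow> real"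
  assumes c: "0 < c" and fc: "continuous_on UNIV f" and fM: "\<And>x. \<bar>f x\<bar> \<le> M"
begin

lemma reflect_continuous: "continuous_on UNIV (\<lambda>y. f (- y))"
  by (intro continuous_on_compose2[OF fc] continuous_intros) auto

lemma left_potential_bound: "\<bar>left_potential c f x\<bar> \<le> c * M"
  unfolding left_potential_reflect
  by (rule right_potential_bound[OF c reflect_continuous]) (rule fM)

lemma left_potential_has_derivative:
  "(left_potential c f has_real_derivative f x - left_potential c f x / c) (at x)"
proof -
  have "((\<lambda>x. right_potential c (\<lambda>y. f (- y)) (- x)) has_real_derivative
      (right_potential c (\<lambda>y. f (- y)) (- x) / c - f (- (- x))) * (- 1)) (at x)"
    by (rule DERIV_chain2[OF right_potential_has_derivative[OF c reflect_continuous fM]])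
       (auto intro!: derivative_eq_intros)
  then show ?thesis unfolding left_potential_reflect[abs_def] by simp
qed

lemma inverse_helmholtz_eq:
  assumes d: "c = sqrt (real d)"
  shows "inverse_helmholtz d f x = (left_potential c f x + right_potential c f x) / (2 * c)"
proof -
  have i: "integrable lborel (\<lambda>y. indicator {x..} y * (exp ((x - y) / c) * f y))"
    by (rule right_potential_integrable[OF c fc fM])
  have "integrable lborel (\<lambda>y. indicator {- x..} (0 + (- 1) * y) * (exp ((- x - (0 + (- 1) * y)) / c) * f (- (0 + (- 1) * y))))"
    by (rule lborel_integrable_real_affine[OF right_potential_integrable[OF c reflect_continuous fM]]) simp
  moreover have "indicator {- x..} (- y) = (indicator {..x} y :: real)" for y
    by (simp add: indicator_def)
  ultimately have i': "integrable lborel (\<lambda>y. indicator {..x} y * (exp ((y - x) / c) * f y))"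
    by simp
  have "inverse_helmholtz d f x = (LINT y|lborel. (indicator {..x} y * (exp ((y - x) / c) * f y) + indicator {x..} y * (exp ((x - y) / c) * f y)) / (2 * c))"
    unfolding inverse_helmholtz_def
  proof (rule integral_cong_AE)
    show "AE y in lborel. kernel d (x - y) * f y =
        (indicator {..x} y * (exp ((y - x) / c) * f y) + indicator {x..} y * (exp ((x - y) / c) * f y)) / (2 * c)"
      using AE_lborel_singleton[of x]
    proof eventually_elim
      case (elim y)
      then consider "y < x" | "x < y" by linarith
      then show ?case
        by cases (simp_all add: kernel_def d indicator_def abs_real_def diff_divide_distrib)
    qed
    have [measurable]: "f \<in> borel_measurable borel" using fc by (rule borel_measurable_continuous_onI)
    show "(\<lambda>y. kernel d (x - y) * f y) \<in> borel_measurable lborel"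
      unfolding kernel_def by measurable
    show "(\<lambda>y. (indicator {..x} y * (exp ((y - x) / c) * f y) + indicator {x..} y * (exp ((x - y) / c) * f y)) / (2 * c)) \<in> borel_measurable lborel"
      by measurable
  qed
  also have "\<dots> = (left_potential c f x + right_potential c f x) / (2 * c)"
    unfolding left_potential_def right_potential_def
    by (simp only: integral_divide_zero Bochner_Integration.integral_add[OF i' i])
  finally show ?thesis .
qed

end

text \<open>The difference of the two sides, multiplied by \<open>e\<^bsup>-x/c\<^esup>\<close>, has the derivative
  \<open>- e\<^bsup>-x/c\<^esup> (c\<^sup>2/2) (V + c V')\<^sup>2\<close> and tends to \<open>0\<close> at infinity; a function that decreases to \<open>0\<close> is nonnegative.\<close>

lemma right_potential_lower_bound:
  fixes c K :: real
  assumes c: "0 < c" and V: "\<And>x. (V has_real_derivative V' x) (at x)" "continuous_on UNIV V'"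
    and K: "\<And>x. \<bar>V x\<bar> \<le> K" "\<And>x. \<bar>V' x\<bar> \<le> K"
  shows "c ^ 3 / 2 * (V x)\<^sup>2 \<le> right_potential c (\<lambda>x. c\<^sup>2 * (V x)\<^sup>2 + c ^ 4 / 2 * (V' x)\<^sup>2) x"
proof -
  let ?f = "\<lambda>x. c\<^sup>2 * (V x)\<^sup>2 + c ^ 4 / 2 * (V' x)\<^sup>2"
  have Vc: "continuous_on UNIV V"
    using V(1) by (meson DERIV_isCont continuous_at_imp_continuous_on)
  have fc: "continuous_on UNIV ?f" by (intro continuous_intros Vc V(2))
  define M where "M = c\<^sup>2 * K\<^sup>2 + c ^ 4 / 2 * K\<^sup>2"
  have sq: "(V x)\<^sup>2 \<le> K\<^sup>2" "(V' x)\<^sup>2 \<le> K\<^sup>2" for x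
    using power_mono[OF K(1)[of x], of 2] power_mono[OF K(2)[of x], of 2] by auto
  have fM: "\<bar>?f x\<bar> \<le> M" for x
  proof -
    have "0 \<le> ?f x" by simp
    moreover have "?f x \<le> M" unfolding M_def by (intro add_mono mult_left_mono sq) auto
    ultimately show ?thesis by simp
  qed
  \<comment> \<open>Without the factor \<open>exp (- x / c)\<close> the derivative would retain a multiple of the function itself.\<close>
  define \<Psi> where "\<Psi> x = exp (- x / c) * (right_potential c ?f x - c ^ 3 / 2 * (V x)\<^sup>2)" for x
  have d: "(\<Psi> has_real_derivative - (exp (- x / c) * (c\<^sup>2 / 2) * (V x + c * V' x)\<^sup>2)) (at x)" for x
  proof -
    define R where "R = right_potential c ?f"
    have dR: "(R has_real_derivative R x / c - (c\<^sup>2 * (V x)\<^sup>2 + c ^ 4 / 2 * (V' x)\<^sup>2)) (at x)"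
      unfolding R_def by (rule right_potential_has_derivative[OF c fc fM])
    have "((\<lambda>x. exp (- x / c) * (R x - c ^ 3 / 2 * (V x)\<^sup>2)) has_real_derivative
        exp (- x / c) * ((R x / c - (c\<^sup>2 * (V x)\<^sup>2 + c ^ 4 / 2 * (V' x)\<^sup>2)) - c ^ 3 / 2 * (2 * V x * V' x))
        + (- 1 / c) * exp (- x / c) * (R x - c ^ 3 / 2 * (V x)\<^sup>2)) (at x)"
    proof -
      have "((\<lambda>x. exp (- x / c)) has_real_derivative (- 1 / c) * exp (- x / c)) (at x)"
        using c by (auto intro!: derivative_eq_intros)
      moreover have "((\<lambda>x. R x - c ^ 3 / 2 * (V x)\<^sup>2) has_real_derivative
          (R x / c - (c\<^sup>2 * (V x)\<^sup>2 + c ^ 4 / 2 * (V' x)\<^sup>2)) - c ^ 3 / 2 * (2 * V x * V' x)) (at x)"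
        by (auto intro!: derivative_eq_intros dR V(1))
      ultimately show ?thesis by (rule DERIV_cong[OF DERIV_mult]) (simp add: mult_ac)
    qed
    moreover have "exp (- x / c) * ((R x / c - (c\<^sup>2 * (V x)\<^sup>2 + c ^ 4 / 2 * (V' x)\<^sup>2)) - c ^ 3 / 2 * (2 * V x * V' x))
        + (- 1 / c) * exp (- x / c) * (R x - c ^ 3 / 2 * (V x)\<^sup>2) = - (exp (- x / c) * (c\<^sup>2 / 2) * (V x + c * V' x)\<^sup>2)"
    proof -
      have "(R x / c - (c\<^sup>2 * (V x)\<^sup>2 + c ^ 4 / 2 * (V' x)\<^sup>2)) - c ^ 3 / 2 * (2 * V x * V' x)
        + (- 1 / c) * (R x - c ^ 3 / 2 * (V x)\<^sup>2) = - ((c\<^sup>2 / 2) * (V x + c * V' x)\<^sup>2)"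
        using c by (simp add: field_simps power2_eq_square power3_eq_cube power4_eq_xxxx)
      then have "exp (- x / c) * ((R x / c - (c\<^sup>2 * (V x)\<^sup>2 + c ^ 4 / 2 * (V' x)\<^sup>2)) - c ^ 3 / 2 * (2 * V x * V' x)
        + (- 1 / c) * (R x - c ^ 3 / 2 * (V x)\<^sup>2)) = exp (- x / c) * (- ((c\<^sup>2 / 2) * (V x + c * V' x)\<^sup>2))"
        by (rule arg_cong)
      then show ?thesis by (simp only: distrib_left mult_ac mult_minus_right)
    qed
    ultimately show ?thesis by (simp add: \<Psi>_def[abs_def] R_def)
  qed
  have anti: "\<Psi> y \<le> \<Psi> x" if "x \<le> y" for x y
    by (rule DERIV_nonpos_imp_nonincreasing[OF that]) (use d in force)
  have "(\<Psi> \<longlongrightarrow> 0) at_top"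
  proof (rule Lim_null_comparison)
    have "((\<lambda>y. exp (- (y / c)) * (c * M + c ^ 3 / 2 * K\<^sup>2)) \<longlongrightarrow> 0 * (c * M + c ^ 3 / 2 * K\<^sup>2)) at_top"
      by (intro tendsto_mult tendsto_const exp_decay c)
    then show "((\<lambda>y. exp (- (y / c)) * (c * M + c ^ 3 / 2 * K\<^sup>2)) \<longlongrightarrow> 0) at_top" by simp
    have "\<bar>right_potential c ?f y - c ^ 3 / 2 * (V y)\<^sup>2\<bar> \<le> c * M + c ^ 3 / 2 * K\<^sup>2" for y
    proof -
      have "c ^ 3 / 2 * (V y)\<^sup>2 \<le> c ^ 3 / 2 * K\<^sup>2" using c sq[of y] by (intro mult_left_mono) auto
      moreover have "0 \<le> c ^ 3 / 2 * (V y)\<^sup>2" using c by simp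
      ultimately show ?thesis using right_potential_bound[OF c fc fM, of y] by linarith
    qed
    then show "\<forall>\<^sub>F y in at_top. norm (\<Psi> y) \<le> exp (- (y / c)) * (c * M + c ^ 3 / 2 * K\<^sup>2)"
      unfolding \<Psi>_def by (intro always_eventually allI) (simp add: abs_mult mult_left_mono)
  qed
  then have "0 \<le> \<Psi> x"
    by (rule tendsto_upperbound)
       (use anti in \<open>auto intro: eventually_mono[OF eventually_ge_at_top[of x]]\<close>)
  then show ?thesis by (simp add: \<Psi>_def zero_le_mult_iff)
qed

lemma left_potential_lower_bound:
  fixes c K :: real
  assumes c: "0 < c" and V: "\<And>x. (V has_real_derivative V' x) (at x)" "continuous_on UNIV V'"
    and K: "\<And>x. \<bar>V x\<bar> \<le> K" "\<And>x. \<bar>V' x\<bar> \<le> K"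
  shows "c ^ 3 / 2 * (V x)\<^sup>2 \<le> left_potential c (\<lambda>x. c\<^sup>2 * (V x)\<^sup>2 + c ^ 4 / 2 * (V' x)\<^sup>2) x"
proof -
  have "((\<lambda>x. V (- x)) has_real_derivative - V' (- x)) (at x)" for x
    using V(1)[of "- x"] by (simp add: DERIV_mirror)
  moreover have "continuous_on UNIV (\<lambda>x. - V' (- x))"
    by (intro continuous_intros continuous_on_compose2[OF V(2)]) auto
  ultimately show ?thesis
    using right_potential_lower_bound[OF c, of "\<lambda>x. V (- x)" "\<lambda>x. - V' (- x)" K "- x"] K
    by (simp add: left_potential_reflect)
qed

section \<open>Signs of the momentum and slopes of the initial value\<close>

text \<open>Whether or not the distribution is a function, a sign condition yields the sign on nonnegative test
  functions supported in the interior; this is the form in which the hypotheses are used.\<close>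

lemma nonneg_onD:
  assumes n: "nonneg_on n I" and \<phi>: "test_function \<phi>" "\<And>x. 0 \<le> \<phi> x" "support \<phi> \<subseteq> interior I"
  shows "0 \<le> n \<phi>"
proof (cases "\<exists>f. is_function n f")
  case True
  then obtain f where f: "is_function n f" "AE x in lborel. x \<in> I \<longrightarrow> 0 \<le> f x"
    using n by (auto simp: nonneg_on_def)
  have out: "\<phi> x = 0" if "x \<notin> I" for x
    using test_function_vanishes[OF \<phi>(1,3)] interior_subset that by (metis subsetD)
  have "AE x in lborel. 0 \<le> f x * \<phi> x"
    using f(2)
  proof eventually_elim
    case (elim x)
    then show ?case using out[of x] \<phi>(2)[of x] by (cases "x \<in> I") auto
  qed
  then show ?thesis
    using f(1) \<phi>(1) by (simp add: is_function_def integral_nonneg_AE)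
next
  case False
  then show ?thesis using n \<phi> by (simp add: nonneg_on_def)
qed

text \<open>A converse for distributions that vanish off a closed set. For a distribution given by a function, the
  function is nonnegative on the closed set by hypothesis and zero off it, because test functions separate.\<close>

lemma nonneg_on_UNIV_I:
  assumes n: "nonneg_on n J" and J: "closed J"
    and zero: "\<And>\<phi>. test_function \<phi> \<Longrightarrow> support \<phi> \<subseteq> - J \<Longrightarrow> n \<phi> = 0"
    and pos: "\<And>\<phi>. test_function \<phi> \<Longrightarrow> (\<And>x. 0 \<le> \<phi> x) \<Longrightarrow> 0 \<le> n \<phi>"
  shows "nonneg_on n UNIV"
proof (cases "\<exists>f. is_function n f")
  case True
  then obtain f where f: "is_function n f" "AE x in lborel. x \<in> J \<longrightarrow> 0 \<le> f x"
    using n by (auto simp: nonneg_on_def)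
  have "AE x in lborel. x \<in> - J \<longrightarrow> f x = 0"
    by (rule test_functions_separate) (use f(1) J zero in \<open>auto simp: is_function_def\<close>)
  with f(2) have "AE x in lborel. x \<in> UNIV \<longrightarrow> 0 \<le> f x"
    by eventually_elim auto
  then show ?thesis using f(1) by (auto simp: nonneg_on_def)
next
  case False
  then show ?thesis using pos by (simp add: nonneg_on_def)
qed

lemma derivative_zero_outside:
  assumes "closed S" "\<And>x. x \<notin> S \<Longrightarrow> f x = 0" "\<And>x. (f has_real_derivative f' x) (at x)" "x \<notin> S"
  shows "f' x = 0"
proof -
  have "(f has_real_derivative 0) (at x)"
  proof (rule DERIV_cong_ev[OF refl _ refl, THEN iffD1])
    show "((\<lambda>x. 0) has_real_derivative 0) (at x)" by simp
    show "\<forall>\<^sub>F y in nhds x. 0 = f y"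
      using assms by (intro eventually_mono[OF eventually_nhds_in_open[of "- S"]]) auto
  qed
  then show ?thesis using assms(3) DERIV_unique by blast
qed

lemma test_function_derivative:
  assumes "test_function \<phi>"
  obtains \<phi>' where "test_function \<phi>'" "\<And>x. (\<phi> has_real_derivative \<phi>' x) (at x)"
    "nth_vderiv 1 \<phi> = \<phi>'" "nth_vderiv 2 \<phi> = nth_vderiv 1 \<phi>'"
    "support \<phi>' \<subseteq> support \<phi>"
proof -
  obtain \<phi>' where s: "smooth \<phi>'" and d: "\<And>x. (\<phi> has_vector_derivative \<phi>' x) (at x)"
    and n: "nth_vderiv 1 \<phi> = \<phi>'" "\<And>k. nth_vderiv (Suc k) \<phi> = nth_vderiv k \<phi>'"
    using assms smooth_derivative unfolding test_function_def by metis
  have d': "(\<phi> has_real_derivative \<phi>' x) (at x)" for x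
    using d by (simp add: has_real_derivative_iff_has_vector_derivative)
  have cl: "closed (support \<phi>)" by (simp add: support_def)
  have "\<phi> x = 0" if "x \<notin> support \<phi>" for x
    using support_subset_iff[OF cl, of \<phi>] that by blast
  then have "\<phi>' x = 0" if "x \<notin> support \<phi>" for x
    using derivative_zero_outside[OF cl _ d'] that by blast
  then have sup: "support \<phi>' \<subseteq> support \<phi>" using support_subset_iff[OF cl] by blast
  moreover have "compact (support \<phi>')"
    using sup assms compact_Int_closed[of "support \<phi>" "support \<phi>'"]
    by (simp add: test_function_def support_def Int_absorb1)
  ultimately show thesis
    using that[of \<phi>'] s d' n by (simp add: test_function_def numeral_2_eq_2)
qed

lemma test_function_continuous: "test_function \<phi> \<Longrightarrow> continuous_on UNIV \<phi>"
  by (simp add: test_function_def smooth_imp_continuous)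

lemma test_function_exp_mult:
  assumes "test_function \<phi>"
  shows "test_function (\<lambda>x. exp (x / k) * \<phi> x)" "support (\<lambda>x. exp (x / k) * \<phi> x) = support \<phi>"
proof -
  show s: "support (\<lambda>x. exp (x / k) * \<phi> x) = support \<phi>" by (simp add: support_def)
  have "smooth (\<lambda>x. exp (1 / k * x) * \<phi> x)"
    using assms by (intro smooth_mult smooth_exp) (simp add: test_function_def)
  then show "test_function (\<lambda>x. exp (x / k) * \<phi> x)"
    using assms s by (simp add: test_function_def)
qed

lemma integrable_continuous_times_test:
  assumes "continuous_on UNIV h" "test_function \<phi>"
  shows "integrable lborel (\<lambda>x. h x * \<phi> x)"
  using assms by (intro integrable_locally_times_test continuous_imp_locally_integrable)

text \<open>For \<open>k\<^sup>2 = d\<close> the derivative of this function is \<open>e\<^bsup>x/k\<^esup>/k\<close> times the momentum of \<open>F\<close>. The values \<open>k = c\<close> and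
  \<open>k = - c\<close> give the two quantities whose monotonicity controls the slope at the point where the sign changes.\<close>

definition profile :: "real \<Rightarrow> (real \<Rightarrow> real) \<Rightarrow> (real \<Rightarrow> real) \<Rightarrow> real \<Rightarrow> real" where
  "profile k F F' x = (F x - k * F' x) * exp (x / k)"

text \<open>The weak form of the statement that the momentum is \<open>k e\<^bsup>-x/k\<^esup>\<close> times the derivative of the profile. It
  comes from the factorization \<open>1 - k\<^sup>2 \<partial>\<^sup>2 = (1 - k \<partial>)(1 + k \<partial>)\<close>: up to an exact derivative,
  \<open>F (\<phi> - k\<^sup>2 \<phi>'')\<close> equals \<open>(F - k F') (\<phi> - k \<phi>')\<close>.\<close>

lemma momentum_profile:
  assumes F: "\<And>x. (F has_real_derivative F' x) (at x)" "continuous_on UNIV F'"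
    and vF: "AE x in lborel. v0 x = F x" and v0: "v0 \<in> borel_measurable borel"
    and k: "k\<^sup>2 = real d" "k \<noteq> 0"
    and \<theta>: "test_function \<theta>" "\<And>x. (\<theta> has_real_derivative \<theta>' x) (at x)"
  shows "momentum d v0 (\<lambda>x. exp (x / k) * \<theta> x) = - k * (LINT x|lborel. profile k F F' x * \<theta>' x)"
proof -
  define \<phi> where "\<phi> x = exp (x / k) * \<theta> x" for x
  have \<phi>: "test_function \<phi>" unfolding \<phi>_def using \<theta>(1) by (rule test_function_exp_mult)
  obtain \<phi>1 where \<phi>1: "test_function \<phi>1" "\<And>x. (\<phi> has_real_derivative \<phi>1 x) (at x)"
    "nth_vderiv 2 \<phi> = nth_vderiv 1 \<phi>1"
    using test_function_derivative[OF \<phi>] by metis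
  obtain \<phi>2 where \<phi>2: "test_function \<phi>2" "\<And>x. (\<phi>1 has_real_derivative \<phi>2 x) (at x)"
    "nth_vderiv 1 \<phi>1 = \<phi>2"
    using test_function_derivative[OF \<phi>1(1)] by metis
  have Fc: "continuous_on UNIV F"
    using F(1) by (meson DERIV_isCont continuous_at_imp_continuous_on)
  note cont = Fc F(2) test_function_continuous[OF \<phi>] test_function_continuous[OF \<phi>1(1)] test_function_continuous[OF \<phi>2(1)]
  have \<phi>1eq: "\<phi>1 x = exp (x / k) * (\<theta>' x + \<theta> x / k)" for x
  proof (rule DERIV_unique[OF \<phi>1(2)])
    show "(\<phi> has_real_derivative exp (x / k) * (\<theta>' x + \<theta> x / k)) (at x)"
      unfolding \<phi>_def using k(2)
      by (auto intro!: derivative_eq_intros \<theta>(2) simp: field_simps)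
  qed
  have "momentum d v0 \<phi> = (LINT x|lborel. v0 x * (\<phi> x - k\<^sup>2 * \<phi>2 x))"
    unfolding momentum_def \<phi>1(3) \<phi>2(3) k(1) ..
  also have "\<dots> = (LINT x|lborel. F x * (\<phi> x - k\<^sup>2 * \<phi>2 x))"
  proof (rule integral_cong_AE)
    show "AE x in lborel. v0 x * (\<phi> x - k\<^sup>2 * \<phi>2 x) = F x * (\<phi> x - k\<^sup>2 * \<phi>2 x)"
      using vF by eventually_elim simp
    have [measurable]: "F \<in> borel_measurable borel" "\<phi> \<in> borel_measurable borel" "\<phi>2 \<in> borel_measurable borel"
      using cont by (auto intro: borel_measurable_continuous_onI)
    show "(\<lambda>x. F x * (\<phi> x - k\<^sup>2 * \<phi>2 x)) \<in> borel_measurable lborel" by measurable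
    show "(\<lambda>x. v0 x * (\<phi> x - k\<^sup>2 * \<phi>2 x)) \<in> borel_measurable lborel" using v0 by measurable
  qed
  also have "\<dots> = (LINT x|lborel. (F x - k * F' x) * (\<phi> x - k * \<phi>1 x))"
  proof -
    define G' where "G' x = k * (F' x * \<phi> x + F x * \<phi>1 x) - k\<^sup>2 * (F' x * \<phi>1 x + F x * \<phi>2 x)" for x
    obtain a b where ab: "\<And>x. x \<notin> {a..b} \<Longrightarrow> \<phi> x = 0"
      using test_function_vanishes[OF \<phi>, of UNIV] by (metis UNIV_I subset_UNIV)
    then have ab1: "\<phi>1 x = 0" if "x \<notin> {a..b}" for x
      using derivative_zero_outside[of "{a..b}" \<phi> \<phi>1] \<phi>1(2) that by blast
    have zero: "(LINT x|lborel. G' x) = 0"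
    proof (rule LINT_derivative_compact_support)
      show "((\<lambda>x. k * (F x * \<phi> x) - k\<^sup>2 * (F x * \<phi>1 x)) has_real_derivative G' x) (at x)" for x
        unfolding G'_def by (auto intro!: derivative_eq_intros F(1) \<phi>1(2) \<phi>2(2) simp: algebra_simps)
      show "continuous_on UNIV G'" unfolding G'_def by (intro continuous_intros cont)
      show "k * (F x * \<phi> x) - k\<^sup>2 * (F x * \<phi>1 x) = 0" if "x \<notin> {a..b}" for x
        using ab[OF that] ab1[OF that] by simp
    qed
    have ig: "integrable lborel (\<lambda>x. h x * \<phi> x)" "integrable lborel (\<lambda>x. h x * \<phi>1 x)" "integrable lborel (\<lambda>x. h x * \<phi>2 x)"
      if "continuous_on UNIV h" for h
      using that \<phi> \<phi>1(1) \<phi>2(1) by (auto intro: integrable_continuous_times_test)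
    have Fk: "continuous_on UNIV (\<lambda>x. F x - k * F' x)" by (intro continuous_intros cont)
    have i1: "integrable lborel (\<lambda>x. (F x - k * F' x) * (\<phi> x - k * \<phi>1 x))"
      using ig(1)[OF Fk] integrable_mult_right[OF ig(2)[OF Fk], of k] 
        Bochner_Integration.integrable_diff[of lborel "\<lambda>x. (F x - k * F' x) * \<phi> x" "\<lambda>x. k * ((F x - k * F' x) * \<phi>1 x)"]
      by (simp add: algebra_simps)
    have i2: "integrable lborel G'"
      unfolding G'_def by (intro Bochner_Integration.integrable_diff Bochner_Integration.integrable_add integrable_mult_right ig cont)
    have "(LINT x|lborel. F x * (\<phi> x - k\<^sup>2 * \<phi>2 x)) = (LINT x|lborel. (F x - k * F' x) * (\<phi> x - k * \<phi>1 x) + G' x)"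
      by (intro Bochner_Integration.integral_cong refl) (simp add: G'_def power2_eq_square algebra_simps)
    then show ?thesis using zero i1 i2 by simp
  qed
  also have "\<dots> = (LINT x|lborel. - k * (profile k F F' x * \<theta>' x))"
    using k(2) by (intro Bochner_Integration.integral_cong refl) (simp add: profile_def \<phi>1eq \<phi>_def field_simps)
  also have "\<dots> = - k * (LINT x|lborel. profile k F F' x * \<theta>' x)" by simp
  finally show ?thesis by (simp add: \<phi>_def[abs_def])
qed

text \<open>The test function rises near \<open>a\<close>, stays constant, and falls near \<open>b\<close>: it is the difference of two
  translates of the primitive of a narrow bump. Its derivative compares averages of \<open>B\<close> near \<open>a\<close> and near \<open>b\<close>.\<close>

lemma mono_if_weakly_mono:
  assumes B: "continuous_on UNIV B"
    and weak: "\<And>\<theta> \<theta>'. test_function \<theta> \<Longrightarrow> (\<And>x. 0 \<le> \<theta> x) \<Longrightarrow> support \<theta> \<subseteq> I \<Longrightarrow>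
      (\<And>x. (\<theta> has_real_derivative \<theta>' x) (at x)) \<Longrightarrow> (LINT x|lborel. B x * \<theta>' x) \<le> 0"
    and I: "open I" and ab: "a < b" "{a..b} \<subseteq> I"
  shows "B a \<le> B b"
proof (rule ccontr)
  assume "\<not> B a \<le> B b"
  then have less: "B b < B a" by simp
  \<comment> \<open>Near \<open>a\<close> the function exceeds \<open>m + e\<close>, and near \<open>b\<close> it is below \<open>m - e\<close>.\<close>
  define m e where "m = (B a + B b) / 2" and "e = (B a - B b) / 4"
  have e: "0 < e" using less by (simp add: e_def)
  have cB: "isCont B x" for x using B by (simp add: continuous_on_eq_continuous_at)
  obtain r1 where r1: "0 < r1" "\<And>x. \<bar>x - a\<bar> < r1 \<Longrightarrow> \<bar>B x - B a\<bar> < e"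
    using cB[of a] e unfolding continuous_at_eps_delta dist_real_def by metis
  obtain r2 where r2: "0 < r2" "\<And>x. \<bar>x - b\<bar> < r2 \<Longrightarrow> \<bar>B x - B b\<bar> < e"
    using cB[of b] e unfolding continuous_at_eps_delta dist_real_def by metis
  obtain r3 where r3: "0 < r3" "ball b r3 \<subseteq> I" using I ab openE by (metis atLeastAtMost_iff less_imp_le order_refl subsetD)
  define r where "r = Min {r1, r2, r3, b - a} / 2"
  have r: "0 < r" "r < r1" "r < r2" "r < r3" "r < b - a"
    using r1 r2 r3 ab by (auto simp: r_def)
  define \<eta> where "\<eta> = bump 0 r"
  have \<eta>s: "smooth \<eta>" unfolding \<eta>_def by (rule smooth_bump)
  have \<eta>c: "continuous_on A \<eta>" for A
    using smooth_imp_continuous[OF \<eta>s] continuous_on_subset by blast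
  have \<eta>0: "\<eta> x = 0" if "x \<notin> {0..r}" for x using that bump_zero[of x 0 r] by (auto simp: \<eta>_def)
  have \<eta>n: "0 \<le> \<eta> x" for x by (simp add: \<eta>_def bump_nonneg)
  define H where "H x = integral {-1..x} \<eta>" for x
  have H0: "H x = 0" if "x \<le> 0" for x
  proof -
    have "integral {-1..x} \<eta> = integral {-1..x} (\<lambda>_. 0)"
      by (intro Henstock_Kurzweil_Integration.integral_cong) (use that in \<open>auto simp: \<eta>_def bump_zero\<close>)
    then show ?thesis by (simp add: H_def)
  qed
  have dH: "(H has_real_derivative \<eta> x) (at x)" for x
  proof (cases "x > - 1")
    case True
    have "((\<lambda>y. integral {-1..y} \<eta>) has_real_derivative \<eta> x) (at x within {-1..x + 1})"
      by (rule integral_has_real_derivative[OF \<eta>c]) (use True in auto)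
    then show ?thesis using True by (simp add: H_def[abs_def] at_within_Icc_at)
  next
    case False
    have "(H has_real_derivative 0) (at x)"
    proof (rule DERIV_cong_ev[OF refl _ refl, THEN iffD1])
      show "((\<lambda>x. 0) has_real_derivative 0) (at x)" by simp
      show "\<forall>\<^sub>F y in nhds x. 0 = H y"
        using H0 False by (intro eventually_mono[OF eventually_nhds_in_open[of "{..<0}"]]) auto
    qed
    then show ?thesis using \<eta>0[of x] False by simp
  qed
  have Hmono: "H x \<le> H y" if "x \<le> y" for x y
    by (rule DERIV_nonneg_imp_nondecreasing[OF that]) (use dH \<eta>n in blast)
  have Hr: "H x = H r" if "r \<le> x" for x
  proof (cases "r = x")
    case False
    have "H x = H r"
    proof (rule DERIV_isconst_end[of r x H])
      show "continuous_on {r..x} H"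
        using dH by (meson DERIV_isCont continuous_at_imp_continuous_on)
      show "(H has_real_derivative 0) (at y)" if "r < y" "y < x" for y
        using dH[of y] \<eta>0[of y] that by simp
    qed (use that False in simp)
    then show ?thesis .
  qed simp
  have Hs: "smooth H"
    by (rule smooth_primitive[OF \<eta>s]) (use dH in \<open>simp add: has_real_derivative_iff_has_vector_derivative\<close>)
  have Hpos: "0 < H r"
  proof -
    have "H 0 < H r"
    proof (rule DERIV_pos_imp_increasing_open[OF r(1)])
      show "\<exists>y. (H has_real_derivative y) (at x) \<and> 0 < y" if "0 < x" "x < r" for x
        using dH[of x] bump_pos[of 0 x r] that by (auto simp: \<eta>_def)
      show "continuous_on {0..r} H"
        using dH by (meson DERIV_isCont continuous_at_imp_continuous_on)
    qed
    then show ?thesis using H0[of 0] by simp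
  qed
  define \<theta> \<theta>' where "\<theta> x = H (1 * x + (- a)) - H (1 * x + (- b))" and "\<theta>' x = \<eta> (x - a) - \<eta> (x - b)" for x
  have \<theta>0: "\<theta> x = 0" if "x \<notin> {a..b + r}" for x
    using that ab(1) Hr[of "x - a"] Hr[of "x - b"] H0[of "x - a"] H0[of "x - b"] r
    by (auto simp: \<theta>_def not_le)
  have \<theta>s: "smooth \<theta>" unfolding \<theta>_def by (intro smooth_diff smooth_affine Hs)
  have sub: "{a..b + r} \<subseteq> I"
  proof
    fix x assume x: "x \<in> {a..b + r}"
    show "x \<in> I"
    proof (cases "x \<le> b")
      case False
      then have "x \<in> ball b r3" using x r by (auto simp: dist_real_def)
      then show ?thesis using r3 by blast
    qed (use x ab in auto)
  qed
  have le: "(LINT x|lborel. B x * \<theta>' x) \<le> 0"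
  proof (rule weak)
    show "test_function \<theta>" using \<theta>s \<theta>0 by (rule test_functionI)
    show "support \<theta> \<subseteq> I" using test_functionI(2)[OF \<theta>s \<theta>0] sub by blast
    show "0 \<le> \<theta> x" for x using Hmono[of "x - b" "x - a"] ab by (simp add: \<theta>_def)
    have s: "((\<lambda>x. H (1 * x + (- t))) has_real_derivative \<eta> (x - t)) (at x)" for t x
    proof -
      have "((\<lambda>x. x - t) has_real_derivative 1) (at x)" by (auto intro!: derivative_eq_intros)
      from DERIV_chain2[OF dH[of "x - t"] this] show ?thesis by simp
    qed
    show "(\<theta> has_real_derivative \<theta>' x) (at x)" for x
      unfolding \<theta>_def \<theta>'_def by (intro DERIV_diff s)
  qed
  have sh: "integrable lborel (\<lambda>x. h x * \<eta> (x - t))" if "continuous_on UNIV h" for h t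
    by (rule integrable_locally_times[where a = t and b = "t + r"])
       (use that \<eta>0 in \<open>auto intro!: continuous_imp_locally_integrable continuous_on_compose2[OF \<eta>c] continuous_intros\<close>)
  have mass: "(LINT x|lborel. \<eta> (x - t)) = H r" for t
  proof -
    have "(LINT x|lborel. \<eta> (x - t)) = (LINT x|lborel. \<eta> x)"
      by (subst lborel_integral_real_affine[where c = 1 and t = t]) auto
    also have "\<dots> = (LINT x|lborel. indicator {0..r} x *\<^sub>R \<eta> x)"
      by (intro Bochner_Integration.integral_cong refl) (use \<eta>0 in \<open>auto simp: indicator_def\<close>)
    also have "\<dots> = H r - H 0"
      by (rule integral_FTC_atLeastAtMost)
         (use r \<eta>c dH in \<open>auto simp: has_real_derivative_iff_has_vector_derivative intro: has_vector_derivative_at_within\<close>)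
    finally show ?thesis using H0[of 0] by simp
  qed
  have i1: "integrable lborel (\<lambda>x. \<eta> (x - t))" for t using sh[of "\<lambda>_. 1" t] by simp
  have "(m + e) * H r = (LINT x|lborel. (m + e) * \<eta> (x - a))" by (simp add: mass)
  also have "\<dots> \<le> (LINT x|lborel. B x * \<eta> (x - a))"
  proof (rule integral_mono)
    show "(m + e) * \<eta> (x - a) \<le> B x * \<eta> (x - a)" for x
    proof (cases "x - a \<in> {0..r}")
      case True
      then have "\<bar>B x - B a\<bar> < e" using r r1(2) by auto
      moreover have "m + e = B a - e" by (simp add: m_def e_def field_simps)
      ultimately have "m + e \<le> B x" by linarith
      then show ?thesis using \<eta>n by (rule mult_right_mono)
    qed (simp add: \<eta>0)
  qed (use sh[OF B] i1 in auto)
  finally have 1: "(m + e) * H r \<le> (LINT x|lborel. B x * \<eta> (x - a))" .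
  have "(LINT x|lborel. B x * \<eta> (x - b)) \<le> (LINT x|lborel. (m - e) * \<eta> (x - b))"
  proof (rule integral_mono)
    show "B x * \<eta> (x - b) \<le> (m - e) * \<eta> (x - b)" for x
    proof (cases "x - b \<in> {0..r}")
      case True
      then have "\<bar>B x - B b\<bar> < e" using r r2(2) by auto
      moreover have "m - e = B b + e" by (simp add: m_def e_def field_simps)
      ultimately have "B x \<le> m - e" by linarith
      then show ?thesis using \<eta>n by (rule mult_right_mono)
    qed (simp add: \<eta>0)
  qed (use sh[OF B] i1 in auto)
  also have "\<dots> = (m - e) * H r" by (simp add: mass)
  finally have 2: "(LINT x|lborel. B x * \<eta> (x - b)) \<le> (m - e) * H r" .
  have "(LINT x|lborel. B x * \<theta>' x) = (LINT x|lborel. B x * \<eta> (x - a)) - (LINT x|lborel. B x * \<eta> (x - b))"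
    using sh[OF B] by (simp add: \<theta>'_def right_diff_distrib)
  then have "2 * e * H r \<le> 0" using le 1 2 by (simp add: algebra_simps)
  then show False using e Hpos by (simp add: mult_le_0_iff)
qed


text \<open>Replace the derivative of the test function by a difference quotient and shift the difference onto \<open>B\<close>.\<close>

lemma weakly_mono_if_mono:
  assumes B: "continuous_on UNIV B" "\<And>x y. x \<le> y \<Longrightarrow> B x \<le> B y"
    and \<theta>: "test_function \<theta>" "\<And>x. 0 \<le> \<theta> x" "\<And>x. (\<theta> has_real_derivative \<theta>' x) (at x)"
  shows "(LINT x|lborel. B x * \<theta>' x) \<le> 0"
proof -
  define h where "h n = 1 / real (Suc n)" for n
  have h: "0 < h n" "h n \<le> 1" for n by (auto simp: h_def field_simps)
  obtain a b where ab: "a \<le> b" "\<And>x. x \<notin> {a..b} \<Longrightarrow> \<theta> x = 0"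
    using test_function_vanishes[OF \<theta>(1), of UNIV] by (metis UNIV_I subset_UNIV)
  obtain \<theta>1 where \<theta>1: "test_function \<theta>1" "\<And>x. (\<theta> has_real_derivative \<theta>1 x) (at x)"
    using test_function_derivative[OF \<theta>(1)] by metis
  have "\<theta>1 = \<theta>'" using \<theta>(3) \<theta>1(2) DERIV_unique by blast
  then have \<theta>': "test_function \<theta>'" using \<theta>1(1) by simp
  have \<theta>c: "continuous_on A \<theta>" "continuous_on A \<theta>'" for A
    using test_function_continuous[OF \<theta>(1)] test_function_continuous[OF \<theta>'] continuous_on_subset by blast+
  have "compact (\<theta>' ` {a - 1..b + 1})" by (intro compact_continuous_image \<theta>c) auto
  then obtain L where L: "\<And>x. x \<in> {a - 1..b + 1} \<Longrightarrow> \<bar>\<theta>' x\<bar> \<le> L"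
    by (metis compact_imp_bounded bounded_real imageI)
  define q where "q n x = (\<theta> (x + h n) - \<theta> x) / h n" for n x
  have qc: "continuous_on UNIV (q n)" for n
    unfolding q_def using h[of n]
    by (intro continuous_intros \<theta>c continuous_on_compose2[OF \<theta>c(1)[of UNIV]]) auto
  have q0: "q n x = 0" if "x \<notin> {a - 1..b}" for n x
    using that h[of n] ab(2)[of x] ab(2)[of "x + h n"] by (auto simp: q_def)
  have qL: "\<bar>q n x\<bar> \<le> L" if "x \<in> {a - 1..b}" for n x
  proof -
    obtain z where z: "x < z" "z < x + h n" "\<theta> (x + h n) - \<theta> x = h n * \<theta>' z"
      using MVT2[of x "x + h n" \<theta> \<theta>'] \<theta>(3) h[of n] by auto
    then have "q n x = \<theta>' z" using h[of n] by (simp add: q_def)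
    moreover have "z \<in> {a - 1..b + 1}" using z h[of n] that by auto
    ultimately show ?thesis using L by simp
  qed
  have nonpos: "(LINT x|lborel. B x * q n x) \<le> 0" for n
  proof -
    have i1: "integrable lborel (\<lambda>x. B x * \<theta> x)"
      using B(1) \<theta>(1) by (rule integrable_continuous_times_test)
    have i2: "integrable lborel (\<lambda>x. B (x - h n) * \<theta> x)"
      by (intro integrable_continuous_times_test \<theta>(1) continuous_on_compose2[OF B(1)] continuous_intros) auto
    have i3: "integrable lborel (\<lambda>x. B x * \<theta> (x + h n))"
      using lborel_integrable_real_affine[OF i2, of 1 "h n"] by (simp add: add.commute)
    have "(LINT x|lborel. B x * q n x) = (LINT x|lborel. (B x * \<theta> (x + h n) - B x * \<theta> x) / h n)"
      by (intro Bochner_Integration.integral_cong refl) (simp add: q_def right_diff_distrib)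
    also have "\<dots> = ((LINT x|lborel. B x * \<theta> (x + h n)) - (LINT x|lborel. B x * \<theta> x)) / h n"
      using i1 i3 by simp
    also have "(LINT x|lborel. B x * \<theta> (x + h n)) = (LINT x|lborel. B (x - h n) * \<theta> x)"
      by (subst lborel_integral_real_affine[where c = 1 and t = "- h n"]) auto
    also have "\<dots> \<le> (LINT x|lborel. B x * \<theta> x)"
      by (intro integral_mono i1 i2 mult_right_mono B(2) \<theta>(2)) (use h[of n] in auto)
    finally show ?thesis
      using h[of n] by (simp add: divide_le_0_iff divide_right_mono)
  qed
  have "(\<lambda>n. LINT x|lborel. B x * q n x) \<longlonglongrightarrow> (LINT x|lborel. B x * \<theta>' x)"
  proof (rule integral_dominated_convergence)
    have "continuous_on {a - 1..b} (\<lambda>x. L * \<bar>B x\<bar>)"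
      by (intro continuous_intros continuous_on_subset[OF B(1)]) auto
    then show "integrable lborel (\<lambda>x. indicator {a - 1..b} x *\<^sub>R (L * \<bar>B x\<bar>))"
      using borel_integrable_atLeastAtMost' by (simp only: set_integrable_def)
    have Bm: "B \<in> borel_measurable borel" using B(1) by (rule borel_measurable_continuous_onI)
    have \<theta>m: "\<theta>' \<in> borel_measurable borel" using \<theta>c(2)[of UNIV] by (rule borel_measurable_continuous_onI)
    show "(\<lambda>x. B x * \<theta>' x) \<in> borel_measurable lborel" using Bm \<theta>m by measurable
    show "(\<lambda>x. B x * q n x) \<in> borel_measurable lborel" for n
      using Bm borel_measurable_continuous_onI[OF qc[of n]] by measurable
    show "AE x in lborel. norm (B x * q n x) \<le> indicator {a - 1..b} x *\<^sub>R (L * \<bar>B x\<bar>)" for n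
    proof (rule AE_I2)
      fix x
      show "norm (B x * q n x) \<le> indicator {a - 1..b} x *\<^sub>R (L * \<bar>B x\<bar>)"
      proof (cases "x \<in> {a - 1..b}")
        case True
        then show ?thesis using mult_right_mono[OF qL[OF True, of n], of "\<bar>B x\<bar>"] by (simp add: abs_mult mult.commute)
      qed (simp add: q0)
    qed
    show "AE x in lborel. (\<lambda>n. B x * q n x) \<longlonglongrightarrow> B x * \<theta>' x"
    proof (intro AE_I2 tendsto_mult tendsto_const)
      fix x
      have "filterlim h (at 0) sequentially"
        using LIMSEQ_inverse_real_of_nat h(1)
        by (intro filterlim_atI) (auto simp: h_def[abs_def] inverse_eq_divide less_imp_neq)
      then show "(\<lambda>n. q n x) \<longlonglongrightarrow> \<theta>' x"
        unfolding q_def using \<theta>(3)[of x] by (auto simp: DERIV_def intro: filterlim_compose)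
    qed
  qed
  then show ?thesis by (rule tendsto_upperbound) (auto intro!: always_eventually nonpos)
qed

lemma mono_on_closure_left:
  fixes B :: "real \<Rightarrow> real"
  assumes B: "continuous_on UNIV B" and m: "\<And>a b. a < b \<Longrightarrow> b < x0 \<Longrightarrow> B a \<le> B b" and "a \<le> b" "b \<le> x0"
  shows "B a \<le> B b"
proof -
  consider "a = b" | "a < b" "b < x0" | "a < b" "b = x0" using assms(3,4) by linarith
  then show ?thesis
  proof cases
    case 3
    have "isCont B b" using B by (simp add: continuous_on_eq_continuous_at)
    then have "(B \<longlongrightarrow> B b) (at_left b)" by (simp add: isCont_def filterlim_at_split)
    then show ?thesis
    proof (rule tendsto_lowerbound)
      show "\<forall>\<^sub>F y in at_left b. B a \<le> B y"
        using eventually_at_left_real[OF 3(1)] by eventually_elim (use m 3 in auto)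
    qed simp
  qed (use m in auto)
qed

lemma mono_on_closure_right:
  fixes B :: "real \<Rightarrow> real"
  assumes B: "continuous_on UNIV B" and m: "\<And>a b. a < b \<Longrightarrow> x0 < a \<Longrightarrow> B a \<le> B b" and "a \<le> b" "x0 \<le> a"
  shows "B a \<le> B b"
proof -
  have "continuous_on UNIV (\<lambda>x. - B (- x))"
    by (intro continuous_intros continuous_on_compose2[OF B]) auto
  then have "- B (- (- b)) \<le> - B (- (- a))"
    by (rule mono_on_closure_left[of _ "- x0"]) (use assms in auto)
  then show ?thesis by simp
qed

lemma profile_continuous:
  assumes "continuous_on UNIV F" "continuous_on UNIV F'"
  shows "continuous_on UNIV (profile k F F')"
  unfolding profile_def divide_inverse by (intro continuous_intros assms)

text \<open>Every test function is of the form \<open>e\<^bsup>x/k\<^esup> \<theta>\<close>, so that statements about the momentum need to be checked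
  only in the form in which the profile enters.\<close>

lemma momentum_exp_cancel:
  assumes "\<And>\<theta>. test_function \<theta> \<Longrightarrow> support \<theta> \<subseteq> S \<Longrightarrow> P \<theta> \<Longrightarrow> Q (n (\<lambda>x. exp (x / k) * \<theta> x))"
    and "test_function \<phi>" "support \<phi> \<subseteq> S" "P (\<lambda>x. exp (x / (- k)) * \<phi> x)"
  shows "Q (n \<phi>)"
proof -
  have eq: "(\<lambda>x. exp (x / k) * (exp (x / (- k)) * \<phi> x)) = \<phi>"
    by (rule ext) (simp add: mult.assoc[symmetric] exp_minus_inverse)
  have "Q (n (\<lambda>x. exp (x / k) * (exp (x / (- k)) * \<phi> x)))"
    using assms(3,4) by (intro assms(1)) (simp_all only: test_function_exp_mult[OF assms(2)])
  then show ?thesis unfolding eq .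
qed

text \<open>Where \<open>F = k F'\<close>, the function \<open>F\<close> is a multiple of \<open>e\<^bsup>x/k\<^esup>\<close>, and the other profile is twice that multiple.\<close>

lemma profile_constant_where_vanishing:
  assumes F: "\<And>x. (F has_real_derivative F' x) (at x)" and k: "k \<noteq> 0" and "a < b"
    and z: "\<And>x. a \<le> x \<Longrightarrow> x \<le> b \<Longrightarrow> profile k F F' x = 0"
  shows "profile (- k) F F' a = profile (- k) F F' b"
proof -
  have F': "F' x = F x / k" if "a \<le> x" "x \<le> b" for x
    using z[OF that] k by (simp add: profile_def field_simps)
  have d: "((\<lambda>x. F x * exp (- x / k)) has_real_derivative (F' x - F x / k) * exp (- x / k)) (at x)" for x
    using k by (auto intro!: derivative_eq_intros F simp: field_simps)
  have "F b * exp (- b / k) = F a * exp (- a / k)"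
  proof (rule DERIV_isconst_end[of a b "\<lambda>x. F x * exp (- x / k)"])
    show "continuous_on {a..b} (\<lambda>x. F x * exp (- x / k))"
      using d by (meson DERIV_isCont continuous_at_imp_continuous_on)
    show "((\<lambda>x. F x * exp (- x / k)) has_real_derivative 0) (at x)" if "a < x" "x < b" for x
      using d[of x] F'[of x] that by simp
  qed fact
  moreover have "profile (- k) F F' x = 2 * (F x * exp (- x / k))" if "a \<le> x" "x \<le> b" for x
    using F'[OF that] k by (simp add: profile_def)
  ultimately show ?thesis using \<open>a < b\<close> by simp
qed

lemma profile_tendsto_0:
  fixes c K :: real
  assumes c: "0 < c" and K: "\<And>x. \<bar>F x\<bar> \<le> K" "\<And>x. \<bar>F' x\<bar> \<le> K"
  shows "(profile c F F' \<longlongrightarrow> 0) at_bot" "(profile (- c) F F' \<longlongrightarrow> 0) at_top"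
proof -
  have b: "\<bar>F x + s * F' x\<bar> \<le> K + c * K" if "\<bar>s\<bar> = c" for s x
  proof -
    have "\<bar>s * F' x\<bar> \<le> c * K" unfolding abs_mult that using K(2)[of x] c by (intro mult_left_mono) auto
    then show ?thesis using K(1)[of x] by linarith
  qed
  have ex: "((\<lambda>y. exp (- (y / c))) \<longlongrightarrow> 0) at_top" using c by (rule exp_decay)
  then have ex2: "((\<lambda>y. exp (y / c)) \<longlongrightarrow> 0) at_bot"
    by (simp add: filterlim_at_bot_mirror)
  show "(profile (- c) F F' \<longlongrightarrow> 0) at_top"
  proof (rule Lim_null_comparison)
    show "((\<lambda>y. (K + c * K) * exp (- (y / c))) \<longlongrightarrow> 0) at_top"
      using tendsto_mult[OF tendsto_const ex] by simp
    show "\<forall>\<^sub>F y in at_top. norm (profile (- c) F F' y) \<le> (K + c * K) * exp (- (y / c))"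
      using b[of c] c by (intro always_eventually allI) (simp add: profile_def abs_mult mult_right_mono)
  qed
  show "(profile c F F' \<longlongrightarrow> 0) at_bot"
  proof (rule Lim_null_comparison)
    show "((\<lambda>y. (K + c * K) * exp (y / c)) \<longlongrightarrow> 0) at_bot"
      using tendsto_mult[OF tendsto_const ex2] by simp
    show "\<forall>\<^sub>F y in at_bot. norm (profile c F F' y) \<le> (K + c * K) * exp (y / c)"
      using b[of "- c"] c by (intro always_eventually allI) (simp add: profile_def abs_mult mult_right_mono)
  qed
qed

text \<open>Both profiles are monotone on their half-line and tend to \<open>0\<close> at its infinite end, which gives the weak
  inequalities. If the profile with \<open>k = c\<close> vanished at \<open>x0\<close>, it would vanish on the left half-line; then
  the other profile is constant there, hence monotone on the whole line, and the momentum is nonpositive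
  everywhere, which contradicts the change of sign. The other case is symmetric.\<close>

lemma initial_slope:
  assumes c: "0 < c" "c\<^sup>2 = real d"
    and F: "\<And>x. (F has_real_derivative F' x) (at x)" "continuous_on UNIV F'"
    and vF: "AE x in lborel. v0 x = F x" and v0: "v0 \<in> borel_measurable borel"
    and K: "\<And>x. \<bar>F x\<bar> \<le> K" "\<And>x. \<bar>F' x\<bar> \<le> K"
    and pos: "nonneg_on (momentum d v0) {..x0}" and neg: "nonpos_on (momentum d v0) {x0..}"
    and ch: "changes_sign (momentum d v0)"
  shows "F x0 + c * F' x0 < 0" "0 < F x0 - c * F' x0"
proof -
  let ?n = "momentum d v0"
  define B C where "B = profile c F F'" and "C = profile (- c) F F'"
  have Fc: "continuous_on UNIV F"
    using F(1) by (meson DERIV_isCont continuous_at_imp_continuous_on)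
  have BC: "continuous_on UNIV B" "continuous_on UNIV C"
    unfolding B_def C_def by (intro profile_continuous Fc F(2))+
  have nB: "?n (\<lambda>x. exp (x / c) * \<theta> x) = - c * (LINT x|lborel. B x * \<theta>' x)"
    if "test_function \<theta>" "\<And>x. (\<theta> has_real_derivative \<theta>' x) (at x)" for \<theta> \<theta>'
    unfolding B_def by (rule momentum_profile[OF F vF v0]) (use c that in auto)
  have nC: "?n (\<lambda>x. exp (x / (- c)) * \<theta> x) = c * (LINT x|lborel. C x * \<theta>' x)"
    if "test_function \<theta>" "\<And>x. (\<theta> has_real_derivative \<theta>' x) (at x)" for \<theta> \<theta>'
    using momentum_profile[OF F vF v0, of "- c"] c that unfolding C_def by simp
  have nonneg: "0 \<le> exp (x / k) * \<theta> x" if "\<And>x. 0 \<le> \<theta> x" for x k and \<theta> :: "real \<Rightarrow> real"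
    using that by simp
  have B_mono: "B a \<le> B b" if "a \<le> b" "b \<le> x0" for a b
  proof (rule mono_on_closure_left[OF BC(1) _ that])
    fix a b assume ab: "a < b" "b < x0"
    show "B a \<le> B b"
    proof (rule mono_if_weakly_mono[OF BC(1) _ open_lessThan[of x0] ab(1)])
      fix \<theta> \<theta>' assume \<theta>: "test_function \<theta>" "\<And>x. 0 \<le> \<theta> x" "support \<theta> \<subseteq> {..<x0}"
        "\<And>x. (\<theta> has_real_derivative \<theta>' x) (at x)"
      have "0 \<le> ?n (\<lambda>x. exp (x / c) * \<theta> x)"
        using \<theta> by (intro nonneg_onD[OF pos] test_function_exp_mult(1) nonneg)
          (simp_all add: test_function_exp_mult(2) interior_real_atMost)
      then show "(LINT x|lborel. B x * \<theta>' x) \<le> 0"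
        using nB[OF \<theta>(1,4)] c by (simp add: mult_le_0_iff zero_le_mult_iff)
    qed (use ab in auto)
  qed
  have C_mono: "C a \<le> C b" if "a \<le> b" "x0 \<le> a" for a b
  proof (rule mono_on_closure_right[OF BC(2) _ that])
    fix a b assume ab: "a < b" "x0 < a"
    show "C a \<le> C b"
    proof (rule mono_if_weakly_mono[OF BC(2) _ open_greaterThan[of x0] ab(1)])
      fix \<theta> \<theta>' assume \<theta>: "test_function \<theta>" "\<And>x. 0 \<le> \<theta> x" "support \<theta> \<subseteq> {x0<..}"
        "\<And>x. (\<theta> has_real_derivative \<theta>' x) (at x)"
      have "0 \<le> - ?n (\<lambda>x. exp (x / (- c)) * \<theta> x)"
        using \<theta> by (intro nonneg_onD[OF neg[unfolded nonpos_on_def]] test_function_exp_mult(1) nonneg)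
          (simp_all only: test_function_exp_mult(2) interior_real_atLeast)
      then show "(LINT x|lborel. C x * \<theta>' x) \<le> 0"
        using nC[OF \<theta>(1,4)] c by (simp add: mult_le_0_iff)
    qed (use ab in auto)
  qed
  have B_nonneg: "0 \<le> B x" if "x \<le> x0" for x
  proof (rule tendsto_upperbound)
    show "(B \<longlongrightarrow> 0) at_bot" unfolding B_def using c(1) K by (rule profile_tendsto_0)
    show "\<forall>\<^sub>F y in at_bot. B y \<le> B x"
      using eventually_le_at_bot[of x] by eventually_elim (use B_mono that in auto)
  qed simp
  have C_nonpos: "C x \<le> 0" if "x0 \<le> x" for x
  proof (rule tendsto_lowerbound)
    show "(C \<longlongrightarrow> 0) at_top" unfolding C_def using c(1) K by (rule profile_tendsto_0)
    show "\<forall>\<^sub>F y in at_top. C x \<le> C y"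
      using eventually_ge_at_top[of x] by eventually_elim (use C_mono that in auto)
  qed simp
  have vanish: "(LINT x|lborel. G x * \<theta>' x) = 0"
    if "closed S" "\<And>x. x \<in> S \<Longrightarrow> G x = 0" "test_function \<theta>" "support \<theta> \<subseteq> S" "\<And>x. (\<theta> has_real_derivative \<theta>' x) (at x)"
    for S and G \<theta> \<theta>' :: "real \<Rightarrow> real"
  proof -
    have "\<theta> x = 0" if "x \<notin> S" for x
      using \<open>support \<theta> \<subseteq> S\<close> support_subset_iff[OF \<open>closed S\<close>] that by blast
    then have "\<theta>' x = 0" if "x \<notin> S" for x
      using derivative_zero_outside[OF \<open>closed S\<close>] that \<open>\<And>x. (\<theta> has_real_derivative \<theta>' x) (at x)\<close> by metis
    then have "(\<lambda>x. G x * \<theta>' x) = (\<lambda>x. 0)" using that(2) by (metis mult_eq_0_iff)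
    then show ?thesis by simp
  qed
  have "B x0 \<noteq> 0"
  proof
    assume "B x0 = 0"
    then have B0: "B x = 0" if "x \<le> x0" for x
      using B_nonneg[OF that] B_mono[OF that order_refl] by simp
    have C_left: "C a = C x0" if "a \<le> x0" for a
      using profile_constant_where_vanishing[OF F(1), of c a x0] B0 that c by (cases "a = x0") (auto simp: B_def C_def)
    have C_all: "C a \<le> C b" if "a \<le> b" for a b
    proof -
      consider "x0 \<le> a" | "a \<le> x0" "x0 \<le> b" | "b \<le> x0" by linarith
      then show ?thesis
      proof cases
        case 2
        then show ?thesis using C_mono[of x0 b] C_left[of a] by simp
      next
        case 3
        then show ?thesis using C_left[of a] C_left[of b] that by simp
      qed (use C_mono that in blast)
    qed
    have "nonneg_on (\<lambda>\<phi>. - ?n \<phi>) UNIV"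
    proof (rule nonneg_on_UNIV_I[OF neg[unfolded nonpos_on_def]])
      fix \<phi> assume \<phi>: "test_function \<phi>" "support \<phi> \<subseteq> - {x0..}"
      then have s: "support \<phi> \<subseteq> {..x0}" by auto
      have "?n \<phi> = 0"
      proof (rule momentum_exp_cancel[where P = "\<lambda>_. True" and k = c, OF _ \<phi>(1) s])
        fix \<theta> assume \<theta>: "test_function \<theta>" "support \<theta> \<subseteq> {..x0}"
        obtain \<theta>' where \<theta>': "\<And>x. (\<theta> has_real_derivative \<theta>' x) (at x)"
          using test_function_derivative[OF \<theta>(1)] by metis
        show "?n (\<lambda>x. exp (x / c) * \<theta> x) = 0"
          using nB[OF \<theta>(1) \<theta>'] vanish[OF closed_atMost _ \<theta> \<theta>', of B] B0 by simp
      qed simp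
      then show "- ?n \<phi> = 0" by simp
    next
      fix \<phi> assume \<phi>: "test_function \<phi>" "\<And>x. 0 \<le> \<phi> x"
      show "0 \<le> - ?n \<phi>"
      proof (rule momentum_exp_cancel[where P = "\<lambda>\<theta>. \<forall>x. 0 \<le> \<theta> x" and k = "- c" and Q = "\<lambda>z. 0 \<le> - z", OF _ \<phi>(1) subset_UNIV])
        fix \<theta> assume \<theta>: "test_function \<theta>" "\<forall>x. 0 \<le> \<theta> x"
        obtain \<theta>' where \<theta>': "\<And>x. (\<theta> has_real_derivative \<theta>' x) (at x)"
          using test_function_derivative[OF \<theta>(1)] by metis
        have "(LINT x|lborel. C x * \<theta>' x) \<le> 0"
          using \<theta> by (intro weakly_mono_if_mono[OF BC(2) C_all _ _ \<theta>']) auto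
        then show "0 \<le> - ?n (\<lambda>x. exp (x / (- c)) * \<theta> x)"
          unfolding nC[OF \<theta>(1) \<theta>'] using c by (simp add: mult_le_0_iff)
      qed (use \<phi> in simp)
    qed simp
    then show False using ch by (simp add: changes_sign_def nonpos_on_def)
  qed
  then have "0 < B x0" using B_nonneg[of x0] by simp
  then show "0 < F x0 - c * F' x0" by (simp add: B_def profile_def zero_less_mult_iff)
  have "C x0 \<noteq> 0"
  proof
    assume "C x0 = 0"
    then have C0: "C x = 0" if "x0 \<le> x" for x
      using C_nonpos[OF that] C_mono[OF that order_refl] by simp
    have B_right: "B b = B x0" if "x0 \<le> b" for b
      using profile_constant_where_vanishing[OF F(1), of "- c" x0 b] C0 that c by (cases "b = x0") (auto simp: B_def C_def)
    have B_all: "B a \<le> B b" if "a \<le> b" for a b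
    proof -
      consider "b \<le> x0" | "a \<le> x0" "x0 \<le> b" | "x0 \<le> a" by linarith
      then show ?thesis
      proof cases
        case 2
        then show ?thesis using B_mono[of a x0] B_right[of b] by simp
      next
        case 3
        then show ?thesis using B_right[of a] B_right[of b] that by simp
      qed (use B_mono that in blast)
    qed
    have "nonneg_on ?n UNIV"
    proof (rule nonneg_on_UNIV_I[OF pos])
      fix \<phi> assume \<phi>: "test_function \<phi>" "support \<phi> \<subseteq> - {..x0}"
      then have s: "support \<phi> \<subseteq> {x0..}" by auto
      show "?n \<phi> = 0"
      proof (rule momentum_exp_cancel[where P = "\<lambda>_. True" and k = "- c", OF _ \<phi>(1) s])
        fix \<theta> assume \<theta>: "test_function \<theta>" "support \<theta> \<subseteq> {x0..}"
        obtain \<theta>' where \<theta>': "\<And>x. (\<theta> has_real_derivative \<theta>' x) (at x)"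
          using test_function_derivative[OF \<theta>(1)] by metis
        show "?n (\<lambda>x. exp (x / (- c)) * \<theta> x) = 0"
          unfolding nC[OF \<theta>(1) \<theta>'] using vanish[OF closed_atLeast _ \<theta> \<theta>', of C] C0 by simp
      qed simp
    next
      fix \<phi> assume \<phi>: "test_function \<phi>" "\<And>x. 0 \<le> \<phi> x"
      show "0 \<le> ?n \<phi>"
      proof (rule momentum_exp_cancel[where P = "\<lambda>\<theta>. \<forall>x. 0 \<le> \<theta> x" and k = c and Q = "\<lambda>z. 0 \<le> z", OF _ \<phi>(1) subset_UNIV])
        fix \<theta> assume \<theta>: "test_function \<theta>" "\<forall>x. 0 \<le> \<theta> x"
        obtain \<theta>' where \<theta>': "\<And>x. (\<theta> has_real_derivative \<theta>' x) (at x)"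
          using test_function_derivative[OF \<theta>(1)] by metis
        have "(LINT x|lborel. B x * \<theta>' x) \<le> 0"
          using \<theta> by (intro weakly_mono_if_mono[OF BC(1) B_all _ _ \<theta>']) auto
        then show "0 \<le> ?n (\<lambda>x. exp (x / c) * \<theta> x)"
          unfolding nB[OF \<theta>(1) \<theta>'] using c by (simp add: mult_le_0_iff)
      qed (use \<phi> in simp)
    qed simp
    then show False using ch by (simp add: changes_sign_def)
  qed
  then have "C x0 < 0" using C_nonpos[of x0] by simp
  then show "F x0 + c * F' x0 < 0" by (simp add: C_def profile_def mult_less_0_iff)
qed

section \<open>Tools from the theory of ordinary differential equations\<close>

text \<open>Picard iteration on the whole interval at once: measured with the weight \<open>e\<^bsup>-2L't\<^esup>\<close>, every step halves the
  distance between consecutive iterates.\<close>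

lemma picard_lindeloef:
  fixes X :: "real \<Rightarrow> real \<Rightarrow> real"
  assumes \<tau>: "0 \<le> \<tau>"
    and cont: "continuous_on ({0..\<tau>} \<times> UNIV) (\<lambda>p. X (fst p) (snd p))"
    and lip: "\<And>t x y. t \<in> {0..\<tau>} \<Longrightarrow> \<bar>X t x - X t y\<bar> \<le> L * \<bar>x - y\<bar>"
  obtains q where "q 0 = x0" "\<And>t. t \<in> {0..\<tau>} \<Longrightarrow> (q has_real_derivative X t (q t)) (at t within {0..\<tau>})"
proof -
  \<comment> \<open>A strictly positive Lipschitz constant, so that it may be divided by.\<close>
  define L' where "L' = \<bar>L\<bar> + 1"
  have L': "0 < L'" by (simp add: L'_def)
  have lip': "\<bar>X t x - X t y\<bar> \<le> L' * \<bar>x - y\<bar>" if "t \<in> {0..\<tau>}" for t x y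
  proof -
    have "L * \<bar>x - y\<bar> \<le> L' * \<bar>x - y\<bar>" by (rule mult_right_mono) (auto simp: L'_def)
    then show ?thesis using lip[OF that, of x y] by linarith
  qed
  have comp: "continuous_on {0..\<tau>} (\<lambda>t. X t (y t))" if "continuous_on {0..\<tau>} y" for y
    by (rule continuous_on_compose2[OF cont, of _ "\<lambda>t. (t, y t)", simplified])
       (use that in \<open>auto intro!: continuous_intros\<close>)
  define Q where "Q = rec_nat (\<lambda>_. x0) (\<lambda>_ y t. x0 + integral {0..t} (\<lambda>s. X s (y s)))"
  have Q0: "Q 0 t = x0" and QS: "Q (Suc n) t = x0 + integral {0..t} (\<lambda>s. X s (Q n s))" for n t
    by (simp_all add: Q_def)
  have Qc: "continuous_on {0..\<tau>} (Q n)" for n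
  proof (induction n)
    case 0 then show ?case by (simp add: Q0[abs_def] continuous_on_const)
  next
    case (Suc n)
    have "continuous_on {0..\<tau>} (\<lambda>t. x0 + integral {0..t} (\<lambda>s. X s (Q n s)))"
      by (intro continuous_intros indefinite_integral_continuous_1 integrable_continuous_real comp Suc)
    then show ?case by (simp add: QS[abs_def])
  qed
  have Xi: "(\<lambda>s. X s (Q n s)) integrable_on {0..t}" if "t \<in> {0..\<tau>}" for n t
    by (intro integrable_continuous_real continuous_on_subset[OF comp[OF Qc]]) (use that in auto)
  have "compact ((\<lambda>s. X s x0) ` {0..\<tau>})"
    by (intro compact_continuous_image comp continuous_intros) auto
  then obtain M where M: "\<And>s. s \<in> {0..\<tau>} \<Longrightarrow> \<bar>X s x0\<bar> \<le> M"
    by (metis compact_imp_bounded bounded_real imageI)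
  have "0 \<le> M" using M[of 0] \<tau> by simp
  define K where "K = M * \<tau>"
  have K: "0 \<le> K" using \<open>0 \<le> M\<close> \<tau> by (simp add: K_def)
  have step: "\<bar>Q (Suc n) t - Q n t\<bar> \<le> K * (1 / 2) ^ n * exp (2 * L' * t)" if "t \<in> {0..\<tau>}" for n t
    using that
  proof (induction n arbitrary: t)
    case 0
    have "norm (integral {0..t} (\<lambda>s. X s x0)) \<le> integral {0..t} (\<lambda>s. M)"
    proof (rule Henstock_Kurzweil_Integration.integral_norm_bound_integral)
      show "(\<lambda>s. X s x0) integrable_on {0..t}" using Xi[OF 0, of 0] by (simp add: Q0)
    qed (use 0 M in auto)
    also have "\<dots> \<le> K" using 0 \<open>0 \<le> M\<close> by (simp add: K_def mult.commute mult_left_mono)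
    also have "\<dots> \<le> K * exp (2 * L' * t)" using K 0 L' by (simp add: mult_le_cancel_left1)
    finally show ?case by (simp add: QS Q0)
  next
    case (Suc n)
    let ?g = "\<lambda>s. L' * (K * (1 / 2) ^ n * exp (2 * L' * s))"
    have gi: "(?g has_integral (K * (1 / 2) ^ Suc n * exp (2 * L' * t) - K * (1 / 2) ^ Suc n * exp (2 * L' * 0))) {0..t}"
      by (rule fundamental_theorem_of_calculus)
         (use Suc.prems in \<open>auto simp: has_real_derivative_iff_has_vector_derivative[symmetric] intro!: derivative_eq_intros\<close>)
    have "\<bar>Q (Suc (Suc n)) t - Q (Suc n) t\<bar> = norm (integral {0..t} (\<lambda>s. X s (Q (Suc n) s) - X s (Q n s)))"
      unfolding QS[of "Suc n" t] QS[of n t] Henstock_Kurzweil_Integration.integral_diff[OF Xi Xi, OF Suc.prems Suc.prems]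
      by simp
    also have "\<dots> \<le> integral {0..t} ?g"
    proof (rule Henstock_Kurzweil_Integration.integral_norm_bound_integral)
      show "(\<lambda>s. X s (Q (Suc n) s) - X s (Q n s)) integrable_on {0..t}"
        by (intro integrable_diff Xi Suc.prems)
      show "?g integrable_on {0..t}" using gi by blast
      show "norm (X s (Q (Suc n) s) - X s (Q n s)) \<le> ?g s" if "s \<in> {0..t}" for s
      proof -
        have s: "s \<in> {0..\<tau>}" using that Suc.prems by auto
        show ?thesis
          unfolding real_norm_def
          by (rule order_trans[OF lip'[OF s] mult_left_mono[OF Suc.IH[OF s]]]) (use L' in simp)
      qed
    qed
    also have "\<dots> = K * (1 / 2) ^ Suc n * exp (2 * L' * t) - K * (1 / 2) ^ Suc n * exp (2 * L' * 0)"
      using gi by (rule integral_unique)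
    also have "\<dots> \<le> K * (1 / 2) ^ Suc n * exp (2 * L' * t)" using K by simp
    finally show ?case .
  qed
  define q where "q t = x0 + (\<Sum>n. Q (Suc n) t - Q n t)" for t
  have "uniform_limit {0..\<tau>} (\<lambda>n t. \<Sum>i<n. Q (Suc i) t - Q i t) (\<lambda>t. \<Sum>n. Q (Suc n) t - Q n t) sequentially"
  proof (rule Weierstrass_m_test[where M = "\<lambda>n. K * exp (2 * L' * \<tau>) * (1 / 2) ^ n"])
    show "summable (\<lambda>n. K * exp (2 * L' * \<tau>) * (1 / 2) ^ n)"
      by (intro summable_mult summable_geometric) simp
    show "norm (Q (Suc n) t - Q n t) \<le> K * exp (2 * L' * \<tau>) * (1 / 2) ^ n" if "t \<in> {0..\<tau>}" for n t
    proof -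
      have "K * (1 / 2) ^ n * exp (2 * L' * t) \<le> K * (1 / 2) ^ n * exp (2 * L' * \<tau>)"
        using that K L' by (intro mult_left_mono) auto
      then show ?thesis using step[OF that, of n] by (simp add: mult_ac)
    qed
  qed
  then have "uniform_limit {0..\<tau>} (\<lambda>n t. x0 + (\<Sum>i<n. Q (Suc i) t - Q i t)) q sequentially"
    unfolding q_def by (intro uniform_limit_add uniform_limit_const)
  moreover have "x0 + (\<Sum>i<n. Q (Suc i) t - Q i t) = Q n t" for n t
    using sum_lessThan_telescope[of "\<lambda>i. Q i t" n] by (simp add: Q0)
  ultimately have ul: "uniform_limit {0..\<tau>} Q q sequentially" by simp
  have qc: "continuous_on {0..\<tau>} q"
    by (rule uniform_limit_theorem[OF _ ul]) (use Qc in auto)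
  have qi: "(\<lambda>s. X s (q s)) integrable_on {0..t}" if "t \<in> {0..\<tau>}" for t
    by (intro integrable_continuous_real continuous_on_subset[OF comp[OF qc]]) (use that in auto)
  have qeq: "q t = x0 + integral {0..t} (\<lambda>s. X s (q s))" if t: "t \<in> {0..\<tau>}" for t
  proof -
    have ul2: "uniform_limit {0..t} (\<lambda>n s. X s (Q n s)) (\<lambda>s. X s (q s)) sequentially"
    proof (rule uniform_limitI)
      fix e :: real assume "0 < e"
      then have "\<forall>\<^sub>F n in sequentially. \<forall>s\<in>{0..\<tau>}. dist (Q n s) (q s) < e / L'"
        using ul L' by (intro uniform_limitD) auto
      then show "\<forall>\<^sub>F n in sequentially. \<forall>s\<in>{0..t}. dist (X s (Q n s)) (X s (q s)) < e"
      proof eventually_elim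
        case (elim n)
        show ?case
        proof
          fix s assume "s \<in> {0..t}"
          then have s: "s \<in> {0..\<tau>}" using t by auto
          have "L' * \<bar>Q n s - q s\<bar> < e"
            using elim s L' by (auto simp: dist_real_def field_simps)
          then show "dist (X s (Q n s)) (X s (q s)) < e"
            using lip'[OF s, of "Q n s" "q s"] by (simp add: dist_real_def)
        qed
      qed
    qed
    have cQ: "continuous_on {0..t} (\<lambda>s. X s (Q n s))" for n
      by (rule continuous_on_subset[OF comp[OF Qc]]) (use t in auto)
    obtain I J where IJ: "\<And>n. ((\<lambda>s. X s (Q n s)) has_integral I n) {0..t}"
        "((\<lambda>s. X s (q s)) has_integral J) {0..t}" "I \<longlonglongrightarrow> J"
      using uniform_limit_integral[OF ul2 cQ] by auto
    have "(\<lambda>n. x0 + I n) \<longlonglongrightarrow> x0 + J" by (intro tendsto_intros IJ(3))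
    moreover have "x0 + I n = Q (Suc n) t" for n using IJ(1)[of n] by (simp add: QS integral_unique)
    moreover have "(\<lambda>n. Q (Suc n) t) \<longlonglongrightarrow> q t"
      using tendsto_uniform_limitI[OF ul t] by (rule LIMSEQ_Suc)
    ultimately have "q t = x0 + J" using LIMSEQ_unique by auto
    then show ?thesis using IJ(2) by (simp add: integral_unique)
  qed
  show thesis
  proof
    show "q 0 = x0" using qeq[of 0] \<tau> by simp
    show "(q has_real_derivative X t (q t)) (at t within {0..\<tau>})" if t: "t \<in> {0..\<tau>}" for t
    proof -
      have "((\<lambda>t. integral {0..t} (\<lambda>s. X s (q s))) has_real_derivative X t (q t)) (at t within {0..\<tau>})"
        by (rule integral_has_real_derivative[OF comp[OF qc] t])
      then have "((\<lambda>t. x0 + integral {0..t} (\<lambda>s. X s (q s))) has_real_derivative X t (q t)) (at t within {0..\<tau>})"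
        by (auto intro!: derivative_eq_intros)
      then show ?thesis
        by (rule has_field_derivative_transform_within[OF _ zero_less_one t]) (use qeq in simp)
    qed
  qed
qed

text \<open>The lower bound \<open>p\<close> for \<open>m\<close> in the integral inequality satisfies \<open>p' = \<kappa> m\<^sup>2 \<ge> \<kappa> p\<^sup>2\<close>, so \<open>1/p\<close> decreases with speed at
  least \<open>\<kappa>\<close> and would reach \<open>0\<close> at time \<open>1/(\<kappa> m0)\<close>.\<close>

lemma quadratic_integral_growth:
  fixes m :: "real \<Rightarrow> real"
  assumes \<tau>: "0 \<le> \<tau>" and m: "continuous_on {0..\<tau>} m" and m0: "0 < m0" and \<kappa>: "0 < \<kappa>"
    and le: "\<And>t. t \<in> {0..\<tau>} \<Longrightarrow> m0 + \<kappa> * integral {0..t} (\<lambda>s. (m s)\<^sup>2) \<le> m t"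
  shows "\<kappa> * \<tau> * m0 < 1"
proof -
  define p where "p t = m0 + \<kappa> * integral {0..t} (\<lambda>s. (m s)\<^sup>2)" for t
  have mc: "continuous_on {0..\<tau>} (\<lambda>s. (m s)\<^sup>2)" by (intro continuous_intros m)
  have dp: "(p has_real_derivative \<kappa> * (m t)\<^sup>2) (at t within {0..\<tau>})" if "t \<in> {0..\<tau>}" for t
    unfolding p_def by (auto intro!: derivative_eq_intros integral_has_real_derivative[OF mc that])
  have p: "m0 \<le> p t" if "t \<in> {0..\<tau>}" for t
  proof -
    have "continuous_on {0..t} (\<lambda>s. (m s)\<^sup>2)"
      by (rule continuous_on_subset[OF mc]) (use that in auto)
    then have "0 \<le> integral {0..t} (\<lambda>s. (m s)\<^sup>2)"
      by (intro Henstock_Kurzweil_Integration.integral_nonneg integrable_continuous_real) auto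
    then show ?thesis using \<kappa> by (simp add: p_def)
  qed
  have upper: "((\<lambda>t. \<kappa> * (m t)\<^sup>2 / (p t)\<^sup>2) has_integral (- (1 / p \<tau>) - - (1 / p 0))) {0..\<tau>}"
  proof (rule fundamental_theorem_of_calculus[OF \<tau>])
    fix t assume t: "t \<in> {0..\<tau>}"
    have "0 < p t" using p[OF t] m0 by simp
    then show "((\<lambda>t. - (1 / p t)) has_vector_derivative \<kappa> * (m t)\<^sup>2 / (p t)\<^sup>2) (at t within {0..\<tau>})"
      unfolding has_real_derivative_iff_has_vector_derivative[symmetric]
      by (auto intro!: derivative_eq_intros dp t simp: power2_eq_square)
  qed
  have lower: "((\<lambda>t. \<kappa>) has_integral \<kappa> * \<tau>) {0..\<tau>}"
    using has_integral_const_real[of \<kappa> 0 \<tau>] \<tau> by (simp add: mult.commute)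
  have "\<kappa> * \<tau> \<le> - (1 / p \<tau>) - - (1 / p 0)"
  proof (rule has_integral_le[OF lower upper])
    fix t assume t: "t \<in> {0..\<tau>}"
    have pt: "0 < p t" using p[OF t] m0 by simp
    have "p t \<le> m t" using le[OF t] by (simp add: p_def)
    then have "(p t)\<^sup>2 \<le> (m t)\<^sup>2" using pt by (intro power_mono) auto
    then have "1 \<le> (m t)\<^sup>2 / (p t)\<^sup>2" using pt by simp
    then show "\<kappa> \<le> \<kappa> * (m t)\<^sup>2 / (p t)\<^sup>2" using \<kappa> mult_left_mono[of 1 "(m t)\<^sup>2 / (p t)\<^sup>2" \<kappa>] by simp
  qed
  moreover have "p 0 = m0" by (simp add: p_def)
  ultimately have "\<kappa> * \<tau> \<le> 1 / m0 - 1 / p \<tau>" by simp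
  moreover have "0 < 1 / p \<tau>" using p[of \<tau>] \<tau> m0 by simp
  ultimately have "\<kappa> * \<tau> < 1 / m0" by linarith
  then show ?thesis using m0 by (simp add: field_simps)
qed

text \<open>Up to the first zero of the product \<open>a b\<close> the integral is nonnegative, so that \<open>a\<close> and \<open>b\<close> are still at least
  as large as initially; hence there is no zero, and the minimum of \<open>a\<close> and \<open>b\<close> satisfies a quadratic
  integral inequality.\<close>

lemma product_integral_growth:
  fixes a b :: "real \<Rightarrow> real"
  assumes \<tau>: "0 \<le> \<tau>" and cont: "continuous_on {0..\<tau>} a" "continuous_on {0..\<tau>} b"
    and pos: "0 < a 0" "0 < b 0" and \<kappa>: "0 < \<kappa>"
    and a: "\<And>t. t \<in> {0..\<tau>} \<Longrightarrow> a 0 + \<kappa> * integral {0..t} (\<lambda>s. a s * b s) \<le> a t"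
    and b: "\<And>t. t \<in> {0..\<tau>} \<Longrightarrow> b 0 + \<kappa> * integral {0..t} (\<lambda>s. a s * b s) \<le> b t"
  shows "\<kappa> * \<tau> * min (a 0) (b 0) < 1"
proof -
  have abc: "continuous_on {0..\<tau>} (\<lambda>s. a s * b s)" by (intro continuous_intros cont)
  have abi: "(\<lambda>s. a s * b s) integrable_on {0..t}" if "t \<in> {0..\<tau>}" for t
    by (intro integrable_continuous_real continuous_on_subset[OF abc]) (use that in auto)
  have ab_pos: "0 < a t * b t" if "t \<in> {0..\<tau>}" for t
  proof (rule ccontr)
    assume neg: "\<not> 0 < a t * b t"
    define Z where "Z = {s \<in> {0..\<tau>}. a s * b s \<le> 0}"
    have "Z = {0..\<tau>} \<inter> (\<lambda>s. a s * b s) -` {..0}" by (auto simp: Z_def)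
    then have "closed Z"
      using continuous_closed_preimage[OF abc closed_real_atLeastAtMost closed_atMost[of 0]] by simp
    moreover have "Z \<subseteq> {0..\<tau>}" by (auto simp: Z_def)
    moreover have "Z \<noteq> {}" using neg that by (auto simp: Z_def)
    ultimately obtain t0 where t0: "t0 \<in> Z" "\<And>s. s \<in> Z \<Longrightarrow> t0 \<le> s"
      using compact_attains_inf[of Z] by (metis closed_subset compact_Icc compact_Int_closed inf.absorb2)
    have t0': "t0 \<in> {0..\<tau>}" using t0 by (simp add: Z_def)
    \<comment> \<open>Before its first zero \<open>t0\<close> the product is positive; its value at \<open>t0\<close> itself does not affect the integral.\<close>
    have "0 \<le> integral {0..t0} (\<lambda>s. if s = t0 then 0 else a s * b s)"
    proof (rule Henstock_Kurzweil_Integration.integral_nonneg)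
      show "(\<lambda>s. if s = t0 then 0 else a s * b s) integrable_on {0..t0}"
        by (rule integrable_spike[OF abi[OF t0'], of "{t0}"]) auto
      show "0 \<le> (if s = t0 then 0 else a s * b s)" if "s \<in> {0..t0}" for s
        using t0(2)[of s] t0' that by (force simp: Z_def)
    qed
    also have "\<dots> = integral {0..t0} (\<lambda>s. a s * b s)"
      by (rule integral_spike[of "{t0}"]) auto
    finally have i: "0 \<le> \<kappa> * integral {0..t0} (\<lambda>s. a s * b s)" using \<kappa> by simp
    have "0 < a t0" "0 < b t0" using a[OF t0'] b[OF t0'] i pos by linarith+
    then show False using t0(1) by (simp add: Z_def mult_le_0_iff)
  qed
  have int_pos: "0 \<le> integral {0..t} (\<lambda>s. a s * b s)" if "t \<in> {0..\<tau>}" for t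
    by (rule Henstock_Kurzweil_Integration.integral_nonneg[OF abi[OF that]])
       (use ab_pos that in \<open>auto intro: less_imp_le\<close>)
  have ab: "0 < a t" "0 < b t" if "t \<in> {0..\<tau>}" for t
    using a[OF that] b[OF that] mult_nonneg_nonneg[OF less_imp_le[OF \<kappa>] int_pos[OF that]] pos by linarith+
  define m where "m t = min (a t) (b t)" for t
  have mc: "continuous_on {0..\<tau>} m" unfolding m_def by (intro continuous_intros cont)
  have "\<kappa> * \<tau> * m 0 < 1"
  proof (rule quadratic_integral_growth[OF \<tau> mc _ \<kappa>])
    show "0 < m 0" using pos by (simp add: m_def)
    fix t assume t: "t \<in> {0..\<tau>}"
    have "integral {0..t} (\<lambda>s. (m s)\<^sup>2) \<le> integral {0..t} (\<lambda>s. a s * b s)"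
    proof (rule integral_le)
      show "(\<lambda>s. (m s)\<^sup>2) integrable_on {0..t}"
        by (intro integrable_continuous_real continuous_intros continuous_on_subset[OF mc]) (use t in auto)
      show "(m s)\<^sup>2 \<le> a s * b s" if "s \<in> {0..t}" for s
      proof -
        have s: "s \<in> {0..\<tau>}" using that t by auto
        show ?thesis unfolding power2_eq_square m_def
          using ab[OF s] by (intro mult_mono) auto
      qed
    qed (rule abi[OF t])
    then have "\<kappa> * integral {0..t} (\<lambda>s. (m s)\<^sup>2) \<le> \<kappa> * integral {0..t} (\<lambda>s. a s * b s)"
      using \<kappa> by (intro mult_left_mono) auto
    then show "m 0 + \<kappa> * integral {0..t} (\<lambda>s. (m s)\<^sup>2) \<le> m t"
      using a[OF t] b[OF t] by (auto simp: m_def min_def)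
  qed
  then show ?thesis by (simp add: m_def)
qed

text \<open>The chain rule along a curve for a function that has a derivative in time only in the sense of uniform
  convergence of the difference quotients; joint differentiability is replaced by that uniformity.\<close>

lemma uniform_chain_rule:
  fixes V :: "real \<Rightarrow> real \<Rightarrow> real"
  assumes ul: "uniform_limit UNIV (\<lambda>\<tau> x. (V \<tau> x - V t x) / (\<tau> - t)) W (at t within S)"
    and W: "isCont W (y t)" and V: "(V t has_real_derivative V') (at (y t))"
    and y: "(y has_real_derivative y') (at t within S)"
  shows "((\<lambda>\<tau>. V \<tau> (y \<tau>)) has_real_derivative W (y t) + V' * y') (at t within S)"
proof -
  have yc: "(y \<longlongrightarrow> y t) (at t within S)"
    using DERIV_continuous[OF y] by (simp add: continuous_within)
  have "((\<lambda>\<tau>. (V \<tau> (y \<tau>) - V t (y \<tau>)) / (\<tau> - t) - W (y \<tau>)) \<longlongrightarrow> 0) (at t within S)"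
  proof (rule tendstoI)
    fix e :: real assume "0 < e"
    from uniform_limitD[OF ul this]
    show "\<forall>\<^sub>F \<tau> in at t within S. dist ((V \<tau> (y \<tau>) - V t (y \<tau>)) / (\<tau> - t) - W (y \<tau>)) 0 < e"
      by eventually_elim (simp add: dist_real_def)
  qed
  moreover have "((\<lambda>\<tau>. W (y \<tau>)) \<longlongrightarrow> W (y t)) (at t within S)"
    using W yc by (rule isCont_tendsto_compose)
  ultimately have 1: "((\<lambda>\<tau>. (V \<tau> (y \<tau>) - V t (y \<tau>)) / (\<tau> - t)) \<longlongrightarrow> W (y t)) (at t within S)"
    using tendsto_add by fastforce
  have "((\<lambda>\<tau>. V t (y \<tau>)) has_real_derivative V' * y') (at t within S)"
    using V y by (rule DERIV_chain2)
  then have "((\<lambda>\<tau>. (V t (y \<tau>) - V t (y t)) / (\<tau> - t)) \<longlongrightarrow> V' * y') (at t within S)"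
    by (simp add: has_field_derivative_iff)
  from tendsto_add[OF 1 this]
  have "((\<lambda>\<tau>. (V \<tau> (y \<tau>) - V t (y t)) / (\<tau> - t)) \<longlongrightarrow> W (y t) + V' * y') (at t within S)"
    by (simp flip: add_divide_distrib)
  then show ?thesis by (simp add: has_field_derivative_iff)
qed

text \<open>Compactness of the time interval, in the form of the bisection principle.\<close>

lemma uniform_limit_imp_bounded:
  fixes V :: "real \<Rightarrow> real \<Rightarrow> real"
  assumes "0 \<le> \<tau>" and b: "\<And>t. t \<in> {0..\<tau>} \<Longrightarrow> \<exists>K. \<forall>x. \<bar>V t x\<bar> \<le> K"
    and ul: "\<And>t. t \<in> {0..\<tau>} \<Longrightarrow> uniform_limit UNIV V (V t) (at t within {0..\<tau>})"
  shows "\<exists>K. \<forall>t\<in>{0..\<tau>}. \<forall>x. \<bar>V t x\<bar> \<le> K"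
proof -
  have "\<exists>K. \<forall>t\<in>{0..\<tau>} \<inter> {0..\<tau>}. \<forall>x. \<bar>V t x\<bar> \<le> K"
    using \<open>0 \<le> \<tau>\<close>
  proof (induction rule: Bolzano[where P = "\<lambda>a b. \<exists>K. \<forall>t\<in>{a..b} \<inter> {0..\<tau>}. \<forall>x. \<bar>V t x\<bar> \<le> K"])
    case (trans a b c)
    then obtain K1 K2 where K: "\<And>t x. t \<in> {a..b} \<inter> {0..\<tau>} \<Longrightarrow> \<bar>V t x\<bar> \<le> K1" "\<And>t x. t \<in> {b..c} \<inter> {0..\<tau>} \<Longrightarrow> \<bar>V t x\<bar> \<le> K2"
      by blast
    show ?case
    proof (intro exI ballI allI)
      fix t x assume "t \<in> {a..c} \<inter> {0..\<tau>}"
      then show "\<bar>V t x\<bar> \<le> max K1 K2" using K(1)[of t x] K(2)[of t x] by (cases "t \<le> b") auto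
    qed
  next
    case (local t)
    then have t: "t \<in> {0..\<tau>}" by simp
    obtain K where K: "\<And>x. \<bar>V t x\<bar> \<le> K" using b[OF t] by blast
    obtain d where d: "0 < d" "\<And>s x. s \<in> {0..\<tau>} \<Longrightarrow> s \<noteq> t \<Longrightarrow> dist s t < d \<Longrightarrow> dist (V s x) (V t x) < 1"
      using uniform_limitD[OF ul[OF t] zero_less_one] unfolding eventually_at by auto
    have "\<bar>V s x\<bar> \<le> K + 1" if "s \<in> {0..\<tau>}" "dist s t < d" for s x
      using d(2)[OF that(1) _ that(2), of x] K[of x] by (cases "s = t") (auto simp: dist_real_def)
    then show ?case
      using d(1) by (intro exI[of _ d] conjI allI impI exI[of _ "K + 1"] ballI) (auto simp: dist_real_def)
  qed
  then show ?thesis by simp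
qed

lemma uniform_limit_imp_jointly_continuous:
  fixes V :: "real \<Rightarrow> real \<Rightarrow> real"
  assumes c: "\<And>t. t \<in> S \<Longrightarrow> continuous_on UNIV (V t)"
    and ul: "\<And>t. t \<in> S \<Longrightarrow> uniform_limit UNIV V (V t) (at t within S)"
  shows "continuous_on (S \<times> UNIV) (\<lambda>p. V (fst p) (snd p))"
  unfolding continuous_on_iff
proof (intro ballI allI impI)
  fix p :: "real \<times> real" and e :: real
  assume p: "p \<in> S \<times> UNIV" and e: "0 < e"
  obtain t x where tx: "p = (t, x)" "t \<in> S" using p by auto
  obtain d1 where d1: "0 < d1" "\<And>s y. s \<in> S \<Longrightarrow> s \<noteq> t \<Longrightarrow> dist s t < d1 \<Longrightarrow> dist (V s y) (V t y) < e / 2"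
    using uniform_limitD[OF ul[OF tx(2)] half_gt_zero[OF e]] unfolding eventually_at by auto
  obtain d2 where d2: "0 < d2" "\<And>y. dist y x < d2 \<Longrightarrow> dist (V t y) (V t x) < e / 2"
    using c[OF tx(2)] half_gt_zero[OF e] unfolding continuous_on_iff by (metis UNIV_I)
  show "\<exists>d>0. \<forall>p'\<in>S \<times> UNIV. dist p' p < d \<longrightarrow> dist (V (fst p') (snd p')) (V (fst p) (snd p)) < e"
  proof (intro exI conjI ballI impI)
    show "0 < min d1 d2" using d1 d2 by simp
    fix p' assume p': "p' \<in> S \<times> UNIV" "dist p' p < min d1 d2"
    have "dist (fst p') t < d1" "dist (snd p') x < d2"
      using p'(2) dist_fst_le[of p' p] dist_snd_le[of p' p] tx by auto
    then have "dist (V (fst p') (snd p')) (V t (snd p')) < e / 2" "dist (V t (snd p')) (V t x) < e / 2"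
      using d1(2)[of "fst p'" "snd p'"] d2 p'(1) e by (cases "fst p' = t"; auto)+
    then show "dist (V (fst p') (snd p')) (V (fst p) (snd p)) < e"
      using dist_triangle_half_r[of "V t (snd p')" "V (fst p') (snd p')" e "V t x"] tx
      by (simp add: dist_commute)
  qed
qed

section \<open>Blow-up along a characteristic\<close>

text \<open>The hypotheses describe a solution of the equation with the regularity that the Sobolev embedding
  provides: no second derivative in space is available. The slope along the characteristic \<open>q\<close> is therefore
  obtained as the limit of difference quotients between the parallel curves \<open>q\<close> and \<open>q + h\<close>; the curve
  \<open>q + h\<close> is not a characteristic, which produces the term with \<open>V'\<close> in their equation.\<close>

lemma blowup_time_bound:
  fixes c \<tau> x0 :: real and V V' W :: "real \<Rightarrow> real \<Rightarrow> real"
  defines "f \<equiv> \<lambda>t x. c\<^sup>2 * (V t x)\<^sup>2 + c ^ 4 / 2 * (V' t x)\<^sup>2"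
  assumes c: "0 < c" and \<tau>: "0 \<le> \<tau>"
    and V: "\<And>t x. t \<in> {0..\<tau>} \<Longrightarrow> (V t has_real_derivative V' t x) (at x)"
    and V'c: "\<And>t. t \<in> {0..\<tau>} \<Longrightarrow> continuous_on UNIV (V' t)"
    and Wc: "\<And>t. t \<in> {0..\<tau>} \<Longrightarrow> continuous_on UNIV (W t)"
    and bV: "\<And>t. t \<in> {0..\<tau>} \<Longrightarrow> \<exists>K. \<forall>x. \<bar>V t x\<bar> \<le> K"
    and bV': "\<And>t. t \<in> {0..\<tau>} \<Longrightarrow> \<exists>K. \<forall>x. \<bar>V' t x\<bar> \<le> K"
    and uV: "\<And>t. t \<in> {0..\<tau>} \<Longrightarrow> uniform_limit UNIV V (V t) (at t within {0..\<tau>})"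
    and uV': "\<And>t. t \<in> {0..\<tau>} \<Longrightarrow> uniform_limit UNIV V' (V' t) (at t within {0..\<tau>})"
    and uW: "\<And>t. t \<in> {0..\<tau>} \<Longrightarrow>
      uniform_limit UNIV (\<lambda>\<tau> x. (V \<tau> x - V t x) / (\<tau> - t)) (W t) (at t within {0..\<tau>})"
    and eq: "\<And>t x. t \<in> {0..\<tau>} \<Longrightarrow> W t x + c\<^sup>2 * V t x * V' t x
      = - ((right_potential c (f t) x - left_potential c (f t) x) / (2 * c\<^sup>2))"
    and neg: "V 0 x0 + c * V' 0 x0 < 0" and pos: "0 < V 0 x0 - c * V' 0 x0"
  shows "c / 2 * \<tau> * min (- (V 0 x0 + c * V' 0 x0)) (V 0 x0 - c * V' 0 x0) < 1"
proof -
  have Vc: "continuous_on UNIV (V t)" if "t \<in> {0..\<tau>}" for t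
    using V[OF that] by (meson DERIV_isCont continuous_at_imp_continuous_on)
  obtain K1 where K1: "\<And>t x. t \<in> {0..\<tau>} \<Longrightarrow> \<bar>V t x\<bar> \<le> K1"
    using uniform_limit_imp_bounded[OF \<tau> bV uV] by blast
  obtain K2 where K2: "\<And>t x. t \<in> {0..\<tau>} \<Longrightarrow> \<bar>V' t x\<bar> \<le> K2"
    using uniform_limit_imp_bounded[OF \<tau> bV' uV'] by blast
  define K where "K = max K1 K2"
  have K: "\<bar>V t x\<bar> \<le> K" "\<bar>V' t x\<bar> \<le> K" if "t \<in> {0..\<tau>}" for t x
    using K1[OF that, of x] K2[OF that, of x] by (auto simp: K_def)
  have K0: "0 \<le> K" using K(1)[of 0 0] \<tau> by simp
  have fc: "continuous_on UNIV (f t)" if "t \<in> {0..\<tau>}" for t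
    unfolding f_def by (intro continuous_intros Vc V'c that)
  define M where "M = c\<^sup>2 * K\<^sup>2 + c ^ 4 / 2 * K\<^sup>2"
  have fM: "\<bar>f t x\<bar> \<le> M" if "t \<in> {0..\<tau>}" for t x
  proof -
    have "(V t x)\<^sup>2 \<le> K\<^sup>2" "(V' t x)\<^sup>2 \<le> K\<^sup>2"
      using power_mono[OF K(1)[OF that, of x], of 2] power_mono[OF K(2)[OF that, of x], of 2] by auto
    then have "f t x \<le> M" unfolding M_def f_def by (intro add_mono mult_left_mono) auto
    moreover have "0 \<le> f t x" by (simp add: f_def)
    ultimately show ?thesis by simp
  qed
  define R where "R t = right_potential c (f t)" for t
  define L where "L t = left_potential c (f t)" for t
  define P where "P t x = (R t x - L t x) / (2 * c\<^sup>2)" for t x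
  define P' where "P' t x = ((R t x + L t x) / c - 2 * f t x) / (2 * c\<^sup>2)" for t x
  have dP: "(P t has_real_derivative P' t x) (at x)" if t: "t \<in> {0..\<tau>}" for t x
  proof -
    have "(R t has_real_derivative R t x / c - f t x) (at x)"
      unfolding R_def by (rule right_potential_has_derivative[OF c fc[OF t] fM[OF t]])
    moreover have "(L t has_real_derivative f t x - L t x / c) (at x)"
      unfolding L_def by (rule left_potential_has_derivative[OF c fc[OF t] fM[OF t]])
    ultimately have "(P t has_real_derivative ((R t x / c - f t x) - (f t x - L t x / c)) / (2 * c\<^sup>2)) (at x)"
      unfolding P_def by (intro DERIV_cdivide DERIV_diff)
    then show ?thesis by (simp add: P'_def add_divide_distrib)
  qed
  have P'_bound: "\<bar>P' t x\<bar> \<le> 2 * M / c\<^sup>2" if t: "t \<in> {0..\<tau>}" for t x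
  proof -
    have "\<bar>R t x\<bar> \<le> c * M" "\<bar>L t x\<bar> \<le> c * M"
      unfolding R_def L_def
      using right_potential_bound[OF c fc[OF t] fM[OF t]] left_potential_bound[OF c fc[OF t] fM[OF t]] by auto
    then have "\<bar>R t x + L t x\<bar> \<le> 2 * (c * M)" by linarith
    then have "\<bar>(R t x + L t x) / c\<bar> \<le> 2 * M" using c by (simp add: abs_divide field_simps)
    then have "\<bar>(R t x + L t x) / c - 2 * f t x\<bar> \<le> 4 * M" using fM[OF t, of x] by linarith
    then show ?thesis using c by (simp add: P'_def abs_divide field_simps)
  qed
  have W: "W t x = - P t x - c\<^sup>2 * V t x * V' t x" if "t \<in> {0..\<tau>}" for t x
    using eq[OF that, of x] by (simp add: P_def R_def L_def)
  obtain q where q0: "q 0 = x0"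
    and q: "\<And>t. t \<in> {0..\<tau>} \<Longrightarrow> (q has_real_derivative c\<^sup>2 * V t (q t)) (at t within {0..\<tau>})"
  proof (rule picard_lindeloef[OF \<tau>, of "\<lambda>t x. c\<^sup>2 * V t x" "c\<^sup>2 * K" x0])
    show "continuous_on ({0..\<tau>} \<times> UNIV) (\<lambda>p. c\<^sup>2 * V (fst p) (snd p))"
      by (intro continuous_intros uniform_limit_imp_jointly_continuous Vc uV)
    show "\<bar>c\<^sup>2 * V t x - c\<^sup>2 * V t y\<bar> \<le> c\<^sup>2 * K * \<bar>x - y\<bar>" if t: "t \<in> {0..\<tau>}" for t x y
    proof -
      have "norm (V t x - V t y) \<le> K * norm (x - y)"
        by (rule field_differentiable_bound[of UNIV "V t" "V' t"]) (use V[OF t] K[OF t] in auto)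
      then have "c\<^sup>2 * \<bar>V t x - V t y\<bar> \<le> c\<^sup>2 * (K * \<bar>x - y\<bar>)" by (intro mult_left_mono) auto
      then show ?thesis by (simp add: abs_mult mult.assoc flip: right_diff_distrib)
    qed
  qed blast
  have shift: "((\<lambda>t. V t (q t + h)) has_real_derivative - P t (q t + h) - c\<^sup>2 * V' t (q t + h) * (V t (q t + h) - V t (q t))) (at t within {0..\<tau>})"
    if t: "t \<in> {0..\<tau>}" for t h
  proof -
    have "((\<lambda>t. V t (q t + h)) has_real_derivative W t (q t + h) + V' t (q t + h) * (c\<^sup>2 * V t (q t))) (at t within {0..\<tau>})"
    proof (rule uniform_chain_rule[OF uW[OF t], where y = "\<lambda>t. q t + h"])
      show "isCont (W t) (q t + h)" using Wc[OF t] by (simp add: continuous_on_eq_continuous_at)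
      show "((\<lambda>t. q t + h) has_real_derivative c\<^sup>2 * V t (q t)) (at t within {0..\<tau>})"
        using q[OF t] by (auto intro!: derivative_eq_intros)
    qed (rule V[OF t])
    then show ?thesis by (simp add: W[OF t] algebra_simps)
  qed
  define U where "U t = V t (q t)" for t
  define Y where "Y t = V' t (q t)" for t
  have dU: "(U has_real_derivative - P t (q t)) (at t within {0..\<tau>})" if "t \<in> {0..\<tau>}" for t
    using shift[OF that, of 0] by (simp add: U_def[abs_def])
  \<comment> \<open>The formal derivative of the slope \<open>Y\<close> along the characteristic; only its integral is meaningful.\<close>
  define g where "g t = - P' t (q t) - c\<^sup>2 * (Y t)\<^sup>2" for t
  define h where "h n = 1 / real (Suc n)" for n
  have h: "0 < h n" for n by (simp add: h_def)
  have h0: "filterlim h (at 0) sequentially"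
    using LIMSEQ_inverse_real_of_nat
    by (intro filterlim_atI) (auto simp: h_def[abs_def] inverse_eq_divide)
  define D where "D n t = (V t (q t + h n) - V t (q t)) / h n" for n t
  define D' where "D' n t = - ((P t (q t + h n) - P t (q t)) / h n) - c\<^sup>2 * V' t (q t + h n) * D n t" for n t
  have Y_integral: "g integrable_on {0..b} \<and> Y b = Y 0 + integral {0..b} g" if b: "b \<in> {0..\<tau>}" for b
  proof -
    have dD: "(D n has_real_derivative D' n t) (at t within {0..\<tau>})" if t: "t \<in> {0..\<tau>}" for n t
    proof -
      have "(D n has_real_derivative ((- P t (q t + h n) - c\<^sup>2 * V' t (q t + h n) * (V t (q t + h n) - V t (q t))) - (- P t (q t))) / h n) (at t within {0..\<tau>})"
        unfolding D_def by (intro DERIV_cdivide DERIV_diff shift t dU[OF t, unfolded U_def])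
      moreover have "((- P t (q t + h n) - c\<^sup>2 * V' t (q t + h n) * (V t (q t + h n) - V t (q t))) - (- P t (q t))) / h n = D' n t"
        using h[of n] by (simp add: D'_def D_def field_simps)
      ultimately show ?thesis by simp
    qed
    have int: "(D' n has_integral D n b - D n 0) {0..b}" for n
    proof (rule fundamental_theorem_of_calculus)
      fix t assume "t \<in> {0..b}"
      then have "t \<in> {0..\<tau>}" using b by auto
      from has_field_derivative_subset[OF dD[OF this], of "{0..b}" n]
      show "(D n has_vector_derivative D' n t) (at t within {0..b})"
        using b by (simp add: has_real_derivative_iff_has_vector_derivative)
    qed (use b in simp)
    have D_lim: "(\<lambda>n. D n t) \<longlonglongrightarrow> Y t" if t: "t \<in> {0..\<tau>}" for t
      unfolding D_def Y_def
      using V[OF t, of "q t"] h0 by (auto simp: DERIV_def intro: filterlim_compose)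
    have conv: "(\<lambda>n. D' n t) \<longlonglongrightarrow> g t" if "t \<in> {0..b}" for t
    proof -
      have t: "t \<in> {0..\<tau>}" using that b by auto
      have "(\<lambda>n. (P t (q t + h n) - P t (q t)) / h n) \<longlonglongrightarrow> P' t (q t)"
        using dP[OF t, of "q t"] h0 by (auto simp: DERIV_def intro: filterlim_compose)
      moreover have "(\<lambda>n. V' t (q t + h n)) \<longlonglongrightarrow> V' t (q t)"
      proof -
        have "isCont (V' t) (q t)" using V'c[OF t] by (simp add: continuous_on_eq_continuous_at)
        moreover have "h \<longlonglongrightarrow> 0" using h0 by (simp add: filterlim_at)
        then have "(\<lambda>n. q t + h n) \<longlonglongrightarrow> q t" by (auto intro!: tendsto_eq_intros)
        ultimately show ?thesis by (rule isCont_tendsto_compose)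
      qed
      ultimately have "(\<lambda>n. D' n t) \<longlonglongrightarrow> - P' t (q t) - c\<^sup>2 * V' t (q t) * Y t"
        unfolding D'_def by (intro tendsto_intros D_lim t)
      then show ?thesis by (simp add: g_def Y_def power2_eq_square mult.assoc)
    qed
    have quot: "\<bar>(G (x + h n) - G x) / h n\<bar> \<le> C" if "\<And>x. (G has_real_derivative G' x) (at x)" "\<And>x. \<bar>G' x\<bar> \<le> C" for G G' :: "real \<Rightarrow> real" and C x n
    proof -
      have "norm (G (x + h n) - G x) \<le> C * norm (x + h n - x)"
        by (rule field_differentiable_bound[of UNIV G G']) (use that in auto)
      then show ?thesis using h[of n] by (simp add: abs_divide field_simps)
    qed
    have bound: "norm (D' n t) \<le> 2 * M / c\<^sup>2 + c\<^sup>2 * K * K" if "t \<in> {0..b}" for n t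
    proof -
      have t: "t \<in> {0..\<tau>}" using that b by auto
      have "\<bar>(P t (q t + h n) - P t (q t)) / h n\<bar> \<le> 2 * M / c\<^sup>2"
        by (rule quot[OF dP[OF t] P'_bound[OF t]])
      moreover have "\<bar>D n t\<bar> \<le> K" unfolding D_def by (rule quot[OF V[OF t] K(2)[OF t]])
      then have "\<bar>c\<^sup>2 * V' t (q t + h n) * D n t\<bar> \<le> c\<^sup>2 * K * K"
        unfolding abs_mult using K(2)[OF t] K0 by (intro mult_mono) auto
      ultimately show ?thesis unfolding D'_def real_norm_def by linarith
    qed
    have D'i: "D' n integrable_on {0..b}" for n using int by blast
    note dom = dominated_convergence[where h = "\<lambda>_. 2 * M / c\<^sup>2 + c\<^sup>2 * K * K", OF D'i integrable_const_ivl bound conv]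
    have "(\<lambda>n. D n b - D n 0) \<longlonglongrightarrow> integral {0..b} g"
      using dom(2) integral_unique[OF int] by simp
    moreover have "(\<lambda>n. D n b - D n 0) \<longlonglongrightarrow> Y b - Y 0"
      using \<tau> b by (intro tendsto_diff D_lim) auto
    ultimately have "Y b - Y 0 = integral {0..b} g" using LIMSEQ_unique by blast
    then show ?thesis using dom(1) by simp
  qed
  have U_integral: "((\<lambda>t. - P t (q t)) has_integral U b - U 0) {0..b}" if b: "b \<in> {0..\<tau>}" for b
  proof (rule fundamental_theorem_of_calculus)
    fix t assume "t \<in> {0..b}"
    then have "t \<in> {0..\<tau>}" using b by auto
    from has_field_derivative_subset[OF dU[OF this], of "{0..b}"]
    show "(U has_vector_derivative - P t (q t)) (at t within {0..b})"
      using b by (simp add: has_real_derivative_iff_has_vector_derivative)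
  qed (use b in simp)
  have Uc: "continuous_on {0..\<tau>} U"
    using dU by (meson DERIV_continuous continuous_on_eq_continuous_within)
  have "continuous_on {0..\<tau>} (\<lambda>b. Y 0 + integral {0..b} g)"
    using Y_integral[of \<tau>] \<tau> by (intro continuous_intros indefinite_integral_continuous_1) auto
  then have Yc: "continuous_on {0..\<tau>} Y"
    by (rule continuous_on_eq) (rule Y_integral[THEN conjunct2, symmetric])
  define a b where "a t = - (U t + c * Y t)" and "b t = U t - c * Y t" for t
  have abc: "continuous_on {0..\<tau>} a" "continuous_on {0..\<tau>} b"
    unfolding a_def b_def by (intro continuous_intros Uc Yc)+
  have ab: "a t * b t = c\<^sup>2 * (Y t)\<^sup>2 - (U t)\<^sup>2" for t
    by (simp add: a_def b_def power2_eq_square algebra_simps)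
  have lower: "c / 2 * (a t * b t) \<le> P t (q t) - c * g t" "c / 2 * (a t * b t) \<le> - P t (q t) - c * g t"
    if t: "t \<in> {0..\<tau>}" for t
  proof -
    have RL: "c ^ 3 / 2 * (U t)\<^sup>2 \<le> R t (q t)" "c ^ 3 / 2 * (U t)\<^sup>2 \<le> L t (q t)"
      unfolding R_def L_def f_def U_def
      using right_potential_lower_bound[OF c V[OF t] V'c[OF t] K[OF t]]
        left_potential_lower_bound[OF c V[OF t] V'c[OF t] K[OF t]] by auto
    have ft: "f t (q t) = c\<^sup>2 * (U t)\<^sup>2 + c ^ 4 / 2 * (Y t)\<^sup>2" by (simp add: f_def U_def Y_def)
    have e: "P t (q t) - c * g t = R t (q t) / c\<^sup>2 - c * (U t)\<^sup>2 + c ^ 3 / 2 * (Y t)\<^sup>2"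
      "- P t (q t) - c * g t = L t (q t) / c\<^sup>2 - c * (U t)\<^sup>2 + c ^ 3 / 2 * (Y t)\<^sup>2"
      using c by (simp_all add: g_def P_def P'_def ft field_simps power2_eq_square power3_eq_cube power4_eq_xxxx)
    have "c / 2 * (U t)\<^sup>2 \<le> R t (q t) / c\<^sup>2" "c / 2 * (U t)\<^sup>2 \<le> L t (q t) / c\<^sup>2"
      using RL c by (simp_all add: field_simps power2_eq_square power3_eq_cube)
    moreover have "c / 2 * (c\<^sup>2 * (Y t)\<^sup>2) = c ^ 3 / 2 * (Y t)\<^sup>2"
      by (simp add: power2_eq_square power3_eq_cube)
    ultimately show "c / 2 * (a t * b t) \<le> P t (q t) - c * g t" "c / 2 * (a t * b t) \<le> - P t (q t) - c * g t"
      unfolding e ab right_diff_distrib by linarith+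
  qed
  have growth: "c / 2 * integral {0..t} (\<lambda>s. a s * b s) \<le> - (\<sigma> * (U t - U 0)) - c * (Y t - Y 0)"
    if t: "t \<in> {0..\<tau>}" and \<sigma>: "\<And>s. s \<in> {0..\<tau>} \<Longrightarrow> c / 2 * (a s * b s) \<le> \<sigma> * P s (q s) - c * g s" for t \<sigma>
  proof -
    have sub: "{0..t} \<subseteq> {0..\<tau>}" using t by auto
    have abi: "(\<lambda>s. a s * b s) integrable_on {0..t}"
      by (intro integrable_continuous_real continuous_intros continuous_on_subset[OF abc(1) sub] continuous_on_subset[OF abc(2) sub])
    have "((\<lambda>s. c / 2 * (a s * b s)) has_integral c / 2 * integral {0..t} (\<lambda>s. a s * b s)) {0..t}"
      using abi by (intro has_integral_mult_right integrable_integral)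
    moreover have "((\<lambda>s. - \<sigma> * (- P s (q s)) - c * g s) has_integral - \<sigma> * (U t - U 0) - c * (Y t - Y 0)) {0..t}"
    proof (intro has_integral_diff has_integral_mult_right U_integral t)
      have "(g has_integral integral {0..t} g) {0..t}" using Y_integral[OF t] by (intro integrable_integral) simp
      moreover have "Y t - Y 0 = integral {0..t} g" using Y_integral[OF t] by linarith
      ultimately show "(g has_integral Y t - Y 0) {0..t}" by simp
    qed
    ultimately have "c / 2 * integral {0..t} (\<lambda>s. a s * b s) \<le> - \<sigma> * (U t - U 0) - c * (Y t - Y 0)"
      by (rule has_integral_le) (use \<sigma> sub in auto)
    then show ?thesis by simp
  qed
  have "c / 2 * \<tau> * min (a 0) (b 0) < 1"
  proof (rule product_integral_growth[OF \<tau> abc])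
    show "0 < a 0" "0 < b 0" using neg pos by (simp_all add: a_def b_def U_def Y_def q0)
    show "a 0 + c / 2 * integral {0..t} (\<lambda>s. a s * b s) \<le> a t" if "t \<in> {0..\<tau>}" for t
      using growth[OF that, of 1] lower(1) by (simp add: a_def algebra_simps)
    show "b 0 + c / 2 * integral {0..t} (\<lambda>s. a s * b s) \<le> b t" if "t \<in> {0..\<tau>}" for t
      using growth[OF that, of "- 1"] lower(2) by (simp add: b_def algebra_simps)
  qed (use c in simp)
  then show ?thesis by (simp add: a_def b_def U_def Y_def q0)
qed

section \<open>The differential equation in classical form and the theorem\<close>

lemma locally_integrable_imp_measurable:
  assumes "locally_integrable f" shows "f \<in> borel_measurable borel"
proof (rule borel_measurable_LIMSEQ_metric)
  fix n :: nat
  have "set_integrable lborel {- real n..real n} f" using assms by (simp add: locally_integrable_def)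
  then show "(\<lambda>x. indicator {- real n..real n} x *\<^sub>R f x) \<in> borel_measurable borel"
    unfolding set_integrable_def using borel_measurable_integrable by fastforce
next
  fix x :: real
  obtain N where N: "\<bar>x\<bar> \<le> real N" using real_arch_simple by blast
  have "\<forall>\<^sub>F n in sequentially. indicator {- real n..real n} x *\<^sub>R f x = f x"
    using eventually_ge_at_top[of N]
  proof eventually_elim
    case (elim n)
    then have "\<bar>x\<bar> \<le> real n" using N by linarith
    then have "x \<in> {- real n..real n}" by auto
    then show ?case by simp
  qed
  then show "(\<lambda>n. indicator {- real n..real n} x *\<^sub>R f x) \<longlonglongrightarrow> f x"
    by (rule tendsto_eventually)
qed

lemma sobolev_measurable:
  assumes "f \<in> sobolev r" shows "f \<in> borel_measurable borel"
proof -
  have "(\<lambda>x. complex_of_real (f x)) \<in> borel_measurable borel"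
    using assms by (auto simp: sobolev_def has_fourier_def square_integrable_def)
  then have "(\<lambda>x. Re (complex_of_real (f x))) \<in> borel_measurable borel" by measurable
  then show ?thesis by simp
qed

lemma uniform_limit_if_dominated:
  fixes g :: "real \<Rightarrow> real \<Rightarrow> real"
  assumes "\<And>\<tau> x. \<tau> \<in> S \<Longrightarrow> \<tau> \<noteq> t \<Longrightarrow> \<bar>g \<tau> x - l x\<bar> \<le> C * N \<tau>" and N: "(N \<longlongrightarrow> 0) (at t within S)"
  shows "uniform_limit UNIV g l (at t within S)"
proof (rule uniform_limitI)
  fix e :: real assume "0 < e"
  have "((\<lambda>\<tau>. C * N \<tau>) \<longlongrightarrow> 0) (at t within S)" using N by (rule tendsto_mult_right_zero)
  then have "\<forall>\<^sub>F \<tau> in at t within S. C * N \<tau> < e" using \<open>0 < e\<close> by (rule order_tendstoD)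
  moreover have "\<forall>\<^sub>F \<tau> in at t within S. \<tau> \<in> S \<and> \<tau> \<noteq> t" by (auto simp: eventually_at_filter)
  ultimately show "\<forall>\<^sub>F \<tau> in at t within S. \<forall>x\<in>UNIV. dist (g \<tau> x) (l x) < e"
  proof eventually_elim
    case (elim \<tau>)
    then show ?case using assms(1)[of \<tau>] by (auto simp: dist_real_def intro: le_less_trans)
  qed
qed

text \<open>The terms \<open>\<plusminus> f\<close> of the two one-sided derivatives cancel, which makes the derivative differentiable again.\<close>

lemma inverse_helmholtz_has_derivative:
  assumes c: "0 < c" "c = sqrt (real d)" and f: "continuous_on UNIV f" "\<And>x. \<bar>f x\<bar> \<le> M"
  shows "(inverse_helmholtz d f has_real_derivative (right_potential c f x - left_potential c f x) / (2 * c\<^sup>2)) (at x)"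
proof -
  have "((\<lambda>x. (left_potential c f x + right_potential c f x) / (2 * c)) has_real_derivative
      ((f x - left_potential c f x / c) + (right_potential c f x / c - f x)) / (2 * c)) (at x)"
    by (intro DERIV_cdivide DERIV_add left_potential_has_derivative[OF c(1) f] right_potential_has_derivative[OF c(1) f])
  moreover have "((f x - left_potential c f x / c) + (right_potential c f x / c - f x)) / (2 * c)
      = (right_potential c f x - left_potential c f x) / (2 * c\<^sup>2)"
    using c(1) by (simp add: field_simps power2_eq_square)
  moreover have "inverse_helmholtz d f = (\<lambda>x. (left_potential c f x + right_potential c f x) / (2 * c))"
    by (rule ext) (rule inverse_helmholtz_eq[OF c(1) f c(2)])
  ultimately show ?thesis by simp
qed

lemma potential_difference_continuous:
  assumes c: "0 < c" and f: "continuous_on UNIV f" "\<And>x. \<bar>f x\<bar> \<le> M"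
  shows "continuous_on UNIV (\<lambda>x. (right_potential c f x - left_potential c f x) / (2 * c\<^sup>2))"
proof -
  have "continuous_on UNIV (right_potential c f)" "continuous_on UNIV (left_potential c f)"
    using right_potential_has_derivative[OF c f] left_potential_has_derivative[OF c f]
    by (meson DERIV_isCont continuous_at_imp_continuous_on)+
  then show ?thesis using c by (intro continuous_intros) auto
qed

text \<open>The equation is given almost everywhere for some weak derivatives. They agree almost everywhere with the
  classical ones, and an identity between continuous functions that holds almost everywhere holds everywhere.\<close>

lemma pointwise_equation:
  fixes c K :: real
  assumes c: "0 < c" "c = sqrt (real d)" and s: "v \<in> sobolev s"
    and V: "\<And>x. (V has_real_derivative V' x) (at x)" "continuous_on UNIV V'" "AE x in lborel. v x = V x"
    and K: "\<And>x. \<bar>V x\<bar> \<le> K" "\<And>x. \<bar>V' x\<bar> \<le> K"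
    and W: "continuous_on UNIV W" "AE x in lborel. w x = W x"
    and vx: "has_weak_derivative v vx"
    and q: "has_weak_derivative (inverse_helmholtz d (\<lambda>x. real d * (v x)\<^sup>2 + (real d)\<^sup>2 / 2 * (vx x)\<^sup>2)) q"
    and eq: "AE x in lborel. w x + real d * v x * vx x = - q x"
  defines "f \<equiv> \<lambda>x. c\<^sup>2 * (V x)\<^sup>2 + c ^ 4 / 2 * (V' x)\<^sup>2"
  shows "W x + c\<^sup>2 * V x * V' x = - ((right_potential c f x - left_potential c f x) / (2 * c\<^sup>2))"
proof -
  have c2: "c\<^sup>2 = real d" using c by simp
  then have c4: "c ^ 4 = (real d)\<^sup>2" by (metis power2_eq_square power4_eq_xxxx mult.assoc)
  have Vc: "continuous_on UNIV V" using V(1) by (meson DERIV_isCont continuous_at_imp_continuous_on)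
  have fc: "continuous_on UNIV f" unfolding f_def by (intro continuous_intros Vc V(2))
  have fM: "\<bar>f x\<bar> \<le> c\<^sup>2 * K\<^sup>2 + c ^ 4 / 2 * K\<^sup>2" for x
  proof -
    have "(V x)\<^sup>2 \<le> K\<^sup>2" "(V' x)\<^sup>2 \<le> K\<^sup>2"
      using power_mono[OF K(1)[of x], of 2] power_mono[OF K(2)[of x], of 2] by auto
    then have "f x \<le> c\<^sup>2 * K\<^sup>2 + c ^ 4 / 2 * K\<^sup>2" unfolding f_def by (intro add_mono mult_left_mono) auto
    moreover have "0 \<le> f x" by (simp add: f_def)
    ultimately show ?thesis by simp
  qed
  have vxV': "AE x in lborel. vx x = V' x" by (rule weak_derivative_of_C1[OF V vx])
  have [measurable]: "v \<in> borel_measurable borel" using s by (rule sobolev_measurable)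
  have [measurable]: "vx \<in> borel_measurable borel"
    using vx by (auto simp: has_weak_derivative_def intro: locally_integrable_imp_measurable)
  have [measurable]: "f \<in> borel_measurable borel" using fc by (rule borel_measurable_continuous_onI)
  have "inverse_helmholtz d (\<lambda>x. real d * (v x)\<^sup>2 + (real d)\<^sup>2 / 2 * (vx x)\<^sup>2) = inverse_helmholtz d f"
  proof
    fix x
    show "inverse_helmholtz d (\<lambda>x. real d * (v x)\<^sup>2 + (real d)\<^sup>2 / 2 * (vx x)\<^sup>2) x = inverse_helmholtz d f x"
      unfolding inverse_helmholtz_def
    proof (rule integral_cong_AE)
      show "AE y in lborel. kernel d (x - y) * (real d * (v y)\<^sup>2 + (real d)\<^sup>2 / 2 * (vx y)\<^sup>2) = kernel d (x - y) * f y"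
        using V(3) vxV' by eventually_elim (simp add: f_def c2 c4)
    qed (unfold kernel_def, measurable)
  qed
  then have q': "has_weak_derivative (inverse_helmholtz d f) q" using q by simp
  have "AE x in lborel. q x = (right_potential c f x - left_potential c f x) / (2 * c\<^sup>2)"
    by (rule weak_derivative_of_C1[OF inverse_helmholtz_has_derivative[OF c fc fM]
          potential_difference_continuous[OF c(1) fc fM] _ q']) simp
  with eq V(3) W(2) vxV' have "AE x in lborel. W x + c\<^sup>2 * V x * V' x = - ((right_potential c f x - left_potential c f x) / (2 * c\<^sup>2))"
    by eventually_elim (simp add: c2)
  moreover have "continuous_on UNIV (\<lambda>x. W x + c\<^sup>2 * V x * V' x)"
    by (intro continuous_intros Vc V(2) W(1))
  moreover have "continuous_on UNIV (\<lambda>x. - ((right_potential c f x - left_potential c f x) / (2 * c\<^sup>2)))"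
    by (intro continuous_on_minus potential_difference_continuous[OF c(1) fc fM])
  ultimately have "(\<lambda>x. W x + c\<^sup>2 * V x * V' x) = (\<lambda>x. - ((right_potential c f x - left_potential c f x) / (2 * c\<^sup>2)))"
    by (intro AE_eq_continuous_imp_eq)
  then show ?thesis by (rule fun_cong)
qed

theorem corollary1p3:
  fixes d :: nat and s x0 :: real and v0 :: "real \<Rightarrow> real"
    and v :: "real \<Rightarrow> real \<Rightarrow> real" and T :: ereal
  assumes "d \<ge> 1"
    and "s > 3 / 2"
    and "v0 \<in> sobolev s"
    and "nonneg_on (momentum d v0) {..x0}"
    and "nonpos_on (momentum d v0) {x0..}"
    and "changes_sign (momentum d v0)"
    and "maximal_solution d s v0 T v"
  shows "T < \<infinity>"
proof (rule ccontr)
  assume "\<not> T < \<infinity>"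
  then have I: "time_interval T = {0..}" by (auto simp: time_interval_def)
  obtain w where v_init: "AE x in lborel. v 0 x = v0 x"
    and v_cont: "continuous_into_sobolev {0..} s v"
    and w_cont: "continuous_into_sobolev {0..} (s - 1) w"
    and v_deriv: "has_sobolev_derivative {0..} (s - 1) v w"
    and v_eq: "\<And>t. 0 \<le> t \<Longrightarrow> \<exists>vx q. has_weak_derivative (v t) vx \<and>
      has_weak_derivative (inverse_helmholtz d (\<lambda>x. real d * (v t x)\<^sup>2 + (real d)\<^sup>2 / 2 * (vx x)\<^sup>2)) q \<and>
      (AE x in lborel. w t x + real d * v t x * vx x = - q x)"
    using \<open>maximal_solution d s v0 T v\<close> unfolding maximal_solution_def strong_solution_def I by auto
  define c where "c = sqrt (real d)"
  have c: "0 < c" using \<open>d \<ge> 1\<close> by (simp add: c_def)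
  have vs: "v t \<in> sobolev s" if "0 \<le> t" for t
    using v_cont that by (simp add: continuous_into_sobolev_def)
  have ws: "w t \<in> sobolev (s - 1)" if "0 \<le> t" for t
    using w_cont that by (simp add: continuous_into_sobolev_def)
  obtain C1 where C1: "0 \<le> C1" "\<And>f. f \<in> sobolev s \<Longrightarrow> \<exists>F F'. (\<forall>x. (F has_real_derivative F' x) (at x)) \<and>
    continuous_on UNIV F' \<and> (AE x in lborel. f x = F x) \<and>
    (\<forall>x. \<bar>F x\<bar> \<le> C1 * sobolev_norm s f \<and> \<bar>F' x\<bar> \<le> C1 * sobolev_norm s f)"
    by (rule sobolev_C1_representative[OF \<open>s > 3 / 2\<close>]) (rule that; assumption)
  have s1: "1 / 2 < s - 1" using \<open>s > 3 / 2\<close> by simp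
  obtain C0 where C0: "0 \<le> C0" "\<And>f. f \<in> sobolev (s - 1) \<Longrightarrow> \<exists>F. continuous_on UNIV F \<and>
    (AE x in lborel. f x = F x) \<and> (\<forall>x. \<bar>F x\<bar> \<le> C0 * sobolev_norm (s - 1) f)"
    by (rule sobolev_continuous_representative[OF s1]) (rule that; assumption)
  define rep where "rep t F F' \<longleftrightarrow> (\<forall>x. (F has_real_derivative F' x) (at x)) \<and>
    continuous_on UNIV F' \<and> (AE x in lborel. v t x = F x) \<and>
    (\<forall>x. \<bar>F x\<bar> \<le> C1 * sobolev_norm s (v t) \<and> \<bar>F' x\<bar> \<le> C1 * sobolev_norm s (v t))" for t F F'
  have "\<forall>t. \<exists>F F'. 0 \<le> t \<longrightarrow> rep t F F'"
    using C1(2)[OF vs] unfolding rep_def by blast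
  then obtain V V' where VV': "\<And>t. 0 \<le> t \<Longrightarrow> rep t (V t) (V' t)" by metis
  have V: "(V t has_real_derivative V' t x) (at x)" and V'c: "continuous_on UNIV (V' t)"
    and vV: "AE x in lborel. v t x = V t x"
    and Vb: "\<bar>V t x\<bar> \<le> C1 * sobolev_norm s (v t)" "\<bar>V' t x\<bar> \<le> C1 * sobolev_norm s (v t)" if "0 \<le> t" for t x
    using VV'[OF that] unfolding rep_def by blast+
  have Vc: "continuous_on UNIV (V t)" if "0 \<le> t" for t
    using V[OF that] by (meson DERIV_isCont continuous_at_imp_continuous_on)
  have "\<forall>t. \<exists>F. 0 \<le> t \<longrightarrow> continuous_on UNIV F \<and> (AE x in lborel. w t x = F x)"
    using C0(2)[OF ws] by blast
  from choice[OF this] obtain W where WW: "\<forall>t. 0 \<le> t \<longrightarrow> continuous_on UNIV (W t) \<and> (AE x in lborel. w t x = W t x)"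
    by blast
  have Wc: "continuous_on UNIV (W t)" and wW: "AE x in lborel. w t x = W t x" if "0 \<le> t" for t
    using WW that by blast+
  have dV: "\<bar>V \<tau> x - V t x\<bar> \<le> C1 * sobolev_norm s (\<lambda>x. v \<tau> x - v t x)"
    "\<bar>V' \<tau> x - V' t x\<bar> \<le> C1 * sobolev_norm s (\<lambda>x. v \<tau> x - v t x)" if t: "0 \<le> t" "0 \<le> \<tau>" for t \<tau> x
  proof -
    obtain F F' where F: "\<And>x. (F has_real_derivative F' x) (at x)"
      "AE x in lborel. v \<tau> x - v t x = F x"
      "\<And>x. \<bar>F x\<bar> \<le> C1 * sobolev_norm s (\<lambda>x. v \<tau> x - v t x)" "\<And>x. \<bar>F' x\<bar> \<le> C1 * sobolev_norm s (\<lambda>x. v \<tau> x - v t x)"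
      using C1(2)[OF sobolev_diff[OF vs vs], OF t(2,1)] by blast
    have "F = (\<lambda>x. V \<tau> x - V t x)"
    proof (rule AE_eq_continuous_imp_eq)
      show "continuous_on UNIV F" using F(1) by (meson DERIV_isCont continuous_at_imp_continuous_on)
      show "continuous_on UNIV (\<lambda>x. V \<tau> x - V t x)" by (intro continuous_intros Vc t)
      show "AE x in lborel. F x = V \<tau> x - V t x"
        using F(2) vV[OF t(1)] vV[OF t(2)] by eventually_elim simp
    qed
    moreover from this have "F' x = V' \<tau> x - V' t x" for x
      using F(1)[of x] DERIV_diff[OF V[OF t(2)] V[OF t(1)], of x] DERIV_unique by blast
    ultimately show "\<bar>V \<tau> x - V t x\<bar> \<le> C1 * sobolev_norm s (\<lambda>x. v \<tau> x - v t x)"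
      "\<bar>V' \<tau> x - V' t x\<bar> \<le> C1 * sobolev_norm s (\<lambda>x. v \<tau> x - v t x)"
      using F(3,4)[of x] by auto
  qed
  have dW: "\<bar>(V \<tau> x - V t x) / (\<tau> - t) - W t x\<bar> \<le> C0 * sobolev_norm (s - 1) (\<lambda>x. (v \<tau> x - v t x) / (\<tau> - t) - w t x)"
    if t: "0 \<le> t" "0 \<le> \<tau>" for t \<tau> x
  proof -
    have "v t \<in> sobolev (s - 1)" "v \<tau> \<in> sobolev (s - 1)" using sobolev_mono[OF vs] t by auto
    then have "(\<lambda>x. (v \<tau> x - v t x) / (\<tau> - t) - w t x) \<in> sobolev (s - 1)"
      by (intro sobolev_diff[of "\<lambda>x. (v \<tau> x - v t x) / (\<tau> - t)"] sobolev_divide[of "\<lambda>x. v \<tau> x - v t x"] sobolev_diff[of "v \<tau>"] ws t)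
    from C0(2)[OF this] obtain F where F: "continuous_on UNIV F"
      "AE x in lborel. (v \<tau> x - v t x) / (\<tau> - t) - w t x = F x"
      "\<And>x. \<bar>F x\<bar> \<le> C0 * sobolev_norm (s - 1) (\<lambda>x. (v \<tau> x - v t x) / (\<tau> - t) - w t x)"
      by blast
    have "F = (\<lambda>x. (V \<tau> x - V t x) / (\<tau> - t) - W t x)"
    proof (rule AE_eq_continuous_imp_eq[OF F(1)])
      show "continuous_on UNIV (\<lambda>x. (V \<tau> x - V t x) / (\<tau> - t) - W t x)"
        unfolding divide_inverse by (intro continuous_intros Vc Wc t)
      show "AE x in lborel. F x = (V \<tau> x - V t x) / (\<tau> - t) - W t x"
        using F(2) vV[OF t(1)] vV[OF t(2)] wW[OF t(1)] by eventually_elim simp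
    qed
    then show ?thesis using F(3)[of x] by simp
  qed
  have c2: "c\<^sup>2 = real d" by (simp add: c_def)
  have v0V: "AE x in lborel. v0 x = V 0 x"
    using v_init vV[OF order_refl] by eventually_elim simp
  have init: "V 0 x0 + c * V' 0 x0 < 0" "0 < V 0 x0 - c * V' 0 x0"
    using initial_slope[OF c c2 V[OF order_refl] V'c[OF order_refl] v0V
        sobolev_measurable[OF \<open>v0 \<in> sobolev s\<close>] Vb[OF order_refl] assms(4-6)] by auto
  define m where "m = min (- (V 0 x0 + c * V' 0 x0)) (V 0 x0 - c * V' 0 x0)"
  have m: "0 < m" using init by (simp add: m_def)
  \<comment> \<open>At this time the lower bound on the growth has become infinite.\<close>
  define \<tau> where "\<tau> = 2 / (c * m)"
  have "c / 2 * \<tau> * m < 1"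
    unfolding m_def
  proof (rule blowup_time_bound[OF c, where V = V and V' = V' and W = W])
    show "0 \<le> \<tau>" using c m by (simp add: \<tau>_def)
    fix t assume "t \<in> {0..\<tau>}"
    then have t: "0 \<le> t" by simp
    have sub: "{0..\<tau>} \<subseteq> {0..}" by auto
    have n1: "((\<lambda>\<tau>. sobolev_norm s (\<lambda>x. v \<tau> x - v t x)) \<longlongrightarrow> 0) (at t within {0..\<tau>})"
      using v_cont t sub by (auto simp: continuous_into_sobolev_def intro: tendsto_within_subset)
    have n2: "((\<lambda>\<tau>. sobolev_norm (s - 1) (\<lambda>x. (v \<tau> x - v t x) / (\<tau> - t) - w t x)) \<longlongrightarrow> 0) (at t within {0..\<tau>})"
      using v_deriv t sub by (auto simp: has_sobolev_derivative_def intro: tendsto_within_subset)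
    show "(V t has_real_derivative V' t x) (at x)" for x by (rule V[OF t])
    show "continuous_on UNIV (V' t)" by (rule V'c[OF t])
    show "continuous_on UNIV (W t)" by (rule Wc[OF t])
    show "\<exists>K. \<forall>x. \<bar>V t x\<bar> \<le> K" "\<exists>K. \<forall>x. \<bar>V' t x\<bar> \<le> K" using Vb[OF t] by blast+
    show "uniform_limit UNIV V (V t) (at t within {0..\<tau>})"
      by (rule uniform_limit_if_dominated[OF dV(1) n1]) (use t in auto)
    show "uniform_limit UNIV V' (V' t) (at t within {0..\<tau>})"
      by (rule uniform_limit_if_dominated[OF dV(2) n1]) (use t in auto)
    show "uniform_limit UNIV (\<lambda>\<tau> x. (V \<tau> x - V t x) / (\<tau> - t)) (W t) (at t within {0..\<tau>})"
      by (rule uniform_limit_if_dominated[OF dW n2]) (use t in auto)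
    obtain vx q where vxq: "has_weak_derivative (v t) vx"
      "has_weak_derivative (inverse_helmholtz d (\<lambda>x. real d * (v t x)\<^sup>2 + (real d)\<^sup>2 / 2 * (vx x)\<^sup>2)) q"
      "AE x in lborel. w t x + real d * v t x * vx x = - q x"
      using v_eq[OF t] by blast
    show "W t x + c\<^sup>2 * V t x * V' t x
      = - ((right_potential c (\<lambda>x. c\<^sup>2 * (V t x)\<^sup>2 + c ^ 4 / 2 * (V' t x)\<^sup>2) x
        - left_potential c (\<lambda>x. c\<^sup>2 * (V t x)\<^sup>2 + c ^ 4 / 2 * (V' t x)\<^sup>2) x) / (2 * c\<^sup>2))" for x
      by (rule pointwise_equation[OF c c_def vs[OF t] V[OF t] V'c[OF t] vV[OF t] Vb[OF t] Wc[OF t] wW[OF t] vxq])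
  qed (use init in auto)
  then show False using c m by (simp add: \<tau>_def)
qed

end
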